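(* Let $\mathfrak g$ be a finite-dimensional Lie algebra over a field $\Bbbk$, with basis $X_1,\dots,X_n$ and structure constants $C_{ij}^k$ determined from $[X_i,X_j]=\sum_kC_{ij}^kX_k$ for $i,j\in\{1,\dots,n\}$. Let $\mathcal H$ be a Hopf $\Bbbk$-algebra in a Hopf pairing $\langle\,,\rangle\colon U(\mathfrak g)\otimes\mathcal H\to\Bbbk$ with $U(\mathfrak g)$. If there exist some elements $\mathcal O^i_j,\bar{\mathcal O}^i_j$, $i,j\in\{1,\dots,n\}$, of $\mathcal H$ such that for all $i,j,k$ $$\langle X_k,\mathcal O^i_j\rangle=C^i_{kj},\qquad \sum_{l,m}C^k_{lm}\mathcal O^l_i\mathcal O^m_j=\sum_r\mathcal O^k_rC^r_{ij},\qquad \sum_j\mathcal O^i_j\bar{\mathcal O}^j_k=\delta^i_k=\sum_j\bar{\mathcal O}^i_j\mathcal O^j_k,$$ and such that the coalgebra structure maps and the antipode of $\mathcal H$ satisfy, for all $i,j$, $$\Delta(\mathcal O^i_j)=\sum_k\mathcal O^i_k\otimes\mathcal O^k_j,\quad\Delta(\bar{\mathcal O}^i_j)=\sum_k\bar{\mathcal O}^k_j\otimes\bar{\mathcal O}^i_k,\quad\epsilon(\mathcal O^i_j)=\delta^i_j=\epsilon(\bar{\mathcal O}^i_j),\quad S(\mathcal O^i_j)=\bar{\mathcal O}^i_j,\quad S(\bar{\mathcal O}^i_j)=\mathcal O^i_j,$$ and if any one of these conditions is met: (a) $\Bbbk$ is $\mathbb R$ or $\mathbb C$, $G$ is a Lie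 group, $\mathcal H\subset C^\infty(G)$ as an algebra and its coalgebra structure and antipode are the transpose of the group structure of $G$, and $\mathcal O^i_j,\bar{\mathcal O}^i_j$ are exactly the components of the matrix of $\mathrm{Ad}$ and its inverse in the chosen basis of $\mathfrak g$, or (b) $\Bbbk$ is $\mathbb R$ or $\mathbb C$, $G$ is a Lie group, $\mathcal H\subset C^\infty(G,e)$ as an algebra and its coalgebra structure and antipode are the transpose of the group structure of $G$, and $\mathcal O^i_j,\bar{\mathcal O}^i_j$ are exactly the germs of the components of the matrix of $\mathrm{Ad}$ and its inverse in the chosen basis of $\mathfrak g$, or (c) $\Bbbk$ is any field, $G$ is an affine algebraic group over $\Bbbk$ and $\mathcal H$ is a Hopf algebra such that $\mathcal H\subset\mathcal O(G)$ as a Hopf subalgebra, or (d) the pairing $U(\mathfrak g)\otimes\mathcal H\to\Bbbk$ is non-degenerate in the second variable, that is, $\mathcal H$ is essentially a Hopf subalgebra of the finite dual $U(\mathfrak g)^\circ$ of $U(\mathfrak g)$, then $(U(\mathfrak g),\blacktriangleleft',\lambda')$ is a braided commutative right-left Yetter–Drinfeld module algebra over $\mathcal H$, where the right action is induced by the pairing by the formula $X\blacktriangleleft' f=\sum\langle X_{(1)},f\rangle X_{(2)}$ and the left coaction is defined on the Lie algebra generators by $\lambda'(X_j)=\sum_i\bar{\mathcal O}^i_j\otimes X_i$. Likewise, $(U(\mathfrak g)^{\mathrm{op}},\blacktriangleleft,\lambda)$ is a braided commutative right-left Yetter–Drinfeld module algebra over $\mathcal H^{\mathrm{co}}$, where the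 right action is induced by the pairing by the formula $Y\blacktriangleleft f=\sum\langle Y_{(1)},f\rangle Y_{(2)}$ and the left coaction is defined on the Lie algebra generators by $\lambda(Y_j)=\sum_i\mathcal O^i_j\otimes Y_i$.
   Context: A Hopf pairing of Hopf algebras $A,H$ is a bilinear pairing (not required to be non-degenerate) with $\langle\Delta(a),h\otimes h'\rangle=\langle a,hh'\rangle$, $\langle a\otimes b,\Delta(h)\rangle=\langle ab,h\rangle$, $\langle a,1\rangle=\epsilon(a)$, $\langle1,h\rangle=\epsilon(h)$, $\langle S(a),h\rangle=\langle a,S(h)\rangle$. Non-degenerate in the second variable means: $\langle D,f\rangle=0$ for all $D$ implies $f=0$. $\mathcal H^{\mathrm{co}}$ is $\mathcal H$ with opposite comultiplication. $U(\mathfrak g)^{\mathrm{op}}$ has the opposite multiplication and the same comultiplication as $U(\mathfrak g)$; $Y_j$ denotes $X_j$ viewed as a generator of $U(\mathfrak g)^{\mathrm{op}}$, and $U(\mathfrak g)^{\mathrm{op}}$ is paired with $\mathcal H^{\mathrm{co}}$ by the same pairing. In (a)–(c), the setting is that $G$ is a group over $\Bbbk$ (Lie group or affine algebraic group) with Lie algebra $\mathfrak g$, the Lie algebra of left invariant derivations $D$ of the function algebra ($D(f\circ L_g)=D(f)\circ L_g$, $L_g(a)=ga$), and the pairing is $\langle D,f\rangle=(Df)(e)$, with $U(\mathfrak g)$ acting on functions by composing derivations. $C^\infty(G)$ is the algebra of smooth functions on $G$, $C^\infty(G,e)$ the algebra of germs of smooth functions around the unit $e$, and $\mathcal O(G)$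 the Hopf algebra of regular functions. Coalgebra structure and antipode transposed from the group structure: $\Delta(f)(a\otimes b)=f(ab)$, $\epsilon(f)=f(e)$, $S(f)(a)=f(a^{-1})$. $\mathrm{Ad}$ is the adjoint representation of $G$ on its Lie algebra. A right action of a bialgebra $H$ on an algebra $A$ is Hopf if $(ab)\blacktriangleleft h=\sum(a\blacktriangleleft h_{(1)})(b\blacktriangleleft h_{(2)})$ and $1\blacktriangleleft h=\epsilon(h)1$; then the smash product $H\# A$ is $H\otimes A$ with $(h\# a)(h'\# a')=\sum hh'_{(1)}\#(a\blacktriangleleft h'_{(2)})a'$. The coactions given on generators are extended to antimultiplicative unital linear maps $\lambda'\colon U(\mathfrak g)\to\mathcal H\# U(\mathfrak g)$ and $\lambda\colon U(\mathfrak g)^{\mathrm{op}}\to\mathcal H^{\mathrm{co}}\# U(\mathfrak g)^{\mathrm{op}}$, read as maps into the underlying tensor products. A right-left Yetter–Drinfeld module algebra over a bialgebra $H$ is an algebra $A$ with a right Hopf action $\blacktriangleleft$ of $H$ and a left $H$-comodule structure $\lambda(a)=\sum a_{[-1]}\otimes a_{[0]}$ such that for all $a,b\in A$, $h\in H$: $\sum a_{[-1]}h_{(1)}\otimes(a_{[0]}\blacktriangleleft h_{(2)})=\sum h_{(2)}(a\blacktriangleleft h_{(1)})_{[-1]}\otimes(a\blacktriangleleft h_{(1)})_{[0]}$; $\lambda(ab)=\sum b_{[-1]}a_{[-1]}\otimes a_{[0]}b_{[0]}$; $\lambda(1)=1\otimes1$. It is braided commutative if $\sum(a\blacktriangleleft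 b_{[-1]})b_{[0]}=ba$ for all $a,b\in A$.
   Formalization: In case (c) it is additionally required that the O^i_j are the components of the matrix of Ad in the chosen basis, as in (a) and (b); without this (c) is false, e.g. for G = O(2) over C, H = O(G), O = 1. *)

theory Defs
  imports
    "HOL-Analysis.Analysis"
    "HOL-Library.Function_Algebras"
    "HOL-Library.Poly_Mapping"
begin

section \<open>Tensor products of vector spaces\<close>

text \<open>
  Vector spaces over a field are types with an explicit scalar multiplication (locale
  \<^locale>\<open>vector_space\<close>).  The tensor product of V and W is realised inside the dual of the space of
  bilinear forms on V and W: a pure tensor is evaluation at a pair, and the tensor product is the
  span of the pure tensors.  Over a field the canonical map from the tensor product to that dual is
  injective, so this is the usual tensor product.
\<close>

type_synonym ('v, 'w, 'k) tensor = "('v \<Rightarrow> 'w \<Rightarrow> 'k) \<Rightarrow> 'k"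
type_synonym ('u, 'v, 'w, 'k) tensor3 = "('u \<Rightarrow> 'v \<Rightarrow> 'w \<Rightarrow> 'k) \<Rightarrow> 'k"

definition bilinear_over ::
  "('k::field \<Rightarrow> 'v::ab_group_add \<Rightarrow> 'v) \<Rightarrow> ('k \<Rightarrow> 'w::ab_group_add \<Rightarrow> 'w) \<Rightarrow>
   ('k \<Rightarrow> 'x::ab_group_add \<Rightarrow> 'x) \<Rightarrow> ('v \<Rightarrow> 'w \<Rightarrow> 'x) \<Rightarrow> bool" where
  "bilinear_over s1 s2 s3 F \<longleftrightarrow>
     (\<forall>v. Vector_Spaces.linear s2 s3 (F v)) \<and> (\<forall>w. Vector_Spaces.linear s1 s3 (\<lambda>v. F v w))"

definition trilinear_form ::
  "('k::field \<Rightarrow> 'u::ab_group_add \<Rightarrow> 'u) \<Rightarrow> ('k \<Rightarrow> 'v::ab_group_add \<Rightarrow> 'v) \<Rightarrow>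
   ('k \<Rightarrow> 'w::ab_group_add \<Rightarrow> 'w) \<Rightarrow> ('u \<Rightarrow> 'v \<Rightarrow> 'w \<Rightarrow> 'k) \<Rightarrow> bool" where
  "trilinear_form s1 s2 s3 F \<longleftrightarrow>
     (\<forall>u. bilinear_over s2 s3 (*) (F u)) \<and>
     (\<forall>v w. Vector_Spaces.linear s1 (*) (\<lambda>u. F u v w))"

definition tens ::
  "('k::field \<Rightarrow> 'v::ab_group_add \<Rightarrow> 'v) \<Rightarrow> ('k \<Rightarrow> 'w::ab_group_add \<Rightarrow> 'w) \<Rightarrow>
   'v \<Rightarrow> 'w \<Rightarrow> ('v, 'w, 'k) tensor" where
  "tens s1 s2 v w = (\<lambda>B. if bilinear_over s1 s2 (*) B then B v w else 0)"

definition tens3 ::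
  "('k::field \<Rightarrow> 'u::ab_group_add \<Rightarrow> 'u) \<Rightarrow> ('k \<Rightarrow> 'v::ab_group_add \<Rightarrow> 'v) \<Rightarrow>
   ('k \<Rightarrow> 'w::ab_group_add \<Rightarrow> 'w) \<Rightarrow> 'u \<Rightarrow> 'v \<Rightarrow> 'w \<Rightarrow> ('u, 'v, 'w, 'k) tensor3" where
  "tens3 s1 s2 s3 u v w = (\<lambda>B. if trilinear_form s1 s2 s3 B then B u v w else 0)"

definition tscale :: "'k::field \<Rightarrow> ('b \<Rightarrow> 'k) \<Rightarrow> 'b \<Rightarrow> 'k" where
  "tscale c t = (\<lambda>B. c * t B)"

definition tensor_space ::
  "('k::field \<Rightarrow> 'v::ab_group_add \<Rightarrow> 'v) \<Rightarrow> ('k \<Rightarrow> 'w::ab_group_add \<Rightarrow> 'w) \<Rightarrow>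
   ('v, 'w, 'k) tensor set" where
  "tensor_space s1 s2 = module.span tscale (range (\<lambda>(v, w). tens s1 s2 v w))"

text \<open>
  \<open>sweedler s1 s2 F t\<close> is the Sweedler sum of \<open>F t\<^sub>1 t\<^sub>2\<close>, i.e. the value at \<open>t\<close> of the linear map on
  the tensor product induced by a bilinear \<open>F\<close>.  It is computed on an arbitrary presentation of
  \<open>t\<close> as a sum of pure tensors; the lemma \<open>sweedler_sum_list\<close> below shows that the choice does not
  matter.
\<close>

definition sweedler ::
  "('k::field \<Rightarrow> 'v::ab_group_add \<Rightarrow> 'v) \<Rightarrow> ('k \<Rightarrow> 'w::ab_group_add \<Rightarrow> 'w) \<Rightarrow>
   ('v \<Rightarrow> 'w \<Rightarrow> 'x::ab_group_add) \<Rightarrow> ('v, 'w, 'k) tensor \<Rightarrow> 'x" where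
  "sweedler s1 s2 F t =
     (\<Sum>(v, w)\<leftarrow>(SOME xs. t = (\<Sum>(v, w)\<leftarrow>xs. tens s1 s2 v w)). F v w)"

lemma sum_list_tens_apply:
  assumes "bilinear_over s1 s2 (*) B"
  shows "(\<Sum>(v, w)\<leftarrow>xs. tens s1 s2 v w) B = (\<Sum>(v, w)\<leftarrow>xs. B v w)"
  by (induction xs) (auto simp: tens_def assms)

lemma sweedler_sum_list:
  fixes s1 :: "'k::field \<Rightarrow> 'v::ab_group_add \<Rightarrow> 'v" and s2 :: "'k \<Rightarrow> 'w::ab_group_add \<Rightarrow> 'w"
    and s3 :: "'k \<Rightarrow> 'x::ab_group_add \<Rightarrow> 'x"
  assumes F: "bilinear_over s1 s2 s3 F"
  shows "sweedler s1 s2 F (\<Sum>(v, w)\<leftarrow>xs. tens s1 s2 v w) = (\<Sum>(v, w)\<leftarrow>xs. F v w)"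
proof -
  define ys where
    "ys = (SOME ys. (\<Sum>(v, w)\<leftarrow>xs. tens s1 s2 v w) = (\<Sum>(v, w)\<leftarrow>ys. tens s1 s2 v w))"
  have ys: "(\<Sum>(v, w)\<leftarrow>xs. tens s1 s2 v w) = (\<Sum>(v, w)\<leftarrow>ys. tens s1 s2 v w)"
    unfolding ys_def by (rule someI[of _ xs]) simp
  have lin: "Vector_Spaces.linear s2 s3 (F undefined)"
    using F by (simp add: bilinear_over_def)
  then interpret X: vector_space s3
    by (simp add: Vector_Spaces.linear_def)
  interpret K: vector_space "(*) :: 'k \<Rightarrow> 'k \<Rightarrow> 'k"
    by unfold_locales (simp_all add: algebra_simps)
  interpret XK: vector_space_pair s3 "(*) :: 'k \<Rightarrow> 'k \<Rightarrow> 'k" ..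
  have agree: "f (\<Sum>(v, w)\<leftarrow>ys. F v w) = f (\<Sum>(v, w)\<leftarrow>xs. F v w)"
    if f: "Vector_Spaces.linear s3 (*) f" for f
  proof -
    interpret f: Vector_Spaces.linear s3 "(*)" f by (rule f)
    have B: "bilinear_over s1 s2 (*) (\<lambda>v w. f (F v w))"
      unfolding bilinear_over_def
    proof (intro conjI allI)
      fix v
      have "Vector_Spaces.linear s2 s3 (F v)" using F by (simp add: bilinear_over_def)
      from Vector_Spaces.linear_compose[OF this f]
      show "Vector_Spaces.linear s2 (*) (\<lambda>w. f (F v w))" by (simp add: o_def)
    next
      fix w
      have "Vector_Spaces.linear s1 s3 (\<lambda>v. F v w)" using F by (simp add: bilinear_over_def)
      from Vector_Spaces.linear_compose[OF this f]
      show "Vector_Spaces.linear s1 (*) (\<lambda>v. f (F v w))" by (simp add: o_def)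
    qed
    have fs: "f (\<Sum>(v, w)\<leftarrow>zs. F v w) = (\<Sum>(v, w)\<leftarrow>zs. f (F v w))" for zs
      by (induction zs) (auto simp: f.add f.zero)
    show ?thesis
      using fun_cong[OF ys, of "\<lambda>v w. f (F v w)"] by (simp add: sum_list_tens_apply[OF B] fs)
  qed
  have "(\<Sum>(v, w)\<leftarrow>ys. F v w) = (\<Sum>(v, w)\<leftarrow>xs. F v w)"
  proof (rule ccontr)
    assume "\<not> ?thesis"
    then have ne: "(\<Sum>(v, w)\<leftarrow>ys. F v w) - (\<Sum>(v, w)\<leftarrow>xs. F v w) \<noteq> 0" (is "?d \<noteq> 0") by simp
    then have ind: "X.independent {?d}"
      by (simp add: X.dependent_single)
    obtain f where f: "Vector_Spaces.linear s3 (*) f" "\<forall>x\<in>{?d}. f x = (1 :: 'k)"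
      using XK.linear_independent_extend[OF ind, of "\<lambda>_. 1"] by blast
    interpret f: Vector_Spaces.linear s3 "(*)" f by (rule f)
    show False
      using f(2) agree[OF f(1)] by (simp add: f.diff)
  qed
  then show ?thesis
    by (simp add: sweedler_def flip: ys_def)
qed

section \<open>Algebras, bialgebras, Hopf algebras, Hopf pairings\<close>

text \<open>
  Multiplication and unit are explicit parameters because an algebra and its opposite live on the
  same type.
\<close>

locale assoc_algebra = vector_space scale
  for scale :: "'k::field \<Rightarrow> 'a::ab_group_add \<Rightarrow> 'a" +
  fixes mult :: "'a \<Rightarrow> 'a \<Rightarrow> 'a" and unit :: 'a
  assumes mult_bilinear: "bilinear_over scale scale scale mult"
    and mult_assoc: "mult (mult a b) c = mult a (mult b c)"
    and unit_left: "mult unit a = a"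
    and unit_right: "mult a unit = a"

locale bialgebra = assoc_algebra scale "(*)" 1
  for scale :: "'k::field \<Rightarrow> 'h::ring_1 \<Rightarrow> 'h" +
  fixes \<Delta> :: "'h \<Rightarrow> ('h, 'h, 'k) tensor" and \<epsilon> :: "'h \<Rightarrow> 'k"
  assumes comult_in: "\<Delta> h \<in> tensor_space scale scale"
    and comult_linear: "Vector_Spaces.linear scale tscale \<Delta>"
    and counit_linear: "Vector_Spaces.linear scale (*) \<epsilon>"
    and coassoc:
      "sweedler scale scale (\<lambda>a b. sweedler scale scale (\<lambda>a1 a2. tens3 scale scale scale a1 a2 b) (\<Delta> a)) (\<Delta> h)
       = sweedler scale scale (\<lambda>a b. sweedler scale scale (\<lambda>b1 b2. tens3 scale scale scale a b1 b2) (\<Delta> b)) (\<Delta> h)"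
    and counit_left: "sweedler scale scale (\<lambda>a b. scale (\<epsilon> a) b) (\<Delta> h) = h"
    and counit_right: "sweedler scale scale (\<lambda>a b. scale (\<epsilon> b) a) (\<Delta> h) = h"
    and comult_mult:
      "\<Delta> (h * h') = sweedler scale scale (\<lambda>a b.
          sweedler scale scale (\<lambda>a' b'. tens scale scale (a * a') (b * b')) (\<Delta> h')) (\<Delta> h)"
    and comult_one: "\<Delta> 1 = tens scale scale 1 1"
    and counit_mult: "\<epsilon> (h * h') = \<epsilon> h * \<epsilon> h'"
    and counit_one: "\<epsilon> 1 = 1"

locale hopf_algebra = bialgebra scale \<Delta> \<epsilon>
  for scale :: "'k::field \<Rightarrow> 'h::ring_1 \<Rightarrow> 'h" and \<Delta> \<epsilon> +
  fixes S :: "'h \<Rightarrow> 'h"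
  assumes antipode_linear: "Vector_Spaces.linear scale scale S"
    and antipode_left: "sweedler scale scale (\<lambda>a b. S a * b) (\<Delta> h) = scale (\<epsilon> h) 1"
    and antipode_right: "sweedler scale scale (\<lambda>a b. a * S b) (\<Delta> h) = scale (\<epsilon> h) 1"

definition co_opposite ::
  "('k::field \<Rightarrow> 'h::ab_group_add \<Rightarrow> 'h) \<Rightarrow> ('h \<Rightarrow> ('h, 'h, 'k) tensor) \<Rightarrow>
   'h \<Rightarrow> ('h, 'h, 'k) tensor" where
  "co_opposite s \<Delta> h = sweedler s s (\<lambda>a b. tens s s b a) (\<Delta> h)"

locale hopf_pairing =
  A: hopf_algebra sA \<Delta>A \<epsilon>A SA + H: hopf_algebra sH \<Delta>H \<epsilon>H SH
  for sA :: "'k::field \<Rightarrow> 'a::ring_1 \<Rightarrow> 'a" and \<Delta>A \<epsilon>A SA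
    and sH :: "'k \<Rightarrow> 'h::ring_1 \<Rightarrow> 'h" and \<Delta>H \<epsilon>H SH +
  fixes pair :: "'a \<Rightarrow> 'h \<Rightarrow> 'k"
  assumes pair_bilinear: "bilinear_over sA sH (*) pair"
    and pair_mult_right: "sweedler sA sA (\<lambda>a1 a2. pair a1 h * pair a2 h') (\<Delta>A a) = pair a (h * h')"
    and pair_mult_left: "sweedler sH sH (\<lambda>h1 h2. pair a h1 * pair b h2) (\<Delta>H h) = pair (a * b) h"
    and pair_one_right: "pair a 1 = \<epsilon>A a"
    and pair_one_left: "pair 1 h = \<epsilon>H h"
    and pair_antipode: "pair (SA a) h = pair a (SH h)"

definition nondegenerate_right :: "('a \<Rightarrow> 'h::zero \<Rightarrow> 'k::zero) \<Rightarrow> bool" where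
  "nondegenerate_right pair \<longleftrightarrow> (\<forall>h. (\<forall>a. pair a h = 0) \<longrightarrow> h = 0)"

section \<open>Lie algebras and their universal enveloping algebras\<close>

locale lie_algebra = vector_space scale
  for scale :: "'k::field \<Rightarrow> 'g::ab_group_add \<Rightarrow> 'g" +
  fixes bracket :: "'g \<Rightarrow> 'g \<Rightarrow> 'g"
  assumes bracket_bilinear: "bilinear_over scale scale scale bracket"
    and bracket_alternating: "bracket x x = 0"
    and jacobi: "bracket x (bracket y z) + bracket y (bracket z x) + bracket z (bracket x y) = 0"

definition is_basis ::
  "('k::field \<Rightarrow> 'g::ab_group_add \<Rightarrow> 'g) \<Rightarrow> nat \<Rightarrow> (nat \<Rightarrow> 'g) \<Rightarrow> bool" where
  "is_basis s n X \<longleftrightarrow> inj_on X {1..n} \<and> \<not> module.dependent s (X ` {1..n}) \<and>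
     module.span s (X ` {1..n}) = UNIV"

text \<open>
  Elements of the free associative algebra on the underlying set of a Lie algebra are the finitely
  supported functions on words.  The set below is its two-sided ideal generated by
  \<open>[x + y] - [x] - [y]\<close>, \<open>[c x] - c [x]\<close> (whose quotient is the tensor algebra) and
  \<open>[x][y] - [y][x] - [bracket x y]\<close>.  The words \<open>u\<close>, \<open>v\<close> in the generators make it an ideal.
\<close>

inductive_set enveloping_ideal ::
  "('k::field \<Rightarrow> 'g::ab_group_add \<Rightarrow> 'g) \<Rightarrow> ('g \<Rightarrow> 'g \<Rightarrow> 'g) \<Rightarrow> ('g list \<Rightarrow>\<^sub>0 'k) set"
  for s bracket where
  zero: "0 \<in> enveloping_ideal s bracket"
| plus: "p \<in> enveloping_ideal s bracket \<Longrightarrow> q \<in> enveloping_ideal s bracket \<Longrightarrow>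
    p + q \<in> enveloping_ideal s bracket"
| scale: "p \<in> enveloping_ideal s bracket \<Longrightarrow>
    Poly_Mapping.map ((*) c) p \<in> enveloping_ideal s bracket"
| generator_plus: "Poly_Mapping.single (u @ [x + y] @ v) 1 - Poly_Mapping.single (u @ [x] @ v) 1
    - Poly_Mapping.single (u @ [y] @ v) 1 \<in> enveloping_ideal s bracket"
| generator_scale: "Poly_Mapping.single (u @ [s c x] @ v) 1 - Poly_Mapping.single (u @ [x] @ v) c
    \<in> enveloping_ideal s bracket"
| generator_bracket: "Poly_Mapping.single (u @ [x, y] @ v) 1 - Poly_Mapping.single (u @ [y, x] @ v) 1
    - Poly_Mapping.single (u @ [bracket x y] @ v) 1 \<in> enveloping_ideal s bracket"

definition evaluate_words ::
  "('k::field \<Rightarrow> 'u::ring_1 \<Rightarrow> 'u) \<Rightarrow> ('g \<Rightarrow> 'u) \<Rightarrow> ('g list \<Rightarrow>\<^sub>0 'k) \<Rightarrow> 'u" where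
  "evaluate_words sU inc p =
     (\<Sum>w\<in>Poly_Mapping.keys p. sU (Poly_Mapping.lookup p w) (prod_list (map inc w)))"

text \<open>
  The algebra \<open>'u\<close> together with the map \<open>inc\<close> is a copy of the quotient of the free algebra by the
  ideal above, i.e. of the universal enveloping algebra; the Hopf structure is the one for which the
  elements of the Lie algebra are primitive.
\<close>

locale enveloping_hopf_algebra =
  L: lie_algebra sg bracket + U: hopf_algebra sU \<Delta>U \<epsilon>U SU
  for sg :: "'k::field \<Rightarrow> 'g::ab_group_add \<Rightarrow> 'g" and bracket
    and sU :: "'k \<Rightarrow> 'u::ring_1 \<Rightarrow> 'u" and \<Delta>U \<epsilon>U SU +
  fixes inc :: "'g \<Rightarrow> 'u"
  assumes evaluate_surj: "surj (evaluate_words sU inc)"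
    and evaluate_kernel: "evaluate_words sU inc p = 0 \<longleftrightarrow> p \<in> enveloping_ideal sg bracket"
    and comult_inc: "\<Delta>U (inc x) = tens sU sU (inc x) 1 + tens sU sU 1 (inc x)"
    and counit_inc: "\<epsilon>U (inc x) = 0"
    and antipode_inc: "SU (inc x) = - inc x"

section \<open>Smash products and Yetter--Drinfeld module algebras\<close>

locale right_hopf_action =
  H: bialgebra sH \<Delta>H \<epsilon>H + A: assoc_algebra sA multA unitA
  for sH :: "'k::field \<Rightarrow> 'h::ring_1 \<Rightarrow> 'h" and \<Delta>H \<epsilon>H
    and sA :: "'k \<Rightarrow> 'a::ab_group_add \<Rightarrow> 'a" and multA unitA +
  fixes act :: "'a \<Rightarrow> 'h \<Rightarrow> 'a"
  assumes act_bilinear: "bilinear_over sA sH sA act"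
    and act_one: "act a 1 = a"
    and act_mult: "act (act a h) h' = act a (h * h')"
    and act_hopf_mult:
      "act (multA a b) h = sweedler sH sH (\<lambda>h1 h2. multA (act a h1) (act b h2)) (\<Delta>H h)"
    and act_hopf_unit: "act unitA h = sA (\<epsilon>H h) unitA"

definition smash_mult ::
  "('k::field \<Rightarrow> 'h::ring_1 \<Rightarrow> 'h) \<Rightarrow> ('h \<Rightarrow> ('h, 'h, 'k) tensor) \<Rightarrow>
   ('k \<Rightarrow> 'a::ab_group_add \<Rightarrow> 'a) \<Rightarrow> ('a \<Rightarrow> 'a \<Rightarrow> 'a) \<Rightarrow> ('a \<Rightarrow> 'h \<Rightarrow> 'a) \<Rightarrow>
   ('h, 'a, 'k) tensor \<Rightarrow> ('h, 'a, 'k) tensor \<Rightarrow> ('h, 'a, 'k) tensor" where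
  "smash_mult sH \<Delta>H sA multA act t t' =
     sweedler sH sA (\<lambda>h a. sweedler sH sA (\<lambda>h' a'. sweedler sH sH (\<lambda>h1 h2.
        tens sH sA (h * h1) (multA (act a h2) a')) (\<Delta>H h')) t') t"

definition antimultiplicative_to_smash ::
  "('k::field \<Rightarrow> 'h::ring_1 \<Rightarrow> 'h) \<Rightarrow> ('h \<Rightarrow> ('h, 'h, 'k) tensor) \<Rightarrow>
   ('k \<Rightarrow> 'a::ab_group_add \<Rightarrow> 'a) \<Rightarrow> ('a \<Rightarrow> 'a \<Rightarrow> 'a) \<Rightarrow> 'a \<Rightarrow> ('a \<Rightarrow> 'h \<Rightarrow> 'a) \<Rightarrow>
   ('a \<Rightarrow> ('h, 'a, 'k) tensor) \<Rightarrow> bool" where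
  "antimultiplicative_to_smash sH \<Delta>H sA multA unitA act coact \<longleftrightarrow>
     (\<forall>a. coact a \<in> tensor_space sH sA) \<and>
     Vector_Spaces.linear sA tscale coact \<and>
     coact unitA = tens sH sA 1 unitA \<and>
     (\<forall>a b. coact (multA a b) = smash_mult sH \<Delta>H sA multA act (coact b) (coact a))"

locale yetter_drinfeld_module_algebra =
  right_hopf_action sH \<Delta>H \<epsilon>H sA multA unitA act
  for sH :: "'k::field \<Rightarrow> 'h::ring_1 \<Rightarrow> 'h" and \<Delta>H \<epsilon>H
    and sA :: "'k \<Rightarrow> 'a::ab_group_add \<Rightarrow> 'a" and multA unitA act +
  fixes coact :: "'a \<Rightarrow> ('h, 'a, 'k) tensor"
  assumes coact_in: "coact a \<in> tensor_space sH sA"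
    and coact_linear: "Vector_Spaces.linear sA tscale coact"
    and coact_counit: "sweedler sH sA (\<lambda>h b. sA (\<epsilon>H h) b) (coact a) = a"
    and coact_coassoc:
      "sweedler sH sA (\<lambda>h b. sweedler sH sH (\<lambda>h1 h2. tens3 sH sH sA h1 h2 b) (\<Delta>H h)) (coact a)
       = sweedler sH sA (\<lambda>h b. sweedler sH sA (\<lambda>h' b'. tens3 sH sH sA h h' b') (coact b)) (coact a)"
    and yetter_drinfeld:
      "sweedler sH sA (\<lambda>a' a0. sweedler sH sH (\<lambda>h1 h2. tens sH sA (a' * h1) (act a0 h2)) (\<Delta>H h))
         (coact a)
       = sweedler sH sH (\<lambda>h1 h2. sweedler sH sA (\<lambda>a' a0. tens sH sA (h2 * a') a0)
           (coact (act a h1))) (\<Delta>H h)"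
    and coact_mult:
      "coact (multA a b) = sweedler sH sA (\<lambda>a' a0. sweedler sH sA (\<lambda>b' b0.
         tens sH sA (b' * a') (multA a0 b0)) (coact b)) (coact a)"
    and coact_unit: "coact unitA = tens sH sA 1 unitA"

text \<open>
  \<open>coact\<close> is the antimultiplicative unital linear extension of the assignment
  \<open>X\<^sub>j \<mapsto> \<Sum>\<^sub>i M\<^sup>i\<^sub>j \<otimes> X\<^sub>i\<close>.
\<close>

definition coaction_extending ::
  "('k::field \<Rightarrow> 'h::ring_1 \<Rightarrow> 'h) \<Rightarrow> ('h \<Rightarrow> ('h, 'h, 'k) tensor) \<Rightarrow>
   ('k \<Rightarrow> 'a::ab_group_add \<Rightarrow> 'a) \<Rightarrow> ('a \<Rightarrow> 'a \<Rightarrow> 'a) \<Rightarrow> 'a \<Rightarrow> ('a \<Rightarrow> 'h \<Rightarrow> 'a) \<Rightarrow>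
   nat \<Rightarrow> (nat \<Rightarrow> 'a) \<Rightarrow> (nat \<Rightarrow> nat \<Rightarrow> 'h) \<Rightarrow> ('a \<Rightarrow> ('h, 'a, 'k) tensor) \<Rightarrow> bool" where
  "coaction_extending sH \<Delta>H sA multA unitA act n X M coact \<longleftrightarrow>
     antimultiplicative_to_smash sH \<Delta>H sA multA unitA act coact \<and>
     (\<forall>j\<in>{1..n}. coact (X j) = (\<Sum>i\<in>{1..n}. tens sH sA (M i j) (X i)))"

definition braided_commutative ::
  "('k::field \<Rightarrow> 'h::ring_1 \<Rightarrow> 'h) \<Rightarrow> ('k \<Rightarrow> 'a::ab_group_add \<Rightarrow> 'a) \<Rightarrow> ('a \<Rightarrow> 'a \<Rightarrow> 'a) \<Rightarrow>
   ('a \<Rightarrow> 'h \<Rightarrow> 'a) \<Rightarrow> ('a \<Rightarrow> ('h, 'a, 'k) tensor) \<Rightarrow> bool" where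
  "braided_commutative sH sA multA act coact \<longleftrightarrow>
     (\<forall>a b. sweedler sH sA (\<lambda>b' b0. multA (act a b') b0) (coact b) = multA b a)"

definition pairing_action ::
  "('k::field \<Rightarrow> 'u::ab_group_add \<Rightarrow> 'u) \<Rightarrow> ('u \<Rightarrow> ('u, 'u, 'k) tensor) \<Rightarrow> ('u \<Rightarrow> 'h \<Rightarrow> 'k) \<Rightarrow>
   'u \<Rightarrow> 'h \<Rightarrow> 'u" where
  "pairing_action sU \<Delta>U pair u h = sweedler sU sU (\<lambda>u1 u2. sU (pair u1 h) u2) (\<Delta>U u)"

section \<open>Smooth manifolds and Lie groups over the real or complex numbers\<close>

text \<open>
  The real and the complex case are treated together: the base field \<open>B\<close> is the subset \<open>\<real>\<close> or
  \<open>UNIV\<close> of the complex numbers, and all derivatives are limits of difference quotients with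
  increments in \<open>B\<close>.  For \<open>B = \<real>\<close> smooth means infinitely often differentiable (with complex
  values), for \<open>B = UNIV\<close> it means holomorphic.  The coordinate space \<open>B\<^sup>m\<close> consists of the
  sequences vanishing from index \<open>m\<close> on, so that dimension 0 is allowed.
\<close>

definition coord_space :: "complex set \<Rightarrow> nat \<Rightarrow> (nat \<Rightarrow> complex) set" where
  "coord_space B m = {x. (\<forall>i<m. x i \<in> B) \<and> (\<forall>i\<ge>m. x i = 0)}"

primrec C_k_on ::
  "complex set \<Rightarrow> nat \<Rightarrow> nat \<Rightarrow> (nat \<Rightarrow> complex) set \<Rightarrow> ((nat \<Rightarrow> complex) \<Rightarrow> complex) \<Rightarrow> bool" where
  "C_k_on B m 0 W f \<longleftrightarrow> continuous_on W f"
| "C_k_on B m (Suc r) W f \<longleftrightarrow> continuous_on W f \<and>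
     (\<forall>i<m. \<exists>f'. (\<forall>x\<in>W. ((\<lambda>t. f (x(i := t))) has_field_derivative f' x) (at (x i) within B)) \<and>
        C_k_on B m r W f')"

definition C_infinity_on ::
  "complex set \<Rightarrow> nat \<Rightarrow> (nat \<Rightarrow> complex) set \<Rightarrow> ((nat \<Rightarrow> complex) \<Rightarrow> complex) \<Rightarrow> bool" where
  "C_infinity_on B m W f \<longleftrightarrow> (\<forall>r. C_k_on B m r W f)"

type_synonym 'p atlas = "('p set \<times> ('p \<Rightarrow> nat \<Rightarrow> complex)) set"

definition smooth_manifold ::
  "complex set \<Rightarrow> nat \<Rightarrow> 'p::{t2_space,second_countable_topology} atlas \<Rightarrow> bool" where
  "smooth_manifold B m \<A> \<longleftrightarrow>
     (\<Union>(U, c)\<in>\<A>. U) = UNIV \<and>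
     (\<forall>(U, c)\<in>\<A>. open U \<and> openin (top_of_set (coord_space B m)) (c ` U) \<and>
        (\<exists>d. homeomorphism U (c ` U) c d)) \<and>
     (\<forall>(U, c)\<in>\<A>. \<forall>(V, d)\<in>\<A>. \<forall>k<m.
        C_infinity_on B m (c ` (U \<inter> V)) (\<lambda>x. d (inv_into U c x) k))"

definition smooth_function_on ::
  "complex set \<Rightarrow> nat \<Rightarrow> 'p atlas \<Rightarrow> 'p set \<Rightarrow> ('p \<Rightarrow> complex) \<Rightarrow> bool" where
  "smooth_function_on B m \<A> W f \<longleftrightarrow>
     (\<forall>(U, c)\<in>\<A>. C_infinity_on B m (c ` (U \<inter> W)) (\<lambda>x. f (inv_into U c x)))"

definition smooth_map ::
  "complex set \<Rightarrow> nat \<Rightarrow> 'p::topological_space atlas \<Rightarrow> nat \<Rightarrow> 'q::topological_space atlas \<Rightarrow>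
   ('p \<Rightarrow> 'q) \<Rightarrow> bool" where
  "smooth_map B m \<A> l \<B> g \<longleftrightarrow> continuous_on UNIV g \<and>
     (\<forall>(U, c)\<in>\<A>. \<forall>(V, d)\<in>\<B>. \<forall>k<l.
        C_infinity_on B m (c ` (U \<inter> g -` V)) (\<lambda>x. d (g (inv_into U c x)) k))"

definition square_atlas :: "nat \<Rightarrow> 'p atlas \<Rightarrow> ('p \<times> 'p) atlas" where
  "square_atlas m \<A> =
     {(U \<times> V, \<lambda>(x, y) i. if i < m then c x i else d y (i - m)) | U c V d. (U, c) \<in> \<A> \<and> (V, d) \<in> \<A>}"

definition lie_group ::
  "complex set \<Rightarrow> nat \<Rightarrow> 'p::{t2_space,second_countable_topology} atlas \<Rightarrow>
   ('p \<Rightarrow> 'p \<Rightarrow> 'p) \<Rightarrow> 'p \<Rightarrow> ('p \<Rightarrow> 'p) \<Rightarrow> bool" where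
  "lie_group B m \<A> mul e ginv \<longleftrightarrow>
     B \<in> {\<real>, UNIV} \<and> Groups.group mul e ginv \<and> smooth_manifold B m \<A> \<and>
     smooth_map B (2 * m) (square_atlas m \<A>) m \<A> (\<lambda>(x, y). mul x y) \<and>
     smooth_map B m \<A> m \<A> ginv"

text \<open>
  The ground field is the field of real or the field of complex numbers, up to the isomorphism
  \<open>\<phi>\<close> onto its image.
\<close>

definition real_or_complex_field :: "('k::field \<Rightarrow> complex) \<Rightarrow> bool" where
  "real_or_complex_field \<phi> \<longleftrightarrow>
     (\<forall>x y. \<phi> (x + y) = \<phi> x + \<phi> y) \<and> (\<forall>x y. \<phi> (x * y) = \<phi> x * \<phi> y) \<and> \<phi> 1 = 1 \<and>
     range \<phi> \<in> {\<real>, UNIV}"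

section \<open>Global functions and germs on a Lie group\<close>

text \<open>
  Global functions and germs at the unit are treated together by a filter \<open>N\<close> on the group.  For
  \<open>N = top\<close>, \<open>germ_eq N\<close> is equality and \<open>smooth_functions\<close> below is the algebra of smooth
  functions on the group.  For \<open>N = nhds e\<close>, \<open>smooth_functions\<close> consists of the functions smooth on
  some neighbourhood of \<open>e\<close>, and its quotient by \<open>germ_eq N\<close> is the algebra of germs at \<open>e\<close>; maps
  from and to the quotient are given on representatives, with \<open>germ_eq N\<close> in place of equality.
\<close>

definition germ_eq :: "'p filter \<Rightarrow> ('p \<Rightarrow> 'k) \<Rightarrow> ('p \<Rightarrow> 'k) \<Rightarrow> bool" where
  "germ_eq N f f' \<longleftrightarrow> (\<forall>\<^sub>F x in N. f x = f' x)"

definition smooth_functions ::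
  "complex set \<Rightarrow> nat \<Rightarrow> 'p::topological_space atlas \<Rightarrow> ('k \<Rightarrow> complex) \<Rightarrow> 'p filter \<Rightarrow>
   ('p \<Rightarrow> 'k) set" where
  "smooth_functions B m \<A> \<phi> N =
     {f. \<exists>W. open W \<and> (\<forall>\<^sub>F x in N. x \<in> W) \<and> smooth_function_on B m \<A> W (\<lambda>x. \<phi> (f x))}"

definition linear_operator ::
  "'p filter \<Rightarrow> ('p \<Rightarrow> 'k::field) set \<Rightarrow> (('p \<Rightarrow> 'k) \<Rightarrow> 'p \<Rightarrow> 'k) \<Rightarrow> bool" where
  "linear_operator N F D \<longleftrightarrow>
     (\<forall>f\<in>F. D f \<in> F) \<and>
     (\<forall>f\<in>F. \<forall>f'\<in>F. germ_eq N f f' \<longrightarrow> germ_eq N (D f) (D f')) \<and>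
     (\<forall>f\<in>F. \<forall>f'\<in>F. germ_eq N (D (\<lambda>x. f x + f' x)) (\<lambda>x. D f x + D f' x)) \<and>
     (\<forall>f\<in>F. \<forall>c. germ_eq N (D (\<lambda>x. c * f x)) (\<lambda>x. c * D f x))"

text \<open>
  Left invariance is \<open>D (f \<circ> L\<^sub>g) = D f \<circ> L\<^sub>g\<close>, for all \<open>g\<close> in the case of global functions, and
  for all \<open>g\<close> close to the unit (depending on the representatives) in the case of germs.
\<close>

definition left_invariant_derivation ::
  "'p filter \<Rightarrow> ('p \<Rightarrow> 'p \<Rightarrow> 'p) \<Rightarrow> ('p \<Rightarrow> 'k::field) set \<Rightarrow> (('p \<Rightarrow> 'k) \<Rightarrow> 'p \<Rightarrow> 'k) \<Rightarrow> bool" where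
  "left_invariant_derivation N mul F D \<longleftrightarrow>
     linear_operator N F D \<and>
     (\<forall>f\<in>F. \<forall>f'\<in>F. germ_eq N (D (\<lambda>x. f x * f' x)) (\<lambda>x. D f x * f' x + f x * D f' x)) \<and>
     (\<forall>f\<in>F. \<forall>\<^sub>F g in N. germ_eq N (D (\<lambda>x. f (mul g x))) (\<lambda>x. D f (mul g x)))"

text \<open>
  \<open>\<rho>\<close> is the action of the enveloping algebra on functions by composing derivations, where \<open>inc\<close>
  followed by \<open>\<rho>\<close> identifies the Lie algebra with the Lie algebra of all left invariant
  derivations.
\<close>

definition acts_by_left_invariant_derivations ::
  "'p filter \<Rightarrow> ('p \<Rightarrow> 'p \<Rightarrow> 'p) \<Rightarrow> ('p \<Rightarrow> 'k::field) set \<Rightarrow> ('k \<Rightarrow> 'u::ring_1 \<Rightarrow> 'u) \<Rightarrow>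
   ('g::zero \<Rightarrow> 'u) \<Rightarrow> ('u \<Rightarrow> ('p \<Rightarrow> 'k) \<Rightarrow> 'p \<Rightarrow> 'k) \<Rightarrow> bool" where
  "acts_by_left_invariant_derivations N mul F sU inc \<rho> \<longleftrightarrow>
     (\<forall>u. linear_operator N F (\<rho> u)) \<and>
     (\<forall>u v. \<forall>f\<in>F. germ_eq N (\<rho> (u + v) f) (\<lambda>x. \<rho> u f x + \<rho> v f x)) \<and>
     (\<forall>c u. \<forall>f\<in>F. germ_eq N (\<rho> (sU c u) f) (\<lambda>x. c * \<rho> u f x)) \<and>
     (\<forall>u v. \<forall>f\<in>F. germ_eq N (\<rho> (u * v) f) (\<rho> u (\<rho> v f))) \<and>
     (\<forall>f\<in>F. germ_eq N (\<rho> 1 f) f) \<and>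
     (\<forall>x. left_invariant_derivation N mul F (\<rho> (inc x))) \<and>
     (\<forall>x. (\<forall>f\<in>F. germ_eq N (\<rho> (inc x) f) (\<lambda>_. 0)) \<longrightarrow> x = 0) \<and>
     (\<forall>D. left_invariant_derivation N mul F D \<longrightarrow> (\<exists>x. \<forall>f\<in>F. germ_eq N (D f) (\<rho> (inc x) f)))"

text \<open>
  \<open>\<iota>\<close> embeds the Hopf algebra as a subalgebra of the functions (or germs) such that comultiplication,
  counit and antipode are transposes of the group structure.
\<close>

definition transposed_subalgebra ::
  "'p filter \<Rightarrow> ('p \<Rightarrow> 'p \<Rightarrow> 'p) \<Rightarrow> 'p \<Rightarrow> ('p \<Rightarrow> 'p) \<Rightarrow> ('p \<Rightarrow> 'k::field) set \<Rightarrow>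
   ('k \<Rightarrow> 'h::ring_1 \<Rightarrow> 'h) \<Rightarrow> ('h \<Rightarrow> ('h, 'h, 'k) tensor) \<Rightarrow> ('h \<Rightarrow> 'k) \<Rightarrow> ('h \<Rightarrow> 'h) \<Rightarrow>
   ('h \<Rightarrow> 'p \<Rightarrow> 'k) \<Rightarrow> bool" where
  "transposed_subalgebra N mul e ginv F sH \<Delta>H \<epsilon>H SH \<iota> \<longleftrightarrow>
     (\<forall>h. \<iota> h \<in> F) \<and>
     (\<forall>h. germ_eq N (\<iota> h) (\<lambda>_. 0) \<longrightarrow> h = 0) \<and>
     (\<forall>h h'. germ_eq N (\<iota> (h + h')) (\<lambda>x. \<iota> h x + \<iota> h' x)) \<and>
     (\<forall>c h. germ_eq N (\<iota> (sH c h)) (\<lambda>x. c * \<iota> h x)) \<and>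
     (\<forall>h h'. germ_eq N (\<iota> (h * h')) (\<lambda>x. \<iota> h x * \<iota> h' x)) \<and>
     germ_eq N (\<iota> 1) (\<lambda>_. 1) \<and>
     (\<forall>h xs. \<Delta>H h = (\<Sum>(h1, h2)\<leftarrow>xs. tens sH sH h1 h2) \<longrightarrow>
        (\<forall>\<^sub>F (a, b) in N \<times>\<^sub>F N. \<iota> h (mul a b) = (\<Sum>(h1, h2)\<leftarrow>xs. \<iota> h1 a * \<iota> h2 b))) \<and>
     (\<forall>h. \<epsilon>H h = \<iota> h e) \<and>
     (\<forall>h. germ_eq N (\<iota> (SH h)) (\<lambda>a. \<iota> h (ginv a)))"

text \<open>
  \<open>M\<close> is the matrix of the adjoint representation in the basis \<open>X\<close>: \<open>Ad\<^sub>a\<close> transports a derivation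
  along the conjugation \<open>x \<mapsto> a x a\<^sup>-\<^sup>1\<close>, and \<open>Ad\<^sub>a X\<^sub>j = \<Sum>\<^sub>i M\<^sup>i\<^sub>j(a) X\<^sub>i\<close>, with \<open>X\<^sub>j\<close> acting as \<open>D j\<close>.
\<close>

definition adjoint_matrix ::
  "'p filter \<Rightarrow> ('p \<Rightarrow> 'p \<Rightarrow> 'p) \<Rightarrow> ('p \<Rightarrow> 'p) \<Rightarrow> ('p \<Rightarrow> 'k::field) set \<Rightarrow> nat \<Rightarrow>
   (nat \<Rightarrow> ('p \<Rightarrow> 'k) \<Rightarrow> 'p \<Rightarrow> 'k) \<Rightarrow> (nat \<Rightarrow> nat \<Rightarrow> 'p \<Rightarrow> 'k) \<Rightarrow> bool" where
  "adjoint_matrix N mul ginv F n D M \<longleftrightarrow>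
     (\<forall>a. \<forall>j\<in>{1..n}. \<forall>f\<in>F.
        germ_eq N (\<lambda>x. D j (\<lambda>y. f (mul (mul a y) (ginv a))) (mul (mul (ginv a) x) a))
          (\<lambda>x. \<Sum>i\<in>{1..n}. M i j a * D i f x))"

definition inverse_matrix :: "nat \<Rightarrow> (nat \<Rightarrow> nat \<Rightarrow> 'r::ring_1) \<Rightarrow> (nat \<Rightarrow> nat \<Rightarrow> 'r) \<Rightarrow> bool" where
  "inverse_matrix n M M' \<longleftrightarrow>
     (\<forall>i\<in>{1..n}. \<forall>k\<in>{1..n}.
        (\<Sum>j\<in>{1..n}. M i j * M' j k) = (if i = k then 1 else 0) \<and>
        (\<Sum>j\<in>{1..n}. M' i j * M j k) = (if i = k then 1 else 0))"

text \<open>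
  The Hopf algebra is a transposed subalgebra of smooth functions (\<open>N = top\<close>) or germs
  (\<open>N = nhds e\<close>) on a Lie group, the pairing is \<open>(D f) (e)\<close>, and \<open>\<O>\<close>, \<open>\<O>'\<close> are the components
  of the matrix of \<open>Ad\<close> and its inverse.  The values of the functions lie in the ground field; if it
  is the field of complex numbers, then both real Lie groups (with complex valued smooth functions)
  and complex Lie groups (with holomorphic functions) are allowed.
\<close>

definition lie_group_function_case ::
  "'p filter \<Rightarrow> ('p::{t2_space,second_countable_topology} \<Rightarrow> 'p \<Rightarrow> 'p) \<Rightarrow> 'p \<Rightarrow> ('p \<Rightarrow> 'p) \<Rightarrow>
   complex set \<Rightarrow> nat \<Rightarrow> 'p atlas \<Rightarrow>
   ('k::field \<Rightarrow> 'u::ring_1 \<Rightarrow> 'u) \<Rightarrow> ('g::zero \<Rightarrow> 'u) \<Rightarrow>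
   ('k \<Rightarrow> 'h::ring_1 \<Rightarrow> 'h) \<Rightarrow> ('h \<Rightarrow> ('h, 'h, 'k) tensor) \<Rightarrow> ('h \<Rightarrow> 'k) \<Rightarrow> ('h \<Rightarrow> 'h) \<Rightarrow>
   ('u \<Rightarrow> 'h \<Rightarrow> 'k) \<Rightarrow> nat \<Rightarrow> (nat \<Rightarrow> 'g) \<Rightarrow> (nat \<Rightarrow> nat \<Rightarrow> 'h) \<Rightarrow> (nat \<Rightarrow> nat \<Rightarrow> 'h) \<Rightarrow> bool" where
  "lie_group_function_case N mul e ginv B m \<A> sU inc sH \<Delta>H \<epsilon>H SH pair n X \<O> \<O>' \<longleftrightarrow>
     lie_group B m \<A> mul e ginv \<and>
     (\<exists>\<phi> F \<iota> \<rho> M M'.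
        real_or_complex_field \<phi> \<and> B \<subseteq> range \<phi> \<and>
        F = smooth_functions B m \<A> \<phi> N \<and>
        acts_by_left_invariant_derivations N mul F sU inc \<rho> \<and>
        transposed_subalgebra N mul e ginv F sH \<Delta>H \<epsilon>H SH \<iota> \<and>
        (\<forall>u h. pair u h = \<rho> u (\<iota> h) e) \<and>
        adjoint_matrix N mul ginv F n (\<lambda>j. \<rho> (inc (X j))) M \<and>
        (\<forall>a. inverse_matrix n (\<lambda>i j. M i j a) (\<lambda>i j. M' i j a)) \<and>
        (\<forall>i\<in>{1..n}. \<forall>j\<in>{1..n}.
           germ_eq N (\<iota> (\<O> i j)) (M i j) \<and> germ_eq N (\<iota> (\<O>' i j)) (M' i j)))"

section \<open>Affine algebraic groups\<close>

text \<open>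
  An affine algebraic group over a field is given by its Hopf algebra of regular functions, a
  finitely generated commutative Hopf algebra.
\<close>

locale affine_algebraic_group = hopf_algebra sA \<Delta>A \<epsilon>A SA
  for sA :: "'k::field \<Rightarrow> 'a::comm_ring_1 \<Rightarrow> 'a" and \<Delta>A \<epsilon>A SA +
  assumes finitely_generated: "\<exists>G. finite G \<and> module.span sA (prod_list ` lists G) = UNIV"

text \<open>
  Left invariance \<open>D (f \<circ> L\<^sub>g) = D f \<circ> L\<^sub>g\<close> for points \<open>g\<close> with values in arbitrary commutative
  algebras, where \<open>f \<circ> L\<^sub>g = \<Sum> f\<^sub>1(g) f\<^sub>2\<close>; equivalently for the generic point, which gives the
  formula below.
\<close>

definition left_invariant_regular_derivation ::
  "('k::field \<Rightarrow> 'a::comm_ring_1 \<Rightarrow> 'a) \<Rightarrow> ('a \<Rightarrow> ('a, 'a, 'k) tensor) \<Rightarrow> ('a \<Rightarrow> 'a) \<Rightarrow> bool" where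
  "left_invariant_regular_derivation sA \<Delta>A D \<longleftrightarrow>
     Vector_Spaces.linear sA sA D \<and>
     (\<forall>f f'. D (f * f') = D f * f' + f * D f') \<and>
     (\<forall>f. \<Delta>A (D f) = sweedler sA sA (\<lambda>f1 f2. tens sA sA f1 (D f2)) (\<Delta>A f))"

definition acts_by_left_invariant_regular_derivations ::
  "('k::field \<Rightarrow> 'a::comm_ring_1 \<Rightarrow> 'a) \<Rightarrow> ('a \<Rightarrow> ('a, 'a, 'k) tensor) \<Rightarrow>
   ('k \<Rightarrow> 'u::ring_1 \<Rightarrow> 'u) \<Rightarrow> ('g \<Rightarrow> 'u) \<Rightarrow> ('u \<Rightarrow> 'a \<Rightarrow> 'a) \<Rightarrow> bool" where
  "acts_by_left_invariant_regular_derivations sA \<Delta>A sU inc \<rho> \<longleftrightarrow>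
     bilinear_over sU sA sA \<rho> \<and>
     (\<forall>u v f. \<rho> (u * v) f = \<rho> u (\<rho> v f)) \<and>
     (\<forall>f. \<rho> 1 f = f) \<and>
     bij_betw (\<lambda>x. \<rho> (inc x)) UNIV {D. left_invariant_regular_derivation sA \<Delta>A D}"

definition hopf_subalgebra_embedding ::
  "('k::field \<Rightarrow> 'h::ring_1 \<Rightarrow> 'h) \<Rightarrow> ('h \<Rightarrow> ('h, 'h, 'k) tensor) \<Rightarrow> ('h \<Rightarrow> 'k) \<Rightarrow> ('h \<Rightarrow> 'h) \<Rightarrow>
   ('k \<Rightarrow> 'a::ring_1 \<Rightarrow> 'a) \<Rightarrow> ('a \<Rightarrow> ('a, 'a, 'k) tensor) \<Rightarrow> ('a \<Rightarrow> 'k) \<Rightarrow> ('a \<Rightarrow> 'a) \<Rightarrow>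
   ('h \<Rightarrow> 'a) \<Rightarrow> bool" where
  "hopf_subalgebra_embedding sH \<Delta>H \<epsilon>H SH sA \<Delta>A \<epsilon>A SA \<iota> \<longleftrightarrow>
     inj \<iota> \<and> Vector_Spaces.linear sH sA \<iota> \<and>
     (\<forall>h h'. \<iota> (h * h') = \<iota> h * \<iota> h') \<and> \<iota> 1 = 1 \<and>
     (\<forall>h. \<Delta>A (\<iota> h) = sweedler sH sH (\<lambda>h1 h2. tens sA sA (\<iota> h1) (\<iota> h2)) (\<Delta>H h)) \<and>
     (\<forall>h. \<epsilon>A (\<iota> h) = \<epsilon>H h) \<and>
     (\<forall>h. SA (\<iota> h) = \<iota> (SH h))"

text \<open>
  The matrix \<open>M\<close> of the adjoint representation, with entries in the regular functions.  Left
  invariant derivations are determined by the tangent vectors \<open>f \<mapsto> (D f)(e)\<close>, and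
  \<open>(Ad\<^sub>a D f)(e) = D (y \<mapsto> f (a y a\<^sup>-\<^sup>1)) (e)\<close>, which as a function of \<open>a\<close> is
  \<open>\<Sum> f\<^sub>1 S(f\<^sub>3) \<epsilon>(D f\<^sub>2)\<close>.
\<close>

definition regular_adjoint_matrix ::
  "('k::field \<Rightarrow> 'a::comm_ring_1 \<Rightarrow> 'a) \<Rightarrow> ('a \<Rightarrow> ('a, 'a, 'k) tensor) \<Rightarrow> ('a \<Rightarrow> 'k) \<Rightarrow> ('a \<Rightarrow> 'a) \<Rightarrow>
   nat \<Rightarrow> (nat \<Rightarrow> 'a \<Rightarrow> 'a) \<Rightarrow> (nat \<Rightarrow> nat \<Rightarrow> 'a) \<Rightarrow> bool" where
  "regular_adjoint_matrix sA \<Delta>A \<epsilon>A SA n D M \<longleftrightarrow>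
     (\<forall>j\<in>{1..n}. \<forall>f.
        sweedler sA sA (\<lambda>f1 g. sweedler sA sA (\<lambda>f2 f3. sA (\<epsilon>A (D j f2)) (f1 * SA f3)) (\<Delta>A g)) (\<Delta>A f)
        = (\<Sum>i\<in>{1..n}. sA (\<epsilon>A (D i f)) (M i j)))"

text \<open>
  The requirement that the \<open>\<O>\<close> are the components of \<open>Ad\<close> cannot be dropped for disconnected groups
  or in positive characteristic: for the orthogonal group in dimension 2 over the complex numbers,
  \<open>\<O> = 1\<close> satisfies all the other conditions, whereas \<open>Ad\<close> is the determinant, and the
  Yetter--Drinfeld condition fails for \<open>\<O> = 1\<close>.
\<close>

definition algebraic_group_case ::
  "('k::field \<Rightarrow> 'a::comm_ring_1 \<Rightarrow> 'a) \<Rightarrow> ('a \<Rightarrow> ('a, 'a, 'k) tensor) \<Rightarrow> ('a \<Rightarrow> 'k) \<Rightarrow> ('a \<Rightarrow> 'a) \<Rightarrow>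
   ('k \<Rightarrow> 'u::ring_1 \<Rightarrow> 'u) \<Rightarrow> ('g \<Rightarrow> 'u) \<Rightarrow>
   ('k \<Rightarrow> 'h::ring_1 \<Rightarrow> 'h) \<Rightarrow> ('h \<Rightarrow> ('h, 'h, 'k) tensor) \<Rightarrow> ('h \<Rightarrow> 'k) \<Rightarrow> ('h \<Rightarrow> 'h) \<Rightarrow>
   ('u \<Rightarrow> 'h \<Rightarrow> 'k) \<Rightarrow> nat \<Rightarrow> (nat \<Rightarrow> 'g) \<Rightarrow> (nat \<Rightarrow> nat \<Rightarrow> 'h) \<Rightarrow> bool" where
  "algebraic_group_case sA \<Delta>A \<epsilon>A SA sU inc sH \<Delta>H \<epsilon>H SH pair n X \<O> \<longleftrightarrow>
     affine_algebraic_group sA \<Delta>A \<epsilon>A SA \<and>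
     (\<exists>\<iota> \<rho>.
        acts_by_left_invariant_regular_derivations sA \<Delta>A sU inc \<rho> \<and>
        hopf_subalgebra_embedding sH \<Delta>H \<epsilon>H SH sA \<Delta>A \<epsilon>A SA \<iota> \<and>
        (\<forall>u h. pair u h = \<epsilon>A (\<rho> u (\<iota> h))) \<and>
        regular_adjoint_matrix sA \<Delta>A \<epsilon>A SA n (\<lambda>j. \<rho> (inc (X j))) (\<lambda>i j. \<iota> (\<O> i j)))"

end

theory Submission
  imports Defs
begin

text \<open>
  The two halves of the theorem are instances of one statement, for an algebra \<open>A\<close> with a right
  Hopf action of a commutative bialgebra \<open>H\<close>: \<open>A\<close> is the enveloping algebra with the matrix
  \<open>M = \<O>'\<close>, or its opposite with \<open>M = \<O>\<close> and the co-opposite of \<open>H\<close>.  The generators act almost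
  trivially, \<open>X\<^sub>j \<triangleleft> h = p\<^sub>j(h) 1 + \<epsilon>(h) X\<^sub>j\<close> with \<open>p\<^sub>j\<close> the pairing with \<open>X\<^sub>j\<close>, and the values
  \<open>p\<^sub>k(M\<^sup>l\<^sub>j)\<close> are structure constants.  This gives \<open>\<Sum>\<^sub>i (a \<triangleleft> M\<^sup>i\<^sub>j) X\<^sub>i = X\<^sub>j a\<close> for all \<open>a\<close>
  (\<open>act_matrix_commute\<close>), which is braided commutativity for a generator.  By it, a map to the
  smash product is antimultiplicative with \<open>\<lambda>(X\<^sub>j) = \<Sum>\<^sub>i M\<^sup>i\<^sub>j \<otimes> X\<^sub>i\<close> if and only if it satisfies the
  recursion \<open>\<lambda>(X\<^sub>j a) = \<Sum>\<^sub>i M\<^sup>i\<^sub>j a\<^sub>-\<^sub>1 \<otimes> X\<^sub>i a\<^sub>0\<close> (locale \<open>generator_coaction\<close>).  The recursion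
  determines \<open>\<lambda>\<close>, and the axioms of a braided commutative Yetter--Drinfeld module algebra follow
  from it one after another by induction on products of generators.

  The Yetter--Drinfeld condition at a generator is not a formal consequence of the properties of the
  matrices.  It amounts to the identity

  \<open>\<Sum>\<^sub>i \<O>\<^sup>i\<^sub>j \<Sum> \<langle>X\<^sub>i, h\<^sub>1\<rangle> h\<^sub>2 = \<Sum> h\<^sub>1 \<langle>X\<^sub>j, h\<^sub>2\<rangle>\<close>   for all \<open>h\<close>,

  which says that \<open>\<O>\<close> turns the right invariant vector fields into the left invariant ones.  This
  identity and the commutativity of \<open>H\<close> are all that the alternative hypotheses of the theorem are used for:

  \<^item> On a Lie group, write \<open>h(a y) = h((a y a\<^sup>-\<^sup>1) a)\<close>, expand both sides by the comultiplication and
    apply \<open>X\<^sub>j\<close> to the variable \<open>y\<close> at the unit.  The operators are only known on smooth functions (or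
    germs), but for \<open>a\<close> close to the unit \<open>y \<mapsto> h(a y a\<^sup>-\<^sup>1)\<close> is the germ of an element of \<open>H\<close>, again
    by the comultiplication, so they apply to it.
  \<^item> On an affine algebraic group the same computation is made in the Hopf algebra, with the antipode in
    the place of inversion.
  \<^item> If the pairing is non-degenerate, the identity is tested on all \<open>u\<close> in the enveloping algebra.
    It becomes \<open>u X\<^sub>j = \<Sum> \<langle>u\<^sub>1, \<O>\<^sup>i\<^sub>j\<rangle> X\<^sub>i u\<^sub>2\<close>, which holds because pairing with \<open>\<O>\<close> gives the
    matrix of the adjoint action.  Commutativity holds because the enveloping algebra is cocommutative.

  It remains to see that the recursion has a solution.  Its right-hand side defines an operator on
  \<open>H \<otimes> A\<close> for every element of the Lie algebra.  By the quadratic relation between the matrix entries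
  and the structure constants these operators form a representation (an antirepresentation in the
  opposite case), and \<open>\<lambda>(a)\<close> is the result of applying \<open>a\<close> to \<open>1 \<otimes> 1\<close>.
\<close>

section \<open>Linear and multilinear maps\<close>

abbreviation linmap ::
  "('k::field \<Rightarrow> 'v::ab_group_add \<Rightarrow> 'v) \<Rightarrow> ('k \<Rightarrow> 'w::ab_group_add \<Rightarrow> 'w) \<Rightarrow> ('v \<Rightarrow> 'w) \<Rightarrow> bool" where
  "linmap s1 s2 f \<equiv> Vector_Spaces.linear s1 s2 f"

text \<open>
  The rules collected here decide linearity of a term in one of its variables by its outermost
  operation.  All multilinearity conditions below are discharged with them.
\<close>

named_theorems linmap_intros

lemma vector_space_field [linmap_intros]: "vector_space ((*) :: 'k::field \<Rightarrow> 'k \<Rightarrow> 'k)"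
  by unfold_locales (simp_all add: algebra_simps)

lemma vector_space_tscale [linmap_intros]: "vector_space (tscale :: 'k::field \<Rightarrow> ('b \<Rightarrow> 'k) \<Rightarrow> 'b \<Rightarrow> 'k)"
  by unfold_locales (auto simp: tscale_def fun_eq_iff algebra_simps)

lemma linmap_add: "linmap s1 s2 f \<Longrightarrow> f (x + y) = f x + f y"
  and linmap_scale: "linmap s1 s2 f \<Longrightarrow> f (s1 c x) = s2 c (f x)"
  by (auto simp: Vector_Spaces.linear_iff)

lemma linmap_0: "linmap s1 s2 f \<Longrightarrow> f 0 = 0"
  using linmap_add[of s1 s2 f 0 0] by simp

lemma linmap_minus: "linmap s1 s2 f \<Longrightarrow> f (- x) = - f x"
  using linmap_add[of s1 s2 f x "- x"] linmap_0[of s1 s2 f] by (simp add: eq_neg_iff_add_eq_0 add.commute)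

lemma linmap_diff: "linmap s1 s2 f \<Longrightarrow> f (x - y) = f x - f y"
  using linmap_add[of s1 s2 f x "- y"] linmap_minus[of s1 s2 f y] by simp

lemma linmap_sum: "linmap s1 s2 f \<Longrightarrow> f (\<Sum>i\<in>I. g i) = (\<Sum>i\<in>I. f (g i))"
  by (induction I rule: infinite_finite_induct) (auto simp: linmap_0 linmap_add)

lemma linmap_sum_list: "linmap s1 s2 f \<Longrightarrow> f (\<Sum>x\<leftarrow>xs. g x) = (\<Sum>x\<leftarrow>xs. f (g x))"
  by (induction xs) (auto simp: linmap_0 linmap_add)

lemma linmap_spaces: "linmap s1 s2 f \<Longrightarrow> vector_space s1" "linmap s1 s2 f \<Longrightarrow> vector_space s2"
  by (auto simp: Vector_Spaces.linear_iff)

lemma linmapI: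
  assumes "vector_space s1" "vector_space s2" "\<And>x y. f (x + y) = f x + f y"
    "\<And>c x. f (s1 c x) = s2 c (f x)"
  shows "linmap s1 s2 f"
  using assms by (auto simp: Vector_Spaces.linear_iff)

lemma linmap_id [linmap_intros]: "vector_space s \<Longrightarrow> linmap s s (\<lambda>x. x)"
  by (auto simp: Vector_Spaces.linear_iff)

lemma linmap_compose: "linmap s2 s3 g \<Longrightarrow> linmap s1 s2 f \<Longrightarrow> linmap s1 s3 (\<lambda>x. g (f x))"
  by (auto simp: Vector_Spaces.linear_iff)

lemma linmap_sum_fun [linmap_intros]:
  assumes "vector_space s1" "vector_space s2" "\<And>i. i \<in> I \<Longrightarrow> linmap s1 s2 (f i)"
  shows "linmap s1 s2 (\<lambda>x. \<Sum>i\<in>I. f i x)"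
proof -
  interpret vector_space s2 by fact
  show ?thesis
    using assms by (auto simp: Vector_Spaces.linear_iff sum.distrib scale_sum_right)
qed

lemma linmap_scale_fun [linmap_intros]:
  assumes "linmap s1 s2 f"
  shows "linmap s1 s2 (\<lambda>x. s2 c (f x))"
proof -
  interpret vector_space s2 using linmap_spaces(2)[OF assms] .
  show ?thesis
    using assms by (auto simp: Vector_Spaces.linear_iff scale_right_distrib mult.commute)
qed

lemma linmap_scale_left [linmap_intros]:
  assumes "vector_space s2" "linmap s1 (*) f"
  shows "linmap s1 s2 (\<lambda>x. s2 (f x) v)"
proof -
  interpret vector_space s2 by fact
  show ?thesis
    using assms by (auto simp: Vector_Spaces.linear_iff scale_left_distrib)
qed

lemma bilinear_overI:
  assumes "\<And>v. linmap s2 s3 (F v)" "\<And>w. linmap s1 s3 (\<lambda>v. F v w)"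
  shows "bilinear_over s1 s2 s3 F"
  using assms by (simp add: bilinear_over_def)

lemma bilinear_left: "bilinear_over s1 s2 s3 F \<Longrightarrow> linmap s s1 f \<Longrightarrow> linmap s s3 (\<lambda>x. F (f x) c)"
  using linmap_compose[of s1 s3 "\<lambda>v. F v c" s f] by (simp add: bilinear_over_def)

lemma bilinear_right: "bilinear_over s1 s2 s3 F \<Longrightarrow> linmap s s2 f \<Longrightarrow> linmap s s3 (\<lambda>x. F c (f x))"
  using linmap_compose[of s2 s3 "F c" s f] by (simp add: bilinear_over_def)

lemma bilinear_spaces:
  assumes "bilinear_over s1 s2 s3 F"
  shows "vector_space s1" "vector_space s2" "vector_space s3"
  using assms by (auto simp: bilinear_over_def Vector_Spaces.linear_iff)

definition trilinear_over ::
  "('k::field \<Rightarrow> 'u::ab_group_add \<Rightarrow> 'u) \<Rightarrow> ('k \<Rightarrow> 'v::ab_group_add \<Rightarrow> 'v) \<Rightarrow>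
   ('k \<Rightarrow> 'w::ab_group_add \<Rightarrow> 'w) \<Rightarrow> ('k \<Rightarrow> 'x::ab_group_add \<Rightarrow> 'x) \<Rightarrow>
   ('u \<Rightarrow> 'v \<Rightarrow> 'w \<Rightarrow> 'x) \<Rightarrow> bool" where
  "trilinear_over s1 s2 s3 s4 F \<longleftrightarrow>
     (\<forall>v w. linmap s1 s4 (\<lambda>u. F u v w)) \<and> (\<forall>u w. linmap s2 s4 (\<lambda>v. F u v w)) \<and>
     (\<forall>u v. linmap s3 s4 (F u v))"

lemma trilinear_overI:
  assumes "\<And>v w. linmap s1 s4 (\<lambda>u. F u v w)" "\<And>u w. linmap s2 s4 (\<lambda>v. F u v w)"
    "\<And>u v. linmap s3 s4 (F u v)"
  shows "trilinear_over s1 s2 s3 s4 F"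
  using assms by (simp add: trilinear_over_def)

lemma trilinear_first:
    "trilinear_over s1 s2 s3 s4 F \<Longrightarrow> linmap s s1 f \<Longrightarrow> linmap s s4 (\<lambda>x. F (f x) v w)"
  using linmap_compose[of s1 s4 "\<lambda>u. F u v w" s f] by (simp add: trilinear_over_def)

lemma trilinear_second:
    "trilinear_over s1 s2 s3 s4 F \<Longrightarrow> linmap s s2 f \<Longrightarrow> linmap s s4 (\<lambda>x. F u (f x) w)"
  using linmap_compose[of s2 s4 "\<lambda>v. F u v w" s f] by (simp add: trilinear_over_def)

lemma trilinear_third:
    "trilinear_over s1 s2 s3 s4 F \<Longrightarrow> linmap s s3 f \<Longrightarrow> linmap s s4 (\<lambda>x. F u v (f x))"
  using linmap_compose[of s3 s4 "\<lambda>w. F u v w" s f] by (simp add: trilinear_over_def)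

lemmas trilinear = trilinear_first trilinear_second trilinear_third
lemmas bilinear = bilinear_left bilinear_right

lemma trilinear_spaces:
  assumes "trilinear_over s1 s2 s3 s4 F"
  shows "vector_space s1" "vector_space s2" "vector_space s3" "vector_space s4"
  using assms by (auto simp: trilinear_over_def Vector_Spaces.linear_iff)

lemma trilinear_form_iff: "trilinear_form s1 s2 s3 F \<longleftrightarrow> trilinear_over s1 s2 s3 (*) F"
  unfolding trilinear_form_def trilinear_over_def bilinear_over_def by blast

text \<open>
  Identities between vectors may be tested on linear functionals.  This transfers the identities
  between functionals that define equality of tensors to arbitrary multilinear maps.
\<close>

lemma functionals_separate:
  fixes s :: "'k::field \<Rightarrow> 'x::ab_group_add \<Rightarrow> 'x"
  assumes "vector_space s" and eq: "\<And>f. linmap s (*) f \<Longrightarrow> f x = f y"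
  shows "x = y"
proof (rule ccontr)
  interpret X: vector_space s by fact
  interpret XK: vector_space_pair s "(*) :: 'k \<Rightarrow> 'k \<Rightarrow> 'k"
    by (intro vector_space_pair.intro vector_space_field assms(1))
  assume "x \<noteq> y"
  then have "X.independent {x - y}"
    by (simp add: X.dependent_single)
  then obtain f where f: "linmap s (*) f" "\<forall>z\<in>{x - y}. f z = (1 :: 'k)"
    using XK.linear_independent_extend[of "{x - y}" "\<lambda>_. 1"] by blast
  then show False
    using eq[OF f(1)] linmap_diff[OF f(1), of x y] by simp
qed

section \<open>Tensors and Sweedler sums\<close>

lemma bilinear_tens:
  assumes "vector_space s1" "vector_space s2"
  shows "bilinear_over s1 s2 tscale (tens s1 s2)"
  using assms
  by (auto simp: bilinear_over_def tens_def Vector_Spaces.linear_iff tscale_def fun_eq_iff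
      vector_space_tscale)

lemma linmap_tens [linmap_intros]:
  "vector_space s2 \<Longrightarrow> linmap s s1 f \<Longrightarrow> linmap s tscale (\<lambda>x. tens s1 s2 (f x) w)"
  "vector_space s1 \<Longrightarrow> linmap s s2 g \<Longrightarrow> linmap s tscale (\<lambda>x. tens s1 s2 v (g x))"
  using bilinear_left[OF bilinear_tens] bilinear_right[OF bilinear_tens] linmap_spaces by blast+

lemma trilinear_tens3:
  assumes "vector_space s1" "vector_space s2" "vector_space s3"
  shows "trilinear_over s1 s2 s3 tscale (tens3 s1 s2 s3)"
  using assms
  by (auto simp: trilinear_over_def tens3_def trilinear_form_iff Vector_Spaces.linear_iff tscale_def
      fun_eq_iff vector_space_tscale)

lemma linmap_tens3 [linmap_intros]:
  "vector_space s2 \<Longrightarrow> vector_space s3 \<Longrightarrow> linmap s s1 f \<Longrightarrow> linmap s tscale (\<lambda>x. tens3 s1 s2 s3 (f x) v w)"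
  "vector_space s1 \<Longrightarrow> vector_space s3 \<Longrightarrow> linmap s s2 g \<Longrightarrow> linmap s tscale (\<lambda>x. tens3 s1 s2 s3 u (g x) w)"
  "vector_space s1 \<Longrightarrow> vector_space s2 \<Longrightarrow> linmap s s3 h \<Longrightarrow> linmap s tscale (\<lambda>x. tens3 s1 s2 s3 u v (h x))"
  by (rule trilinear[OF trilinear_tens3]; (assumption | erule linmap_spaces(2)))+

lemma
  fixes s1 :: "'a::field \<Rightarrow> 'b::ab_group_add \<Rightarrow> 'b" and s2 :: "'a \<Rightarrow> 'c::ab_group_add \<Rightarrow> 'c"
  shows tensor_space_0: "0 \<in> tensor_space s1 s2"
  and tensor_space_add: "t \<in> tensor_space s1 s2 \<Longrightarrow> t' \<in> tensor_space s1 s2 \<Longrightarrow> t + t' \<in> tensor_space s1 s2"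
  and tensor_space_scale: "t \<in> tensor_space s1 s2 \<Longrightarrow> tscale c t \<in> tensor_space s1 s2"
  and tensor_space_tens: "tens s1 s2 v w \<in> tensor_space s1 s2"
proof -
  interpret T: vector_space "tscale :: 'a \<Rightarrow> (('b \<Rightarrow> 'c \<Rightarrow> 'a) \<Rightarrow> 'a) \<Rightarrow> _" by (rule vector_space_tscale)
  show "0 \<in> tensor_space s1 s2"
    and "t \<in> tensor_space s1 s2 \<Longrightarrow> t' \<in> tensor_space s1 s2 \<Longrightarrow> t + t' \<in> tensor_space s1 s2"
    and "t \<in> tensor_space s1 s2 \<Longrightarrow> tscale c t \<in> tensor_space s1 s2"
    by (simp_all add: tensor_space_def T.span_zero T.span_add T.span_scale)
  show "tens s1 s2 v w \<in> tensor_space s1 s2"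
    unfolding tensor_space_def by (rule T.span_base) auto
qed

lemma tensor_space_sum: "(\<And>i. i \<in> I \<Longrightarrow> f i \<in> tensor_space s1 s2) \<Longrightarrow> (\<Sum>i\<in>I. f i) \<in> tensor_space s1 s2"
  by (induction I rule: infinite_finite_induct) (auto simp: tensor_space_0 tensor_space_add)

lemma tensor_space_sum_list: "(\<And>x. x \<in> set xs \<Longrightarrow> f x \<in> tensor_space s1 s2) \<Longrightarrow> (\<Sum>x\<leftarrow>xs. f x) \<in> tensor_space s1 s2"
  by (induction xs) (auto simp: tensor_space_0 tensor_space_add)

lemma tensor_space_sweedler:
  "(\<And>v w. F v w \<in> tensor_space s1 s2) \<Longrightarrow> sweedler s3 s4 F t \<in> tensor_space s1 s2"
  unfolding sweedler_def by (auto intro!: tensor_space_sum_list)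

lemmas tensor_space_closed = tensor_space_0 tensor_space_add tensor_space_scale tensor_space_tens
  tensor_space_sum tensor_space_sweedler

lemma tscale_tens:
  assumes "vector_space s1" "vector_space s2"
  shows "tscale c (tens s1 s2 v w) = tens s1 s2 (s1 c v) w"
  using linmap_scale[OF bilinear_left[OF bilinear_tens[OF assms] linmap_id[OF assms(1)]]] by metis

text \<open>
  Scalars can be absorbed in the first factor, so sums of pure tensors suffice.
\<close>

lemma tensor_space_presentation:
  fixes s1 :: "'a::field \<Rightarrow> 'b::ab_group_add \<Rightarrow> 'b" and s2 :: "'a \<Rightarrow> 'c::ab_group_add \<Rightarrow> 'c"
  assumes "vector_space s1" "vector_space s2" "t \<in> tensor_space s1 s2"
  obtains xs where "t = (\<Sum>(v, w)\<leftarrow>xs. tens s1 s2 v w)"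
proof -
  interpret T: vector_space "tscale :: 'a \<Rightarrow> (('b \<Rightarrow> 'c \<Rightarrow> 'a) \<Rightarrow> 'a) \<Rightarrow> _" by (rule vector_space_tscale)
  have "\<exists>xs. t = (\<Sum>(v, w)\<leftarrow>xs. tens s1 s2 v w)"
    using assms(3) unfolding tensor_space_def
  proof (induction rule: T.span_induct_alt)
    case base
    show ?case by (rule exI[of _ "[]"]) simp
  next
    case (step c x y)
    then obtain v w xs where "x = tens s1 s2 v w" "y = (\<Sum>(v, w)\<leftarrow>xs. tens s1 s2 v w)"
      by auto
    then have "tscale c x + y = (\<Sum>(v, w)\<leftarrow>(s1 c v, w) # xs. tens s1 s2 v w)"
      by (simp add: tscale_tens assms)
    then show ?case by blast
  qed
  then show ?thesis using that by blast
qed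

subsection \<open>Sweedler sums depend linearly on the tensor\<close>

lemma sweedler_tens: "bilinear_over s1 s2 s3 F \<Longrightarrow> sweedler s1 s2 F (tens s1 s2 v w) = F v w"
  using sweedler_sum_list[of s1 s2 s3 F "[(v, w)]"] by simp

lemma sweedler_0: "bilinear_over s1 s2 s3 F \<Longrightarrow> sweedler s1 s2 F 0 = 0"
  using sweedler_sum_list[of s1 s2 s3 F "[]"] by simp

lemma sweedler_add:
  assumes F: "bilinear_over s1 s2 s3 F" and "t \<in> tensor_space s1 s2" "t' \<in> tensor_space s1 s2"
  shows "sweedler s1 s2 F (t + t') = sweedler s1 s2 F t + sweedler s1 s2 F t'"
proof -
  obtain xs ys where "t = (\<Sum>(v, w)\<leftarrow>xs. tens s1 s2 v w)" "t' = (\<Sum>(v, w)\<leftarrow>ys. tens s1 s2 v w)"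
    using tensor_space_presentation bilinear_spaces[OF F] assms(2,3) by metis
  moreover from this have "t + t' = (\<Sum>(v, w)\<leftarrow>xs @ ys. tens s1 s2 v w)" by simp
  ultimately show ?thesis by (simp only: sweedler_sum_list[OF F]) simp
qed

lemma sweedler_scale:
  assumes F: "bilinear_over s1 s2 s3 F" and t: "t \<in> tensor_space s1 s2"
  shows "sweedler s1 s2 F (tscale c t) = s3 c (sweedler s1 s2 F t)"
proof -
  note sp = bilinear_spaces[OF F]
  interpret vector_space s3 by (rule sp)
  obtain xs where xs: "t = (\<Sum>(v, w)\<leftarrow>xs. tens s1 s2 v w)"
    using tensor_space_presentation[OF sp(1,2) t] .
  have "tscale c t = (\<Sum>(v, w)\<leftarrow>map (\<lambda>(v, w). (s1 c v, w)) xs. tens s1 s2 v w)"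
    unfolding xs linmap_sum_list[OF linmap_scale_fun[OF linmap_id[OF vector_space_tscale]]]
    by (simp add: case_prod_unfold o_def tscale_tens sp)
  then have "sweedler s1 s2 F (tscale c t) = (\<Sum>(v, w)\<leftarrow>xs. s3 c (F v w))"
    by (simp only: sweedler_sum_list[OF F])
      (simp add: case_prod_unfold o_def linmap_scale[OF bilinear_left[OF F linmap_id[OF sp(1)]]])
  also have "\<dots> = s3 c (\<Sum>(v, w)\<leftarrow>xs. F v w)"
    by (induction xs) (auto simp: scale_right_distrib)
  also have "\<dots> = s3 c (sweedler s1 s2 F t)"
    by (simp add: xs sweedler_sum_list[OF F])
  finally show ?thesis .
qed

lemma sweedler_sum:
  assumes F: "bilinear_over s1 s2 s3 F" and "\<And>i. i \<in> I \<Longrightarrow> t i \<in> tensor_space s1 s2"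
  shows "sweedler s1 s2 F (\<Sum>i\<in>I. t i) = (\<Sum>i\<in>I. sweedler s1 s2 F (t i))"
  using assms(2)
  by (induction I rule: infinite_finite_induct)
    (auto simp: sweedler_0[OF F] sweedler_add[OF F] tensor_space_sum)

lemma sweedler_sum_tens:
  assumes F: "bilinear_over s1 s2 s3 F"
  shows "sweedler s1 s2 F (\<Sum>i\<in>I. tens s1 s2 (v i) (w i)) = (\<Sum>i\<in>I. F (v i) (w i))"
  by (simp add: sweedler_sum[OF F] tensor_space_tens sweedler_tens[OF F])

lemma tensor_sweedler:
  assumes "vector_space s1" "vector_space s2" "t \<in> tensor_space s1 s2"
  shows "sweedler s1 s2 (tens s1 s2) t = t"
proof -
  obtain xs where xs: "t = (\<Sum>(v, w)\<leftarrow>xs. tens s1 s2 v w)"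
    using tensor_space_presentation[OF assms] .
  show ?thesis unfolding xs
    by (rule sweedler_sum_list[OF bilinear_tens]) (rule assms)+
qed

subsection \<open>Sweedler sums depend linearly on the summand\<close>

text \<open>
  The presentation that computes \<open>sweedler s1 s2 F t\<close> does not depend on \<open>F\<close>.  Hence Sweedler sums
  commute with additive maps and with each other, without any assumption of bilinearity.
\<close>

lemma sweedler_additive:
  assumes "\<And>x y. f (x + y) = f x + f y" "f 0 = 0"
  shows "f (sweedler s1 s2 F t) = sweedler s1 s2 (\<lambda>v w. f (F v w)) t"
proof -
  have "f (\<Sum>(v, w)\<leftarrow>xs. F v w) = (\<Sum>(v, w)\<leftarrow>xs. f (F v w))" for xs
    by (induction xs) (auto simp: assms)
  then show ?thesis by (simp add: sweedler_def)
qed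

lemma sweedler_linmap: "linmap s3 s4 f \<Longrightarrow> f (sweedler s1 s2 F t) = sweedler s1 s2 (\<lambda>v w. f (F v w)) t"
  by (rule sweedler_additive) (auto simp: linmap_add linmap_0)

lemma sweedler_plus_fun:
  "sweedler s1 s2 (\<lambda>v w. F v w + G v w) t = sweedler s1 s2 F t + sweedler s1 s2 G t"
  by (simp add: sweedler_def case_prod_unfold sum_list_addf)

lemma sweedler_zero_fun: "sweedler s1 s2 (\<lambda>v w. 0) t = 0"
  by (simp add: sweedler_def case_prod_unfold)

lemma sweedler_sum_fun: "sweedler s1 s2 (\<lambda>v w. \<Sum>i\<in>I. F i v w) t = (\<Sum>i\<in>I. sweedler s1 s2 (F i) t)"
  by (induction I rule: infinite_finite_induct) (auto simp: sweedler_plus_fun sweedler_zero_fun)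

lemma sweedler_swap:
  "sweedler s1 s2 (\<lambda>a b. sweedler s3 s4 (\<lambda>c d. F a b c d) t') t
   = sweedler s3 s4 (\<lambda>c d. sweedler s1 s2 (\<lambda>a b. F a b c d) t) t'"
proof -
  have "(\<Sum>(a, b)\<leftarrow>xs. \<Sum>(c, d)\<leftarrow>ys. F a b c d) = (\<Sum>(c, d)\<leftarrow>ys. \<Sum>(a, b)\<leftarrow>xs. F a b c d)" for xs ys
    by (induction xs) (simp_all add: case_prod_unfold sum_list_addf)
  then show ?thesis by (simp add: sweedler_def)
qed

lemma sweedler_eval: "sweedler s1 s2 F t B = sweedler s1 s2 (\<lambda>v w. F v w B) t"
  by (rule sweedler_additive[of "\<lambda>t. t B"]) simp_all

lemma sweedler_sweedler:
  assumes G: "bilinear_over s1 s2 s3 G" and T: "\<And>v w. T v w \<in> tensor_space s1 s2"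
  shows "sweedler s1 s2 G (sweedler s4 s5 T t) = sweedler s4 s5 (\<lambda>v w. sweedler s1 s2 G (T v w)) t"
proof -
  have "sweedler s1 s2 G (\<Sum>(v, w)\<leftarrow>xs. T v w) = (\<Sum>(v, w)\<leftarrow>xs. sweedler s1 s2 G (T v w))" for xs
    using T by (induction xs)
      (auto simp: sweedler_0[OF G] sweedler_add[OF G] tensor_space_sum_list case_prod_unfold)
  then show ?thesis by (simp add: sweedler_def[of s4 s5])
qed

text \<open>
  A Sweedler sum may depend on a variable through the summand or through the tensor; the unifier
  tells the two cases apart.
\<close>

lemma linmap_sweedler_fun [linmap_intros]:
  assumes "\<And>v w. linmap s s3 (\<lambda>x. F x v w)"
  shows "linmap s s3 (\<lambda>x. sweedler s1 s2 (F x) t)"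
proof -
  note sp = linmap_spaces[OF assms]
  show ?thesis
  proof (rule linmapI[OF sp])
    fix x y c
    have "F (x + y) = (\<lambda>v w. F x v w + F y v w)" "F (s c x) = (\<lambda>v w. s3 c (F x v w))"
      by (simp_all add: fun_eq_iff linmap_add[OF assms] linmap_scale[OF assms])
    then show "sweedler s1 s2 (F (x + y)) t = sweedler s1 s2 (F x) t + sweedler s1 s2 (F y) t"
      and "sweedler s1 s2 (F (s c x)) t = s3 c (sweedler s1 s2 (F x) t)"
      by (simp_all add: sweedler_plus_fun sweedler_linmap[OF linmap_scale_fun[OF linmap_id[OF sp(2)]]])
  qed
qed

lemma linmap_sweedler_arg [linmap_intros]:
  assumes F: "bilinear_over s1 s2 s3 F" and T: "linmap s tscale T" and in_space: "\<And>x. T x \<in> tensor_space s1 s2"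
  shows "linmap s s3 (\<lambda>x. sweedler s1 s2 F (T x))"
  by (rule linmapI)
    (simp_all add: linmap_spaces(1)[OF T] bilinear_spaces[OF F] linmap_add[OF T] linmap_scale[OF T]
      sweedler_add[OF F] sweedler_scale[OF F] in_space)

section \<open>Sweedler calculus in algebras and bialgebras\<close>

context assoc_algebra
begin

lemma vector_space_scale [linmap_intros]: "vector_space scale"
  by (rule vector_space_axioms)

lemmas linmap_mult [linmap_intros] = bilinear[OF mult_bilinear]

lemma mult_add_left: "mult (a + b) c = mult a c + mult b c"
  and mult_add_right: "mult c (a + b) = mult c a + mult c b"
  and mult_scale_left: "mult (scale r a) b = scale r (mult a b)"
  and mult_scale_right: "mult a (scale r b) = scale r (mult a b)"
  using mult_bilinear by (auto simp: bilinear_over_def Vector_Spaces.linear_iff)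

lemma mult_sum_left: "mult (\<Sum>i\<in>I. f i) c = (\<Sum>i\<in>I. mult (f i) c)"
  and mult_sum_right: "mult c (\<Sum>i\<in>I. f i) = (\<Sum>i\<in>I. mult c (f i))"
  by (rule linmap_sum[of scale scale "\<lambda>x. mult x c"] linmap_sum[of scale scale "mult c"];
      intro linmap_intros)+

end

context bialgebra
begin

abbreviation comult_sum :: "('h \<Rightarrow> 'h \<Rightarrow> 'x::ab_group_add) \<Rightarrow> 'h \<Rightarrow> 'x" where
  "comult_sum F h \<equiv> sweedler scale scale F (\<Delta> h)"

lemma linmap_comult [linmap_intros]: "linmap s scale f \<Longrightarrow> linmap s tscale (\<lambda>x. \<Delta> (f x))"
  by (rule linmap_compose[OF comult_linear])

lemma linmap_counit [linmap_intros]: "linmap s scale f \<Longrightarrow> linmap s (*) (\<lambda>x. \<epsilon> (f x))"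
  by (rule linmap_compose[OF counit_linear])

declare comult_in [linmap_intros]

text \<open>
  Coassociativity is an identity in the threefold tensor product.  Composing \<open>F\<close> with linear
  functionals turns it into an identity of Sweedler sums for all trilinear maps.
\<close>

lemma comult_sum_coassoc:
  assumes F: "trilinear_over scale scale scale s F"
  shows "comult_sum (\<lambda>a b. comult_sum (\<lambda>a1 a2. F a1 a2 b) a) h = comult_sum (\<lambda>a b. comult_sum (F a) b) h"
proof (rule functionals_separate[OF trilinear_spaces(4)[OF F]])
  fix f assume f: "linmap s (*) f"
  define B where "B = (\<lambda>a b c. f (F a b c))"
  have "trilinear_over scale scale scale (*) B"
    unfolding B_def by (intro trilinear_overI linmap_compose[OF f] trilinear[OF F] linmap_intros)
  then have B: "tens3 scale scale scale a b c B = f (F a b c)" for a b c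
    by (simp add: tens3_def trilinear_form_iff B_def)
  show "f (comult_sum (\<lambda>a b. comult_sum (\<lambda>a1 a2. F a1 a2 b) a) h) = f (comult_sum (\<lambda>a b. comult_sum (F a) b) h)"
    using fun_cong[OF coassoc[of h], of B] by (simp add: sweedler_eval B sweedler_linmap[OF f])
qed

lemma comult_sum_mult:
  assumes F: "bilinear_over scale scale s F"
  shows "comult_sum F (h * h') = comult_sum (\<lambda>a b. comult_sum (\<lambda>a' b'. F (a * a') (b * b')) h') h"
  unfolding comult_mult
  by (simp add: sweedler_sweedler[OF F] tensor_space_closed sweedler_tens[OF F])

lemma comult_sum_one: "bilinear_over scale scale s F \<Longrightarrow> comult_sum F 1 = F 1 1"
  by (simp add: comult_one sweedler_tens)

lemma comult_sum_add: "bilinear_over scale scale s F \<Longrightarrow> comult_sum F (a + b) = comult_sum F a + comult_sum F b"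
  by (rule linmap_add[of scale s]) (intro linmap_intros)

lemma comult_sum_scale: "bilinear_over scale scale s F \<Longrightarrow> comult_sum F (scale c a) = s c (comult_sum F a)"
  by (rule linmap_scale[of scale s]) (intro linmap_intros)

lemma comult_sum_counit_left:
  assumes f: "linmap scale s f"
  shows "comult_sum (\<lambda>a b. s (\<epsilon> a) (f b)) h = f h"
  using sweedler_linmap[OF f, of scale scale "\<lambda>a b. scale (\<epsilon> a) b" "\<Delta> h"]
  by (simp add: counit_left linmap_scale[OF f])

lemma comult_sum_counit_right:
  assumes f: "linmap scale s f"
  shows "comult_sum (\<lambda>a b. s (\<epsilon> b) (f a)) h = f h"
  using sweedler_linmap[OF f, of scale scale "\<lambda>a b. scale (\<epsilon> b) a" "\<Delta> h"]
  by (simp add: counit_right linmap_scale[OF f])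

end

section \<open>Coactions on an algebra with generators that act almost trivially\<close>

text \<open>
  This locale describes both the enveloping algebra and its opposite.  The equations \<open>commutator_M\<close>
  and \<open>intertwiner_M\<close> are braided commutativity of two generators and the Yetter--Drinfeld condition
  at a generator, stripped of the parts that always agree.  Generation is stated as an induction
  principle.
\<close>

locale matrix_generated =
  right_hopf_action sH \<Delta>H \<epsilon>H sA multA unitA act
  for sH :: "'k::field \<Rightarrow> 'h::ring_1 \<Rightarrow> 'h" and \<Delta>H \<epsilon>H
    and sA :: "'k \<Rightarrow> 'a::ab_group_add \<Rightarrow> 'a" and multA (infixl \<open>\<star>\<close> 70) and unitA
    and act (infixl \<open>\<triangleleft>\<close> 72) +
  fixes I :: "'i set" and X :: "'i \<Rightarrow> 'a" and M :: "'i \<Rightarrow> 'i \<Rightarrow> 'h" and p :: "'i \<Rightarrow> 'h \<Rightarrow> 'k"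
  assumes finite_I: "finite I"
    and H_commute: "h * h' = (h' * h :: 'h)"
    and p_linear: "j \<in> I \<Longrightarrow> linmap sH (*) (p j)"
    and generated:
      "\<And>P a. P unitA \<Longrightarrow> (\<And>a b. P a \<Longrightarrow> P b \<Longrightarrow> P (a + b)) \<Longrightarrow> (\<And>c a. P a \<Longrightarrow> P (sA c a)) \<Longrightarrow>
        (\<And>j a. j \<in> I \<Longrightarrow> P a \<Longrightarrow> P (X j \<star> a)) \<Longrightarrow> P (a :: 'a)"
    and act_generator: "j \<in> I \<Longrightarrow> X j \<triangleleft> h = sA (p j h) unitA + sA (\<epsilon>H h) (X j)"
    and comult_M: "i \<in> I \<Longrightarrow> j \<in> I \<Longrightarrow> \<Delta>H (M i j) = (\<Sum>k\<in>I. tens sH sH (M k j) (M i k))"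
    and counit_M: "i \<in> I \<Longrightarrow> j \<in> I \<Longrightarrow> \<epsilon>H (M i j) = (if i = j then 1 else 0)"
    and commutator_M: "j \<in> I \<Longrightarrow> k \<in> I \<Longrightarrow>
      (\<Sum>l\<in>I. sA (p k (M l j)) (X l)) = X j \<star> X k - X k \<star> X j"
    and intertwiner_M: "j \<in> I \<Longrightarrow>
      (\<Sum>i\<in>I. M i j * sweedler sH sH (\<lambda>h1 h2. sH (p i h2) h1) (\<Delta>H h))
      = sweedler sH sH (\<lambda>h1 h2. sH (p j h1) h2) (\<Delta>H h)"
begin

lemmas linmap_act [linmap_intros] = bilinear[OF act_bilinear]

lemma linmap_p [linmap_intros]: "j \<in> I \<Longrightarrow> linmap s sH f \<Longrightarrow> linmap s (*) (\<lambda>x. p j (f x))"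
  by (rule linmap_compose[OF p_linear])

lemma act_add: "(a + b) \<triangleleft> h = a \<triangleleft> h + b \<triangleleft> h"
  and act_scale: "sA c a \<triangleleft> h = sA c (a \<triangleleft> h)"
  using act_bilinear by (auto simp: bilinear_over_def Vector_Spaces.linear_iff)

lemma H_left_commute: "h * (k * l) = k * (h * l :: 'h)"
  by (metis H_commute mult.assoc)

lemma sum_delta_M: "j \<in> I \<Longrightarrow> (\<Sum>i\<in>I. sA (\<epsilon>H (M i j)) (f i)) = f j"
proof -
  assume j: "j \<in> I"
  have "(\<Sum>i\<in>I. sA (\<epsilon>H (M i j)) (f i)) = (\<Sum>i\<in>I. if i = j then f i else 0)"
    by (rule sum.cong) (use j in \<open>auto simp: counit_M\<close>)
  then show ?thesis using j finite_I by simp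
qed

text \<open>
  For \<open>a = X\<^sub>k b\<close> the Hopf property and the comultiplication of \<open>M\<close> reduce the left-hand side to
  \<open>\<Sum>\<^sub>l (X\<^sub>k \<triangleleft> M\<^sup>l\<^sub>j) X\<^sub>l b\<close>, and \<open>commutator_M\<close> says that \<open>\<Sum>\<^sub>l (X\<^sub>k \<triangleleft> M\<^sup>l\<^sub>j) X\<^sub>l = X\<^sub>j X\<^sub>k\<close>.
\<close>

lemma act_matrix_commute:
  assumes j: "j \<in> I"
  shows "(\<Sum>i\<in>I. (a \<triangleleft> M i j) \<star> X i) = X j \<star> a"
  using j
proof (induction a arbitrary: j rule: generated)
  case 1
  then show ?case
    by (simp add: act_hopf_unit A.mult_scale_left A.unit_left A.unit_right sum_delta_M)
next
  case (2 a b)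
  then show ?case by (simp add: act_add A.mult_add_left A.mult_add_right sum.distrib)
next
  case (3 c a)
  then show ?case
    by (simp add: act_scale A.mult_scale_left A.mult_scale_right flip: A.scale_sum_right)
next
  case (4 k a)
  have bil: "bilinear_over sH sH sA (\<lambda>h1 h2. (X k \<triangleleft> h1) \<star> (a \<triangleleft> h2))"
    by (intro bilinear_overI linmap_intros)
  have "(\<Sum>i\<in>I. ((X k \<star> a) \<triangleleft> M i j) \<star> X i)
      = (\<Sum>i\<in>I. \<Sum>l\<in>I. (X k \<triangleleft> M l j) \<star> ((a \<triangleleft> M i l) \<star> X i))"
    using 4 by (intro sum.cong)
      (auto simp: act_hopf_mult comult_M sweedler_sum_tens[OF bil] A.mult_sum_left A.mult_assoc)
  also have "\<dots> = (\<Sum>l\<in>I. (X k \<triangleleft> M l j) \<star> X l) \<star> a"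
    by (subst sum.swap)
      (simp add: 4(2) A.mult_sum_left A.mult_assoc flip: A.mult_sum_right)
  also have "(\<Sum>l\<in>I. (X k \<triangleleft> M l j) \<star> X l)
      = (\<Sum>l\<in>I. sA (p k (M l j)) (X l)) + (\<Sum>l\<in>I. sA (\<epsilon>H (M l j)) (X k \<star> X l))"
    using 4 by (simp add: act_generator A.mult_add_left A.mult_scale_left A.unit_left sum.distrib)
  also have "\<dots> = X j \<star> X k"
    using 4 by (simp only: sum_delta_M commutator_M) simp
  finally show ?case by (simp add: A.mult_assoc)
qed

lemma act_generator_mult:
  assumes i: "i \<in> I"
  shows "(X i \<star> a) \<triangleleft> h = H.comult_sum (\<lambda>h1 h2. sA (p i h1) (a \<triangleleft> h2)) h + X i \<star> (a \<triangleleft> h)"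
proof -
  have "linmap sH sA (\<lambda>h. X i \<star> (a \<triangleleft> h))" by (intro linmap_intros)
  from H.comult_sum_counit_left[OF this] show ?thesis
    unfolding act_hopf_mult
    by (simp add: act_generator i A.mult_add_left A.mult_scale_left A.unit_left sweedler_plus_fun)
qed

end

text \<open>
  The recursion on generators that characterises the coaction.  In contrast to antimultiplicativity
  with respect to the smash product it does not involve the action.
\<close>

locale generator_coaction = matrix_generated +
  fixes coact
  assumes coact_in_space: "coact a \<in> tensor_space sH sA"
    and coact_linmap: "linmap sA tscale coact"
    and coact_of_unit: "coact unitA = tens sH sA 1 unitA"
    and coact_generator_mult: "j \<in> I \<Longrightarrow> coact (X j \<star> a)
      = (\<Sum>i\<in>I. sweedler sH sA (\<lambda>h b. tens sH sA (M i j * h) (X i \<star> b)) (coact a))"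
begin

abbreviation coact_sum :: "('b \<Rightarrow> 'c \<Rightarrow> 'x::ab_group_add) \<Rightarrow> 'c \<Rightarrow> 'x" where
  "coact_sum F a \<equiv> sweedler sH sA F (coact a)"

lemma linmap_coact [linmap_intros]: "linmap s sA f \<Longrightarrow> linmap s tscale (\<lambda>x. coact (f x))"
  by (rule linmap_compose[OF coact_linmap])

declare coact_in_space [linmap_intros]

lemma coact_sum_unit: "bilinear_over sH sA s F \<Longrightarrow> coact_sum F unitA = F 1 unitA"
  by (simp add: coact_of_unit sweedler_tens)

lemma coact_sum_add: "bilinear_over sH sA s F \<Longrightarrow> coact_sum F (a + b) = coact_sum F a + coact_sum F b"
  by (rule linmap_add[of sA s]) (intro linmap_intros)

lemma coact_sum_scale: "bilinear_over sH sA s F \<Longrightarrow> coact_sum F (sA c a) = s c (coact_sum F a)"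
  by (rule linmap_scale[of sA s]) (intro linmap_intros)

lemma coact_sum_generator_mult:
  assumes F: "bilinear_over sH sA s F" and j: "j \<in> I"
  shows "coact_sum F (X j \<star> a) = (\<Sum>i\<in>I. coact_sum (\<lambda>h b. F (M i j * h) (X i \<star> b)) a)"
  unfolding coact_generator_mult[OF j]
  by (simp add: sweedler_sum[OF F] sweedler_sweedler[OF F] tensor_space_closed sweedler_tens[OF F])

text \<open>
  The comodule axioms hold because the comultiplication and the counit of \<open>M\<close> are those of the
  coefficients of a comodule.
\<close>

lemma coact_sum_counit: "coact_sum (\<lambda>h b. sA (\<epsilon>H h) b) a = a"
proof (induction a rule: generated)
  have bil: "bilinear_over sH sA sA (\<lambda>h b. sA (\<epsilon>H h) b)"
    by (intro bilinear_overI linmap_intros)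
  {
    case 1
    show ?case by (simp add: coact_sum_unit[OF bil] H.counit_one)
  next
    case (2 a b)
    then show ?case by (simp add: coact_sum_add[OF bil])
  next
    case (3 c a)
    then show ?case by (simp add: coact_sum_scale[OF bil])
  next
    case (4 j a)
    have "coact_sum (\<lambda>h b. sA (\<epsilon>H h) b) (X j \<star> a)
        = (\<Sum>i\<in>I. sA (\<epsilon>H (M i j)) (coact_sum (\<lambda>h b. X i \<star> sA (\<epsilon>H h) b) a))"
      by (simp add: coact_sum_generator_mult[OF bil] 4 H.counit_mult A.mult_scale_right
          sweedler_linmap[OF linmap_scale_fun[OF linmap_id[OF A.vector_space_scale]]])
    also have "\<dots> = (\<Sum>i\<in>I. sA (\<epsilon>H (M i j)) (X i \<star> a))"
      by (subst sweedler_linmap[of sA sA "\<lambda>b. X _ \<star> b", symmetric]) (simp_all add: linmap_intros 4)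
    finally show ?case by (simp only: sum_delta_M 4)
  }
qed

lemma coact_sum_coassoc:
  assumes F: "trilinear_over sH sH sA s F"
  shows "coact_sum (\<lambda>h b. H.comult_sum (\<lambda>h1 h2. F h1 h2 b) h) a
       = coact_sum (\<lambda>h b. coact_sum (F h) b) a"
  using F
proof (induction a arbitrary: F rule: generated)
  case 1
  note [linmap_intros] = trilinear[OF 1]
  have bil: "bilinear_over sH sA s (\<lambda>h b. H.comult_sum (\<lambda>h1 h2. F h1 h2 b) h)"
    "bilinear_over sH sA s (\<lambda>h b. coact_sum (F h) b)" "bilinear_over sH sA s (F h)"
    "bilinear_over sH sH s (\<lambda>h1 h2. F h1 h2 b)" for h b
    by (intro bilinear_overI linmap_intros)+
  show ?case
    by (simp add: coact_sum_unit[OF bil(1)] coact_sum_unit[OF bil(2)] coact_sum_unit[OF bil(3)]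
        H.comult_sum_one[OF bil(4)])
next
  case (2 a b)
  note [linmap_intros] = trilinear[OF 2(3)]
  have bil: "bilinear_over sH sA s (\<lambda>h b. H.comult_sum (\<lambda>h1 h2. F h1 h2 b) h)"
    "bilinear_over sH sA s (\<lambda>h b. coact_sum (F h) b)"
    by (intro bilinear_overI linmap_intros)+
  show ?case by (simp add: coact_sum_add[OF bil(1)] coact_sum_add[OF bil(2)] 2)
next
  case (3 c a)
  note [linmap_intros] = trilinear[OF 3(2)]
  have bil: "bilinear_over sH sA s (\<lambda>h b. H.comult_sum (\<lambda>h1 h2. F h1 h2 b) h)"
    "bilinear_over sH sA s (\<lambda>h b. coact_sum (F h) b)"
    by (intro bilinear_overI linmap_intros)+
  show ?case by (simp add: coact_sum_scale[OF bil(1)] coact_sum_scale[OF bil(2)] 3)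
next
  case (4 j a)
  note j = 4(1) and [linmap_intros] = trilinear[OF 4(3)]
  have bil: "bilinear_over sH sA s (\<lambda>h b. H.comult_sum (\<lambda>h1 h2. F h1 h2 b) h)"
    "bilinear_over sH sA s (\<lambda>h b. coact_sum (F h) b)" "bilinear_over sH sA s (F h)"
    "bilinear_over sH sH s (\<lambda>h1 h2. F h1 h2 b)"
    "bilinear_over sH sH s (\<lambda>k1 k2. H.comult_sum (\<lambda>h1 h2. F (k1 * h1) (k2 * h2) b) h')" for h h' b
    by (intro bilinear_overI linmap_intros)+
  have tri: "trilinear_over sH sH sA s (\<lambda>h h' b. F (M k j * h) (M i k * h') (X i \<star> b))" for i k
    by (intro trilinear_overI linmap_intros)
  have "coact_sum (\<lambda>h b. H.comult_sum (\<lambda>h1 h2. F h1 h2 b) h) (X j \<star> a)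
      = (\<Sum>i\<in>I. \<Sum>k\<in>I. coact_sum (\<lambda>h b. H.comult_sum (\<lambda>h1 h2. F (M k j * h1) (M i k * h2) (X i \<star> b)) h) a)"
    using j by (simp add: coact_sum_generator_mult[OF bil(1)] H.comult_sum_mult[OF bil(4)] comult_M
        sweedler_sum_tens[OF bil(5)] sweedler_sum_fun)
  also have "\<dots> = (\<Sum>i\<in>I. \<Sum>k\<in>I. coact_sum (\<lambda>h b. coact_sum (\<lambda>h' b'. F (M k j * h) (M i k * h') (X i \<star> b')) b) a)"
    by (simp add: 4(2)[OF tri])
  also have "\<dots> = (\<Sum>k\<in>I. \<Sum>i\<in>I. coact_sum (\<lambda>h b. coact_sum (\<lambda>h' b'. F (M k j * h) (M i k * h') (X i \<star> b')) b) a)"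
    by (rule sum.swap)
  also have "\<dots> = coact_sum (\<lambda>h b. coact_sum (F h) b) (X j \<star> a)"
    using j by (simp add: coact_sum_generator_mult[OF bil(2)] coact_sum_generator_mult[OF bil(3)] sweedler_sum_fun)
  finally show ?case .
qed

text \<open>
  As \<open>H\<close> is commutative, the recursion makes the coaction an algebra map to the ordinary tensor
  product algebra.
\<close>

lemma coact_sum_mult:
  assumes F: "bilinear_over sH sA s F"
  shows "coact_sum F (a \<star> b) = coact_sum (\<lambda>a' a0. coact_sum (\<lambda>b' b0. F (b' * a') (a0 \<star> b0)) b) a"
  using F
proof (induction a arbitrary: F rule: generated)
  case 1
  note [linmap_intros] = bilinear[OF 1]
  have bil: "bilinear_over sH sA s (\<lambda>a' a0. coact_sum (\<lambda>b' b0. F (b' * a') (a0 \<star> b0)) b)"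
    by (intro bilinear_overI linmap_intros)
  show ?case by (simp add: coact_sum_unit[OF bil] A.unit_left)
next
  case (2 a b)
  note [linmap_intros] = bilinear[OF 2(3)]
  have bil: "bilinear_over sH sA s (\<lambda>a' a0. coact_sum (\<lambda>b' b0. F (b' * a') (a0 \<star> b0)) b)" for b
    by (intro bilinear_overI linmap_intros)
  show ?case by (simp add: A.mult_add_left coact_sum_add[OF bil] coact_sum_add[OF 2(3)] 2)
next
  case (3 c a)
  note [linmap_intros] = bilinear[OF 3(2)]
  have bil: "bilinear_over sH sA s (\<lambda>a' a0. coact_sum (\<lambda>b' b0. F (b' * a') (a0 \<star> b0)) b)" for b
    by (intro bilinear_overI linmap_intros)
  show ?case by (simp add: A.mult_scale_left coact_sum_scale[OF bil] coact_sum_scale[OF 3(2)] 3)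
next
  case (4 j a)
  note j = 4(1) and [linmap_intros] = bilinear[OF 4(3)]
  have bil: "bilinear_over sH sA s (\<lambda>a' a0. coact_sum (\<lambda>b' b0. F (b' * a') (a0 \<star> b0)) b)"
    "bilinear_over sH sA s (\<lambda>h b. F (M i j * h) (X i \<star> b))" for b i
    by (intro bilinear_overI linmap_intros)+
  show ?case
    by (simp add: A.mult_assoc coact_sum_generator_mult[OF 4(3) j] coact_sum_generator_mult[OF bil(1) j]
        4(2)[OF bil(2)] H_left_commute)
qed

text \<open>
  For \<open>b = X\<^sub>j c\<close> commutativity of \<open>H\<close> lets \<open>M\<^sup>i\<^sub>j\<close> act last, so that \<open>act_matrix_commute\<close> moves
  \<open>X\<^sub>j\<close> to the front.
\<close>

lemma coact_sum_braided_commute: "coact_sum (\<lambda>h b0. (a \<triangleleft> h) \<star> b0) b = b \<star> a"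
proof (induction b arbitrary: a rule: generated)
  have bil: "bilinear_over sH sA sA (\<lambda>h b. (a \<triangleleft> h) \<star> b)" for a
    by (intro bilinear_overI linmap_intros)
  {
    case 1
    show ?case by (simp add: coact_sum_unit[OF bil] act_one A.unit_left A.unit_right)
  next
    case (2 a b)
    then show ?case by (simp add: coact_sum_add[OF bil] A.mult_add_left)
  next
    case (3 c a)
    then show ?case by (simp add: coact_sum_scale[OF bil] A.mult_scale_left)
  next
    case (4 j b)
    have "(\<Sum>i\<in>I. (a \<triangleleft> (M i j * h)) \<star> (X i \<star> b0)) = (\<Sum>i\<in>I. ((a \<triangleleft> h) \<triangleleft> M i j) \<star> X i) \<star> b0" for h b0
      by (simp add: H_commute[of _ h] A.mult_sum_left A.mult_assoc act_mult)
    then have "(\<Sum>i\<in>I. (a \<triangleleft> (M i j * h)) \<star> (X i \<star> b0)) = X j \<star> ((a \<triangleleft> h) \<star> b0)" for h b0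
      by (simp add: act_matrix_commute[OF 4(1)] A.mult_assoc)
    then have "coact_sum (\<lambda>h b0. (a \<triangleleft> h) \<star> b0) (X j \<star> b) = coact_sum (\<lambda>h b0. X j \<star> ((a \<triangleleft> h) \<star> b0)) b"
      by (simp add: coact_sum_generator_mult[OF bil 4(1)] flip: sweedler_sum_fun)
    also have "\<dots> = X j \<star> (b \<star> a)"
      by (subst sweedler_linmap[of sA sA "\<lambda>b. X j \<star> b", symmetric]) (intro linmap_intros, simp add: 4)
    finally show ?case by (simp add: A.mult_assoc)
  }
qed

text \<open>
  One step of the induction for the Yetter--Drinfeld condition.  The action of \<open>h\<^sub>2\<close> on \<open>X\<^sub>i b\<close> has two
  parts by \<open>act_generator_mult\<close>; in the part without \<open>X\<^sub>i\<close> the factor \<open>M\<^sup>i\<^sub>j\<close> is removed by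
  \<open>intertwiner_M\<close>.
\<close>

lemma act_generator_mult_intertwine:
  assumes F: "bilinear_over sH sA s F" and j: "j \<in> I"
  shows "(\<Sum>i\<in>I. H.comult_sum (\<lambda>h1 h2. F (M i j * k * h1) ((X i \<star> b) \<triangleleft> h2)) h)
    = H.comult_sum (\<lambda>h1 h2. s (p j h1) (H.comult_sum (\<lambda>k1 k2. F (k * k1) (b \<triangleleft> k2)) h2)) h
      + (\<Sum>i\<in>I. H.comult_sum (\<lambda>h1 h2. F (M i j * (k * h1)) (X i \<star> (b \<triangleleft> h2))) h)"
proof -
  note [linmap_intros] = bilinear_spaces(3)[OF F] bilinear[OF F]
  have lin: "linmap sA s (\<lambda>a. F c a)" "linmap sH s (\<lambda>h. F h a)" for c a
    by (intro linmap_intros)+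
  note F_simps = linmap_scale[OF lin(1)] linmap_scale[OF lin(2)] linmap_add[OF lin(1)]
  have tri: "trilinear_over sH sH sH s (\<lambda>h1 h2 h3. s (p i h2) (F (M i j * k * h1) (b \<triangleleft> h3)))"
    if "i \<in> I" for i
    using that by (intro trilinear_overI linmap_intros)
  have tri': "trilinear_over sH sH sH s (\<lambda>h1 h2 h3. s (p j h1) (F (k * h2) (b \<triangleleft> h3)))"
    using j by (intro trilinear_overI linmap_intros)
  have lin_M: "linmap sH s (\<lambda>x. F (M i j * k * x) c)" "linmap sH s (\<lambda>x. F (k * x) c)" for i c
    by (intro linmap_intros)+
  have move: "(\<Sum>i\<in>I. H.comult_sum (\<lambda>h1 h2. s (p i h2) (F (M i j * k * h1) c)) h')
      = H.comult_sum (\<lambda>h1 h2. s (p j h1) (F (k * h2) c)) h'" for c h'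
  proof -
    have lin_kM: "linmap sH s (\<lambda>x. F (k * (M i j * x)) c)" for i
      by (intro linmap_intros)
    have "M i j * k * h1 = k * (M i j * h1)" for i h1
      by (metis H_commute mult.assoc)
    then have "(\<Sum>i\<in>I. H.comult_sum (\<lambda>h1 h2. s (p i h2) (F (M i j * k * h1) c)) h')
        = F (k * (\<Sum>i\<in>I. M i j * H.comult_sum (\<lambda>h1 h2. sH (p i h2) h1) h')) c"
      by (simp add: linmap_sum[OF lin_M(2)] sweedler_linmap[OF lin_kM] linmap_scale[OF lin_kM])
    then show ?thesis
      by (simp add: intertwiner_M[OF j] sweedler_linmap[OF lin_M(2)] linmap_scale[OF lin_M(2)])
  qed
  have "(\<Sum>i\<in>I. H.comult_sum (\<lambda>h1 h2. F (M i j * k * h1) ((X i \<star> b) \<triangleleft> h2)) h)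
    = (\<Sum>i\<in>I. H.comult_sum (\<lambda>h1 h2. H.comult_sum (\<lambda>k1 k2. s (p i k1) (F (M i j * k * h1) (b \<triangleleft> k2))) h2) h)
      + (\<Sum>i\<in>I. H.comult_sum (\<lambda>h1 h2. F (M i j * (k * h1)) (X i \<star> (b \<triangleleft> h2))) h)"
    by (simp add: act_generator_mult F_simps sweedler_linmap[OF lin(1)] sweedler_plus_fun sum.distrib
        mult.assoc cong: sum.cong)
  also have "(\<Sum>i\<in>I. H.comult_sum (\<lambda>h1 h2. H.comult_sum (\<lambda>k1 k2. s (p i k1) (F (M i j * k * h1) (b \<triangleleft> k2))) h2) h)
      = H.comult_sum (\<lambda>g h3. \<Sum>i\<in>I. H.comult_sum (\<lambda>h1 h2. s (p i h2) (F (M i j * k * h1) (b \<triangleleft> h3))) g) h"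
    unfolding sweedler_sum_fun by (rule sum.cong[OF refl H.comult_sum_coassoc[OF tri, symmetric]])
  also have "\<dots> = H.comult_sum (\<lambda>h1 h2. H.comult_sum (\<lambda>k1 k2. s (p j h1) (F (k * k1) (b \<triangleleft> k2))) h2) h"
    unfolding move by (rule H.comult_sum_coassoc[OF tri'])
  finally show ?thesis
    by (simp add: sweedler_linmap[OF linmap_scale_fun[OF linmap_id[OF bilinear_spaces(3)[OF F]]]])
qed

lemma coact_sum_yetter_drinfeld:
  assumes F: "bilinear_over sH sA s F"
  shows "coact_sum (\<lambda>a' a0. H.comult_sum (\<lambda>h1 h2. F (a' * h1) (a0 \<triangleleft> h2)) h) a
       = H.comult_sum (\<lambda>h1 h2. coact_sum (\<lambda>a' a0. F (h2 * a') a0) (a \<triangleleft> h1)) h"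
  using F
proof (induction a arbitrary: F h rule: generated)
  case 1
  note [linmap_intros] = bilinear_spaces(3)[OF 1] bilinear[OF 1]
  have bil: "bilinear_over sH sA s (\<lambda>a' a0. H.comult_sum (\<lambda>h1 h2. F (a' * h1) (a0 \<triangleleft> h2)) h)"
    "bilinear_over sH sA s (\<lambda>a' a0. F (h2 * a') a0)" for h h2
    by (intro bilinear_overI linmap_intros)+
  have lin: "linmap sA s (F c)" "linmap sH s (\<lambda>h. F h unitA)" for c
    by (intro linmap_intros)+
  show ?case
    by (simp add: coact_sum_unit[OF bil(1)] coact_sum_unit[OF bil(2)] coact_sum_scale[OF bil(2)]
        act_hopf_unit linmap_scale[OF lin(1)] H.comult_sum_counit_left[OF lin(2)] H.comult_sum_counit_right[OF lin(2)])
next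
  case (2 a b)
  note [linmap_intros] = bilinear[OF 2(3)]
  have bil: "bilinear_over sH sA s (\<lambda>a' a0. H.comult_sum (\<lambda>h1 h2. F (a' * h1) (a0 \<triangleleft> h2)) h)"
    "bilinear_over sH sA s (\<lambda>a' a0. F (h2 * a') a0)" for h h2
    by (intro bilinear_overI linmap_intros)+
  show ?case
    by (simp add: coact_sum_add[OF bil(1)] coact_sum_add[OF bil(2)] act_add sweedler_plus_fun 2)
next
  case (3 c a)
  note [linmap_intros] = bilinear_spaces(3)[OF 3(2)] bilinear[OF 3(2)]
  have bil: "bilinear_over sH sA s (\<lambda>a' a0. H.comult_sum (\<lambda>h1 h2. F (a' * h1) (a0 \<triangleleft> h2)) h)"
    "bilinear_over sH sA s (\<lambda>a' a0. F (h2 * a') a0)" for h h2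
    by (intro bilinear_overI linmap_intros)+
  show ?case
    by (simp add: coact_sum_scale[OF bil(1)] coact_sum_scale[OF bil(2)] act_scale 3
        sweedler_linmap[OF linmap_scale_fun[OF linmap_id[OF bilinear_spaces(3)[OF 3(2)]]]])
next
  case (4 j b)
  note F = 4(3) and j = 4(1)
  note [linmap_intros] = bilinear_spaces(3)[OF F] bilinear[OF F]
  note lin_s = linmap_scale_fun[OF linmap_id[OF bilinear_spaces(3)[OF F]]]
  have bil: "bilinear_over sH sA s (\<lambda>a' a0. H.comult_sum (\<lambda>h1 h2. F (a' * h1) (a0 \<triangleleft> h2)) h)"
    "bilinear_over sH sA s (\<lambda>a' a0. F (h2 * a') a0)"
    "bilinear_over sH sA s (\<lambda>h a. F (M i j * h) (X i \<star> a))" for h h2 i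
    by (intro bilinear_overI linmap_intros)+
  have tri: "trilinear_over sH sH sH s (\<lambda>h1 h2 h3. s (p j h1) (coact_sum (\<lambda>a' a0. F (h3 * a') a0) (b \<triangleleft> h2)))"
    using j by (intro trilinear_overI bilinear_overI linmap_intros)
  have lin: "linmap sA s (coact_sum (\<lambda>a' a0. F (h2 * a') a0))" for h2
    by (intro bilinear_overI linmap_intros)
  have "coact_sum (\<lambda>a' a0. H.comult_sum (\<lambda>h1 h2. F (a' * h1) (a0 \<triangleleft> h2)) h) (X j \<star> b)
    = coact_sum (\<lambda>a' a0. \<Sum>i\<in>I. H.comult_sum (\<lambda>h1 h2. F (M i j * a' * h1) ((X i \<star> a0) \<triangleleft> h2)) h) b"
    by (simp add: coact_sum_generator_mult[OF bil(1) j] sweedler_sum_fun)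
  also have "\<dots> = H.comult_sum (\<lambda>h1 h2. s (p j h1) (coact_sum (\<lambda>a' a0. H.comult_sum (\<lambda>k1 k2. F (a' * k1) (a0 \<triangleleft> k2)) h2) b)) h
      + (\<Sum>i\<in>I. coact_sum (\<lambda>a' a0. H.comult_sum (\<lambda>h1 h2. F (M i j * (a' * h1)) (X i \<star> (a0 \<triangleleft> h2))) h) b)"
    unfolding act_generator_mult_intertwine[OF F j] sweedler_plus_fun sweedler_sum_fun
    by (simp add: sweedler_linmap[OF lin_s] sweedler_swap[of sH sA sH sH])
  also have "(\<Sum>i\<in>I. coact_sum (\<lambda>a' a0. H.comult_sum (\<lambda>h1 h2. F (M i j * (a' * h1)) (X i \<star> (a0 \<triangleleft> h2))) h) b)
      = H.comult_sum (\<lambda>h1 h2. coact_sum (\<lambda>a' a0. F (h2 * a') a0) (X j \<star> (b \<triangleleft> h1))) h"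
    unfolding 4(2)[OF bil(3)] coact_sum_generator_mult[OF bil(2) j] sweedler_sum_fun
    by (simp add: H_left_commute)
  also have "H.comult_sum (\<lambda>h1 h2. s (p j h1) (coact_sum (\<lambda>a' a0. H.comult_sum (\<lambda>k1 k2. F (a' * k1) (a0 \<triangleleft> k2)) h2) b)) h
      = H.comult_sum (\<lambda>h1 h2. H.comult_sum (\<lambda>k1 k2. s (p j h1) (coact_sum (\<lambda>a' a0. F (k2 * a') a0) (b \<triangleleft> k1))) h2) h"
    by (simp add: 4(2)[OF F] sweedler_linmap[OF lin_s])
  also have "\<dots> = H.comult_sum (\<lambda>g h3. coact_sum (\<lambda>a' a0. F (h3 * a') a0) (H.comult_sum (\<lambda>h1 h2. sA (p j h1) (b \<triangleleft> h2)) g)) h"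
    unfolding H.comult_sum_coassoc[OF tri, symmetric]
    by (simp add: sweedler_linmap[OF lin] linmap_scale[OF lin])
  finally show ?case
    by (simp add: act_generator_mult[OF j] coact_sum_add[OF bil(2)] sweedler_plus_fun)
qed

text \<open>
  In the smash product the left factor of one element acts on the other.  Coassociativity replaces
  that factor by a second application of the coaction, and braided commutativity then removes the
  action: \<open>\<Sum> (b \<triangleleft> a\<^sub>-\<^sub>1) a\<^sub>0 = a b\<close>.
\<close>

lemma coact_smash_antimult: "coact (a \<star> b) = smash_mult sH \<Delta>H sA multA act (coact b) (coact a)"
proof -
  have tri: "trilinear_over sH sH sA tscale (\<lambda>h1 h2 a0. tens sH sA (b' * h1) ((b0 \<triangleleft> h2) \<star> a0))" for b' b0
    by (intro trilinear_overI linmap_intros)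
  have lin: "linmap sA tscale (\<lambda>a. tens sH sA h a)" for h
    by (intro linmap_intros)
  have bil: "bilinear_over sH sA tscale (tens sH sA)"
    by (intro bilinear_overI linmap_intros)
  have "smash_mult sH \<Delta>H sA multA act (coact b) (coact a)
      = coact_sum (\<lambda>b' b0. coact_sum (\<lambda>a' a0. tens sH sA (b' * a') (a0 \<star> b0)) a) b"
    unfolding smash_mult_def coact_sum_coassoc[OF tri]
    by (simp add: coact_sum_braided_commute flip: sweedler_linmap[OF lin])
  also have "\<dots> = coact_sum (tens sH sA) (a \<star> b)"
    unfolding coact_sum_mult[OF bil] by (rule sweedler_swap)
  also have "\<dots> = coact (a \<star> b)"
    by (rule tensor_sweedler) (intro linmap_intros)+
  finally show ?thesis ..
qed

lemma coact_generator:
  assumes j: "j \<in> I"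
  shows "coact (X j) = (\<Sum>i\<in>I. tens sH sA (M i j) (X i))"
proof -
  have bil: "bilinear_over sH sA tscale (\<lambda>h b. tens sH sA (M i j * h) (X i \<star> b))" for i
    by (intro bilinear_overI linmap_intros)
  show ?thesis
    using coact_generator_mult[OF j, of unitA]
    by (simp add: A.unit_right coact_of_unit sweedler_tens[OF bil])
qed

lemma antimultiplicative: "antimultiplicative_to_smash sH \<Delta>H sA multA unitA act coact"
  by (simp add: antimultiplicative_to_smash_def coact_in_space coact_linmap coact_of_unit coact_smash_antimult)

lemma yetter_drinfeld: "yetter_drinfeld_module_algebra sH \<Delta>H \<epsilon>H sA multA unitA act coact"
proof (intro yetter_drinfeld_module_algebra.intro right_hopf_action_axioms
    yetter_drinfeld_module_algebra_axioms.intro)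
  have bil: "bilinear_over sH sA tscale (tens sH sA)"
    by (intro bilinear_overI linmap_intros)
  have tri: "trilinear_over sH sH sA tscale (tens3 sH sH sA)"
    by (intro trilinear_overI linmap_intros)
  have pure: "coact_sum (tens sH sA) a = coact a" for a
    by (rule tensor_sweedler) (intro linmap_intros)+
  fix a b h
  show "coact a \<in> tensor_space sH sA" by (rule coact_in_space)
  show "linmap sA tscale coact" by (rule coact_linmap)
  show "coact_sum (\<lambda>h b. sA (\<epsilon>H h) b) a = a" by (rule coact_sum_counit)
  show "coact_sum (\<lambda>h b. H.comult_sum (\<lambda>h1 h2. tens3 sH sH sA h1 h2 b) h) a
    = coact_sum (\<lambda>h b. coact_sum (\<lambda>h' b'. tens3 sH sH sA h h' b') b) a"
    by (rule coact_sum_coassoc[OF tri])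
  show "coact_sum (\<lambda>a' a0. H.comult_sum (\<lambda>h1 h2. tens sH sA (a' * h1) (a0 \<triangleleft> h2)) h) a
    = H.comult_sum (\<lambda>h1 h2. coact_sum (\<lambda>a' a0. tens sH sA (h2 * a') a0) (a \<triangleleft> h1)) h"
    by (rule coact_sum_yetter_drinfeld[OF bil])
  show "coact (a \<star> b) = coact_sum (\<lambda>a' a0. coact_sum (\<lambda>b' b0. tens sH sA (b' * a') (a0 \<star> b0)) b) a"
    using coact_sum_mult[OF bil] by (simp add: pure)
  show "coact unitA = tens sH sA 1 unitA" by (rule coact_of_unit)
qed

lemma braided_commutative: "braided_commutative sH sA multA act coact"
  by (simp add: braided_commutative_def coact_sum_braided_commute)

end

context matrix_generated
begin

text \<open>
  Multiplying by \<open>\<lambda>(X\<^sub>j)\<close> in the smash product produces \<open>\<Sum>\<^sub>i (b \<triangleleft> M\<^sup>i\<^sub>k) X\<^sub>i\<close>, to which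
  \<open>act_matrix_commute\<close> applies.
\<close>

lemma generator_coaction_if_antimultiplicative:
  assumes anti: "antimultiplicative_to_smash sH \<Delta>H sA multA unitA act coact"
    and gen: "\<And>j. j \<in> I \<Longrightarrow> coact (X j) = (\<Sum>i\<in>I. tens sH sA (M i j) (X i))"
  shows "generator_coaction sH \<Delta>H \<epsilon>H sA multA unitA act I X M p coact"
proof (intro generator_coaction.intro matrix_generated_axioms generator_coaction_axioms.intro)
  show "coact a \<in> tensor_space sH sA" for a
    using anti by (simp add: antimultiplicative_to_smash_def)
  show "linmap sA tscale coact" "coact unitA = tens sH sA 1 unitA"
    using anti by (simp_all add: antimultiplicative_to_smash_def)
  fix j a assume j: "j \<in> I"
  have bil: "bilinear_over sH sA tscale (\<lambda>h' a'. H.comult_sum (\<lambda>h1 h2. tens sH sA (h * h1) ((b \<triangleleft> h2) \<star> a')) h')"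
    "bilinear_over sH sH tscale (\<lambda>h1 h2. tens sH sA (h * h1) ((b \<triangleleft> h2) \<star> a'))" for h b a'
    by (intro bilinear_overI linmap_intros)+
  have lin: "linmap sA tscale (tens sH sA h)" for h
    by (intro linmap_intros)
  have "coact (X j \<star> a) = smash_mult sH \<Delta>H sA multA act (coact a) (\<Sum>i\<in>I. tens sH sA (M i j) (X i))"
    using anti j by (simp add: antimultiplicative_to_smash_def gen)
  also have "\<dots> = sweedler sH sA (\<lambda>h b. \<Sum>i\<in>I. \<Sum>k\<in>I. tens sH sA (h * M k j) ((b \<triangleleft> M i k) \<star> X i)) (coact a)"
    using j by (simp add: smash_mult_def sweedler_sum_tens[OF bil(1)] comult_M sweedler_sum_tens[OF bil(2)] cong: sum.cong)
  also have "\<dots> = sweedler sH sA (\<lambda>h b. \<Sum>k\<in>I. tens sH sA (M k j * h) (X k \<star> b)) (coact a)"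
    by (subst sum.swap) (simp add: H_commute act_matrix_commute flip: linmap_sum[OF lin] cong: sum.cong)
  finally show "coact (X j \<star> a) = (\<Sum>i\<in>I. sweedler sH sA (\<lambda>h b. tens sH sA (M i j * h) (X i \<star> b)) (coact a))"
    by (simp add: sweedler_sum_fun)
qed

lemma generator_coaction_unique:
  assumes "generator_coaction sH \<Delta>H \<epsilon>H sA multA unitA act I X M p coact"
    and "generator_coaction sH \<Delta>H \<epsilon>H sA multA unitA act I X M p coact'"
  shows "coact = coact'"
proof
  interpret c: generator_coaction sH \<Delta>H \<epsilon>H sA multA unitA act I X M p coact by fact
  interpret c': generator_coaction sH \<Delta>H \<epsilon>H sA multA unitA act I X M p coact' by fact
  fix a
  show "coact a = coact' a"
    by (induction a rule: generated)
      (simp_all add: c.coact_of_unit c'.coact_of_unit linmap_add[OF c.coact_linmap] linmap_add[OF c'.coact_linmap]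
        linmap_scale[OF c.coact_linmap] linmap_scale[OF c'.coact_linmap]
        c.coact_generator_mult c'.coact_generator_mult)
qed

end

section \<open>The co-opposite bialgebra\<close>

context bialgebra
begin

lemma sweedler_co_opposite:
  assumes F: "bilinear_over scale scale s F"
  shows "sweedler scale scale F (co_opposite scale \<Delta> h) = comult_sum (\<lambda>a b. F b a) h"
  unfolding co_opposite_def
  by (simp add: sweedler_sweedler[OF F] tensor_space_closed sweedler_tens[OF F])

lemma bialgebra_co_opposite: "bialgebra scale (co_opposite scale \<Delta>) \<epsilon>"
proof (intro bialgebra.intro assoc_algebra_axioms bialgebra_axioms.intro)
  fix h h'
  show "co_opposite scale \<Delta> h \<in> tensor_space scale scale"
    unfolding co_opposite_def by (intro tensor_space_closed)
  show "linmap scale tscale (co_opposite scale \<Delta>)"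
    unfolding co_opposite_def by (intro bilinear_overI linmap_intros)
  show "linmap scale (*) \<epsilon>" by (intro linmap_intros)
  have bil: "bilinear_over scale scale tscale (\<lambda>a b. sweedler scale scale (\<lambda>a1 a2. tens3 scale scale scale a1 a2 b) (co_opposite scale \<Delta> a))"
    "bilinear_over scale scale tscale (\<lambda>a b. sweedler scale scale (\<lambda>b1 b2. tens3 scale scale scale a b1 b2) (co_opposite scale \<Delta> b))"
    "bilinear_over scale scale tscale (\<lambda>a1 a2. tens3 scale scale scale a1 a2 c)"
    "bilinear_over scale scale tscale (\<lambda>a1 a2. tens3 scale scale scale c a1 a2)" for c
    unfolding co_opposite_def by (intro bilinear_overI linmap_intros tensor_space_closed)+
  have tri: "trilinear_over scale scale scale tscale (\<lambda>a b c. tens3 scale scale scale c b a)"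
    by (intro trilinear_overI linmap_intros)
  show "sweedler scale scale (\<lambda>a b. sweedler scale scale (\<lambda>a1 a2. tens3 scale scale scale a1 a2 b)
      (co_opposite scale \<Delta> a)) (co_opposite scale \<Delta> h)
    = sweedler scale scale (\<lambda>a b. sweedler scale scale (\<lambda>b1 b2. tens3 scale scale scale a b1 b2)
      (co_opposite scale \<Delta> b)) (co_opposite scale \<Delta> h)"
    unfolding sweedler_co_opposite[OF bil(1)] sweedler_co_opposite[OF bil(2)]
    unfolding sweedler_co_opposite[OF bil(3)] sweedler_co_opposite[OF bil(4)]
    by (rule comult_sum_coassoc[OF tri, symmetric])
  have bil: "bilinear_over scale scale scale (\<lambda>a b. scale (\<epsilon> a) b)"
    "bilinear_over scale scale scale (\<lambda>a b. scale (\<epsilon> b) a)"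
    by (intro bilinear_overI linmap_intros)+
  show "sweedler scale scale (\<lambda>a b. scale (\<epsilon> a) b) (co_opposite scale \<Delta> h) = h"
    "sweedler scale scale (\<lambda>a b. scale (\<epsilon> b) a) (co_opposite scale \<Delta> h) = h"
    using sweedler_co_opposite[OF bil(1)] sweedler_co_opposite[OF bil(2)] counit_left counit_right by simp_all
  have bil: "bilinear_over scale scale tscale (\<lambda>a b. sweedler scale scale (\<lambda>a' b'. tens scale scale (a * a') (b * b'))
        (co_opposite scale \<Delta> h'))"
    "bilinear_over scale scale tscale (\<lambda>a' b'. tens scale scale (a * a') (b * b'))"
    "bilinear_over scale scale tscale (\<lambda>a b. tens scale scale b a)" for h' a b
    by (intro bilinear_overI linmap_intros)+
  show "co_opposite scale \<Delta> (h * h') = sweedler scale scale (\<lambda>a b.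
      sweedler scale scale (\<lambda>a' b'. tens scale scale (a * a') (b * b')) (co_opposite scale \<Delta> h'))
      (co_opposite scale \<Delta> h)"
    unfolding sweedler_co_opposite[OF bil(1)] unfolding sweedler_co_opposite[OF bil(2)]
    by (simp add: co_opposite_def comult_sum_mult[OF bil(3)])
  show "co_opposite scale \<Delta> 1 = tens scale scale 1 1"
    by (simp add: co_opposite_def comult_sum_one[OF bil(3)])
qed (simp_all add: counit_mult counit_one)

end

section \<open>Universal enveloping algebras\<close>

text \<open>
  The linear extension of a function on words to the free algebra, as \<open>evaluate_words\<close> but with an
  arbitrary target.
\<close>

definition word_combination ::
  "('k::field \<Rightarrow> 'v::ab_group_add \<Rightarrow> 'v) \<Rightarrow> ('w \<Rightarrow> 'v) \<Rightarrow> ('w \<Rightarrow>\<^sub>0 'k) \<Rightarrow> 'v" where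
  "word_combination s f p = (\<Sum>w\<in>Poly_Mapping.keys p. s (Poly_Mapping.lookup p w) (f w))"

lemma evaluate_words_eq: "evaluate_words s inc = word_combination s (\<lambda>w. prod_list (map inc w))"
  by (simp add: evaluate_words_def word_combination_def fun_eq_iff)

lemma lookup_scale: "Poly_Mapping.lookup (Poly_Mapping.map ((*) c) p) w = c * Poly_Mapping.lookup p (w :: 'w)"
  for c :: "'k::field"
  by (simp add: Poly_Mapping.map.rep_eq when_def)

context vector_space
begin

lemma word_combination_superset:
  assumes "finite A" "Poly_Mapping.keys p \<subseteq> A"
  shows "word_combination scale f p = (\<Sum>w\<in>A. scale (Poly_Mapping.lookup p w) (f w))"
  unfolding word_combination_def
  by (rule sum.mono_neutral_left) (use assms in \<open>auto simp: in_keys_iff\<close>)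

lemma word_combination_add:
  "word_combination scale f (p + q) = word_combination scale f p + word_combination scale f q"
proof -
  let ?A = "Poly_Mapping.keys p \<union> Poly_Mapping.keys q"
  have A: "finite ?A" by simp
  show ?thesis
    using word_combination_superset[OF A, of "p + q" f] word_combination_superset[OF A, of p f]
      word_combination_superset[OF A, of q f] Poly_Mapping.keys_add[of p q]
    by (simp add: lookup_add scale_left_distrib sum.distrib)
qed

lemma word_combination_scale:
  "word_combination scale f (Poly_Mapping.map ((*) c) p) = scale c (word_combination scale f p)"
proof -
  have "Poly_Mapping.keys (Poly_Mapping.map ((*) c) p) \<subseteq> Poly_Mapping.keys p"
    by (auto simp: in_keys_iff lookup_scale)
  then show ?thesis
    using word_combination_superset[of "Poly_Mapping.keys p" "Poly_Mapping.map ((*) c) p" f]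
    by (simp add: word_combination_def lookup_scale scale_sum_right)
qed

lemma word_combination_diff:
  "word_combination scale f (p - q) = word_combination scale f p - word_combination scale f q"
  using word_combination_add[of f "p - q" q] by (simp add: algebra_simps)

lemma word_combination_single: "word_combination scale f (Poly_Mapping.single w c) = scale c (f w)"
  by (simp add: word_combination_def)

lemma word_combination_0: "word_combination scale f 0 = 0"
  by (simp add: word_combination_def)

lemmas word_combination_linear = word_combination_add word_combination_scale word_combination_diff
  word_combination_single word_combination_0

end

context enveloping_hopf_algebra
begin

lemma inc_add: "inc (x + y) = inc x + inc y"
  and inc_scale: "inc (sg c x) = sU c (inc x)"
  and inc_bracket: "inc (bracket x y) = inc x * inc y - inc y * inc x"
  using enveloping_ideal.generator_plus[of "[]" x y "[]" sg bracket]
    enveloping_ideal.generator_scale[of "[]" sg c x "[]" bracket]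
    enveloping_ideal.generator_bracket[of "[]" x y "[]" bracket sg]
  unfolding evaluate_kernel[symmetric] evaluate_words_eq
  by (simp_all add: U.word_combination_linear algebra_simps)

lemma linmap_inc [linmap_intros]: "linmap s sg f \<Longrightarrow> linmap s sU (\<lambda>x. inc (f x))"
  by (auto simp: Vector_Spaces.linear_iff inc_add inc_scale U.vector_space_axioms)

lemma enveloping_word_induct [case_names word add scale]:
  assumes word: "\<And>w. P (prod_list (map inc w))"
    and add: "\<And>a b. P a \<Longrightarrow> P b \<Longrightarrow> P (a + b)" and scale: "\<And>c a. P a \<Longrightarrow> P (sU c a)"
  shows "P a"
proof -
  obtain p where p: "a = evaluate_words sU inc p" using evaluate_surj by blast
  \<comment> \<open>The empty sum needs the value 0, which is a multiple of the empty word.\<close>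
  have "P 0" using scale[OF word, of 0 "[]"] by simp
  then have "P (\<Sum>w\<in>W. sU (r w) (prod_list (map inc w)))" for r W
    by (induction W rule: infinite_finite_induct) (auto intro: add scale word)
  then show ?thesis by (simp add: p evaluate_words_def)
qed

lemma enveloping_induct_left [case_names one add scale mult]:
  assumes "P 1" "\<And>a b. P a \<Longrightarrow> P b \<Longrightarrow> P (a + b)" "\<And>c a. P a \<Longrightarrow> P (sU c a)"
    "\<And>x a. P a \<Longrightarrow> P (inc x * a)"
  shows "P a"
proof (induction a rule: enveloping_word_induct)
  case (word w)
  show ?case by (induction w) (simp_all add: assms)
qed (fact assms)+

lemma enveloping_induct_right [case_names one add scale mult]:
  assumes "P 1" "\<And>a b. P a \<Longrightarrow> P b \<Longrightarrow> P (a + b)" "\<And>c a. P a \<Longrightarrow> P (sU c a)"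
    "\<And>x a. P a \<Longrightarrow> P (a * inc x)"
  shows "P a"
proof (induction a rule: enveloping_word_induct)
  case (word w)
  show ?case by (induction w rule: rev_induct) (simp_all add: assms)
qed (fact assms)+

text \<open>
  The universal property in a form without algebra structure on the target: a function on words
  that respects the defining relations inside words factors through the enveloping algebra.
\<close>

lemma enveloping_universal:
  fixes s :: "'k \<Rightarrow> 'v::ab_group_add \<Rightarrow> 'v" and f :: "'g list \<Rightarrow> 'v"
  assumes "vector_space s"
    and plus: "\<And>u x y v. f (u @ [x + y] @ v) = f (u @ [x] @ v) + f (u @ [y] @ v)"
    and scale: "\<And>u c x v. f (u @ [sg c x] @ v) = s c (f (u @ [x] @ v))"
    and comm: "\<And>u x y v. f (u @ [x, y] @ v) = f (u @ [y, x] @ v) + f (u @ [bracket x y] @ v)"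
  obtains \<phi> where "linmap sU s \<phi>" "\<And>w. \<phi> (prod_list (map inc w)) = f w"
proof -
  interpret V: vector_space s by fact
  have ideal: "word_combination s f p = 0" if "p \<in> enveloping_ideal sg bracket" for p
    using that
  proof induction
    case (generator_bracket u x y v)
    show ?case using comm[of u x y v] by (simp add: V.word_combination_linear)
  qed (simp_all add: V.word_combination_linear plus[simplified] scale[simplified])
  have cong: "word_combination s f p = word_combination s f q"
    if "evaluate_words sU inc p = evaluate_words sU inc q" for p q
  proof -
    have "evaluate_words sU inc (p - q) = 0"
      using that by (simp add: evaluate_words_eq U.word_combination_linear)
    then show ?thesis
      using ideal[of "p - q"] by (simp add: evaluate_kernel V.word_combination_linear)
  qed
  define \<phi> where "\<phi> a = word_combination s f (SOME p. evaluate_words sU inc p = a)" for a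
  have \<phi>: "\<phi> (evaluate_words sU inc p) = word_combination s f p" for p
    unfolding \<phi>_def by (rule cong, rule someI_ex) blast
  have "linmap sU s \<phi>"
  proof (rule linmapI)
    fix a b c
    obtain p q where "a = evaluate_words sU inc p" "b = evaluate_words sU inc q"
      using evaluate_surj by (metis surjD)
    then show "\<phi> (a + b) = \<phi> a + \<phi> b" "\<phi> (sU c a) = s c (\<phi> a)"
      using \<phi>[of "p + q"] \<phi>[of "Poly_Mapping.map ((*) c) p"] \<phi>[of p] \<phi>[of q]
      by (simp_all add: evaluate_words_eq U.word_combination_linear V.word_combination_linear)
  qed (use U.vector_space_axioms assms(1) in auto)
  moreover have "\<phi> (prod_list (map inc w)) = f w" for w
    using \<phi>[of "Poly_Mapping.single w 1"]
    by (simp add: evaluate_words_eq U.word_combination_linear V.word_combination_linear)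
  ultimately show ?thesis using that by blast
qed

lemma comult_sum_inc_mult:
  assumes F: "bilinear_over sU sU s F"
  shows "U.comult_sum F (inc x * a)
    = U.comult_sum (\<lambda>a1 a2. F (inc x * a1) a2) a + U.comult_sum (\<lambda>a1 a2. F a1 (inc x * a2)) a"
proof -
  note [linmap_intros] = bilinear[OF F]
  have bil: "bilinear_over sU sU s (\<lambda>y1 y2. U.comult_sum (\<lambda>a1 a2. F (y1 * a1) (y2 * a2)) a)"
    by (intro bilinear_overI linmap_intros)
  show ?thesis
    by (simp add: U.comult_sum_mult[OF F] comult_inc sweedler_add[OF bil] sweedler_tens[OF bil]
        tensor_space_closed)
qed

text \<open>
  Multiplication by a primitive element preserves symmetry of the coproduct.
\<close>

lemma enveloping_cocommutative:
  assumes "bilinear_over sU sU s F"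
  shows "U.comult_sum F a = U.comult_sum (\<lambda>a1 a2. F a2 a1) a"
  using assms
proof (induction a arbitrary: F rule: enveloping_induct_left)
  case one
  note [linmap_intros] = bilinear[OF one]
  have "bilinear_over sU sU s (\<lambda>a1 a2. F a2 a1)" by (intro bilinear_overI linmap_intros)
  with one show ?case by (simp add: U.comult_sum_one)
next
  case (add a b)
  note [linmap_intros] = bilinear[OF add(3)]
  have bil: "bilinear_over sU sU s (\<lambda>a1 a2. F a2 a1)" by (intro bilinear_overI linmap_intros)
  show ?case
    using add by (simp add: U.comult_sum_add[OF bil] U.comult_sum_add[OF add(3)])
next
  case (scale c a)
  note [linmap_intros] = bilinear[OF scale(2)]
  have bil: "bilinear_over sU sU s (\<lambda>a1 a2. F a2 a1)" by (intro bilinear_overI linmap_intros)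
  show ?case
    using scale by (simp add: U.comult_sum_scale[OF bil] U.comult_sum_scale[OF scale(2)])
next
  case (mult x a)
  note [linmap_intros] = bilinear[OF mult(2)]
  have bil: "bilinear_over sU sU s (\<lambda>a1 a2. F a2 a1)" "bilinear_over sU sU s (\<lambda>a1 a2. F (inc x * a1) a2)"
     "bilinear_over sU sU s (\<lambda>a1 a2. F a1 (inc x * a2))" by (intro bilinear_overI linmap_intros)+
  show ?case
    by (simp add: comult_sum_inc_mult[OF mult(2)] comult_sum_inc_mult[OF bil(1)]
        mult(1)[OF bil(2)] mult(1)[OF bil(3)] add.commute)
qed

end

section \<open>The action induced by a Hopf pairing\<close>

context hopf_pairing
begin

lemmas linmap_pair [linmap_intros] = bilinear[OF pair_bilinear]

abbreviation pact :: "'a \<Rightarrow> 'h \<Rightarrow> 'a" (infixl \<open>\<triangleleft>\<close> 72) where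
  "u \<triangleleft> h \<equiv> pairing_action sA \<Delta>A pair u h"

lemma linmap_pairing_action:
  "linmap s sA f \<Longrightarrow> linmap s sA (\<lambda>x. f x \<triangleleft> h)" "linmap s sH g \<Longrightarrow> linmap s sA (\<lambda>x. u \<triangleleft> g x)"
  unfolding pairing_action_def by (intro bilinear_overI linmap_intros; assumption)+

lemma pairing_action_mult_right: "(u \<triangleleft> h) \<triangleleft> h' = u \<triangleleft> (h * h')"
proof -
  have tri: "trilinear_over sA sA sA sA (\<lambda>a b c. sA (pair a h) (sA (pair b h') c))"
    by (intro trilinear_overI linmap_intros)
  have lin: "linmap sA sA (\<lambda>u. u \<triangleleft> h')" "linmap (*) sA (\<lambda>k. sA k v)" for v
    by (intro linmap_pairing_action linmap_intros)+
  have "(u \<triangleleft> h) \<triangleleft> h' = A.comult_sum (\<lambda>a b. A.comult_sum (\<lambda>b c. sA (pair a h) (sA (pair b h') c)) b) u"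
    by (simp add: pairing_action_def[of _ _ _ u] sweedler_linmap[OF lin(1)] linmap_scale[OF lin(1)])
      (simp add: pairing_action_def sweedler_linmap[OF linmap_scale_fun[OF linmap_id[OF A.vector_space_scale]]])
  also have "\<dots> = A.comult_sum (\<lambda>a b. sA (A.comult_sum (\<lambda>a1 a2. pair a1 h * pair a2 h') a) b) u"
    unfolding A.comult_sum_coassoc[OF tri, symmetric] by (simp add: sweedler_linmap[OF lin(2)])
  finally show ?thesis by (simp add: pair_mult_right pairing_action_def)
qed

lemma pairing_action_mult_left: "(a * b) \<triangleleft> h = H.comult_sum (\<lambda>h1 h2. (a \<triangleleft> h1) * (b \<triangleleft> h2)) h"
proof -
  have bil: "bilinear_over sA sA sA (\<lambda>u1 u2. sA (pair u1 h) u2)"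
    by (intro bilinear_overI linmap_intros)
  have lin: "linmap (*) sA (\<lambda>k. sA k v)" "linmap sA sA (\<lambda>u. u * v)" "linmap sA sA (\<lambda>u. v * u)"
    "linmap sA sA (sA r)" for v r
    by (intro linmap_intros)+
  have swap: "H.comult_sum (\<lambda>c d. A.comult_sum (\<lambda>a b. F a b c d) u) h
      = A.comult_sum (\<lambda>a b. H.comult_sum (\<lambda>c d. F a b c d) h) u" for F :: "'a \<Rightarrow> 'a \<Rightarrow> 'h \<Rightarrow> 'h \<Rightarrow> 'a" and u
    by (rule sweedler_swap)
  have "(a * b) \<triangleleft> h
    = A.comult_sum (\<lambda>a1 a2. A.comult_sum (\<lambda>b1 b2. sA (pair (a1 * b1) h) (a2 * b2)) b) a"
    unfolding pairing_action_def by (rule A.comult_sum_mult[OF bil])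
  also have "\<dots> = A.comult_sum (\<lambda>a1 a2. A.comult_sum (\<lambda>b1 b2.
      H.comult_sum (\<lambda>h1 h2. sA (pair a1 h1) a2 * sA (pair b1 h2) b2) h) b) a"
    by (simp add: sweedler_linmap[OF lin(1)] A.mult_scale_left A.mult_scale_right mult.commute flip: pair_mult_left)
  also have "\<dots> = H.comult_sum (\<lambda>h1 h2. (a \<triangleleft> h1) * (b \<triangleleft> h2)) h"
    unfolding pairing_action_def
    by (simp add: sweedler_linmap[OF lin(2)] sweedler_linmap[OF lin(3)] swap
        sweedler_swap[where t = "\<Delta>A b" and t' = "\<Delta>A a"])
  finally show ?thesis .
qed

lemma bilinear_pairing_action: "bilinear_over sA sH sA (pairing_action sA \<Delta>A pair)"
  by (intro bilinear_overI linmap_pairing_action linmap_intros)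

lemma pairing_action_one_right: "u \<triangleleft> 1 = u"
  by (simp add: pairing_action_def pair_one_right A.counit_left)

lemma pairing_action_one_left: "1 \<triangleleft> h = sA (\<epsilon>H h) 1"
proof -
  have "bilinear_over sA sA sA (\<lambda>u1 u2. sA (pair u1 h) u2)"
    by (intro bilinear_overI linmap_intros)
  then show ?thesis
    by (simp add: pairing_action_def A.comult_sum_one pair_one_left)
qed

lemma right_hopf_action_pairing: "right_hopf_action sH \<Delta>H \<epsilon>H sA (*) 1 (pairing_action sA \<Delta>A pair)"
  by (intro right_hopf_action.intro H.bialgebra_axioms A.assoc_algebra_axioms
      right_hopf_action_axioms.intro bilinear_pairing_action pairing_action_one_right
      pairing_action_mult_right pairing_action_mult_left pairing_action_one_left)

lemma assoc_algebra_opposite: "assoc_algebra sA (\<lambda>a b. b * a) 1"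
  by (intro assoc_algebra.intro A.vector_space_axioms assoc_algebra_axioms.intro)
    (auto intro!: bilinear_overI linmap_intros simp: mult.assoc)

lemma right_hopf_action_opposite_pairing:
  "right_hopf_action sH (co_opposite sH \<Delta>H) \<epsilon>H sA (\<lambda>a b. b * a) 1 (pairing_action sA \<Delta>A pair)"
proof (intro right_hopf_action.intro H.bialgebra_co_opposite assoc_algebra_opposite
    right_hopf_action_axioms.intro bilinear_pairing_action pairing_action_one_right
    pairing_action_mult_right pairing_action_one_left)
  fix a b h
  have "bilinear_over sH sH sA (\<lambda>h1 h2. (b \<triangleleft> h2) * (a \<triangleleft> h1))"
    by (intro bilinear_overI linmap_pairing_action linmap_intros)
  then show "(b * a) \<triangleleft> h = sweedler sH sH (\<lambda>h1 h2. (b \<triangleleft> h2) * (a \<triangleleft> h1)) (co_opposite sH \<Delta>H h)"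
    by (simp add: H.sweedler_co_opposite pairing_action_mult_left)
qed

end

section \<open>Constructing coactions from representations on tensors\<close>

text \<open>
  The operators are additive and satisfy the relations only on the subset \<open>V\<close>, because the tensors
  form a subset of a larger type of functionals.
\<close>

locale linear_operators =
  enveloping_hopf_algebra sg bracket sU \<Delta>U \<epsilon>U SU inc + V: vector_space s
  for sg :: "'k::field \<Rightarrow> 'g::ab_group_add \<Rightarrow> 'g" and bracket
    and sU :: "'k \<Rightarrow> 'u::ring_1 \<Rightarrow> 'u" and \<Delta>U \<epsilon>U SU inc and s :: "'k \<Rightarrow> 'v::ab_group_add \<Rightarrow> 'v" +
  fixes V :: "'v set" and T :: "'g \<Rightarrow> 'v \<Rightarrow> 'v"
  assumes V_add: "v \<in> V \<Longrightarrow> v' \<in> V \<Longrightarrow> v + v' \<in> V" and V_scale: "v \<in> V \<Longrightarrow> s c v \<in> V"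
    and T_in: "v \<in> V \<Longrightarrow> T x v \<in> V"
    and T_add: "v \<in> V \<Longrightarrow> v' \<in> V \<Longrightarrow> T x (v + v') = T x v + T x v'"
    and T_scale: "v \<in> V \<Longrightarrow> T x (s c v) = s c (T x v)"
    and T_add_left: "v \<in> V \<Longrightarrow> T (x + y) v = T x v + T y v"
    and T_scale_left: "v \<in> V \<Longrightarrow> T (sg c x) v = s c (T x v)"
begin

lemma fold_in: "v \<in> V \<Longrightarrow> fold T w v \<in> V"
  by (induction w arbitrary: v) (auto simp: T_in)

lemma fold_add: "v \<in> V \<Longrightarrow> v' \<in> V \<Longrightarrow> fold T w (v + v') = fold T w v + fold T w v'"
  by (induction w arbitrary: v v') (auto simp: T_in T_add)

lemma fold_scale: "v \<in> V \<Longrightarrow> fold T w (s c v) = s c (fold T w v)"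
  by (induction w arbitrary: v) (auto simp: T_in T_scale)

lemma extend_representation:
  assumes comm: "\<And>x y v. v \<in> V \<Longrightarrow> T x (T y v) = T y (T x v) + T (bracket x y) v" and v0: "v0 \<in> V"
  obtains \<phi> where "linmap sU s \<phi>" "\<phi> 1 = v0" "\<And>a. \<phi> a \<in> V" "\<And>x a. \<phi> (inc x * a) = T x (\<phi> a)"
proof -
  let ?f = "\<lambda>w. fold T (rev w) v0"
  have f: "?f w \<in> V" for w by (rule fold_in[OF v0])
  have split: "?f (u @ z @ w) = fold T (rev u) (fold T (rev z) (?f w))" for u z w
    by simp
  obtain \<phi> where \<phi>: "linmap sU s \<phi>" "\<And>w. \<phi> (prod_list (map inc w)) = ?f w"
  proof (rule enveloping_universal[OF V.vector_space_axioms, of ?f])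
    fix u x y w c
    note t = f[of w]
    show "?f (u @ [x + y] @ w) = ?f (u @ [x] @ w) + ?f (u @ [y] @ w)"
      unfolding split using t by (simp add: T_add_left fold_add T_in)
    show "?f (u @ [sg c x] @ w) = s c (?f (u @ [x] @ w))"
      unfolding split using t by (simp add: T_scale_left fold_scale T_in)
    show "?f (u @ [x, y] @ w) = ?f (u @ [y, x] @ w) + ?f (u @ [bracket x y] @ w)"
      unfolding split using t comm[OF t, of x y] by (simp add: T_in flip: fold_add)
  qed blast
  have in_V: "\<phi> a \<in> V" for a
    by (induction a rule: enveloping_word_induct)
      (simp_all add: \<phi>(2) f linmap_add[OF \<phi>(1)] linmap_scale[OF \<phi>(1)] V_add V_scale)
  have "\<phi> (inc x * a) = T x (\<phi> a)" for x a
  proof (induction a rule: enveloping_word_induct)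
    case (word w)
    then show ?case using \<phi>(2)[of "x # w"] \<phi>(2)[of w] by simp
  next
    case (add a b)
    then show ?case by (simp add: distrib_left linmap_add[OF \<phi>(1)] T_add in_V)
  next
    case (scale c a)
    then show ?case by (simp add: U.mult_scale_right linmap_scale[OF \<phi>(1)] T_scale in_V)
  qed
  then show ?thesis using that[of \<phi>] \<phi>(1) \<phi>(2)[of "[]"] in_V by simp
qed

text \<open>
  For the opposite algebra the generators of a word act in the order of the word instead of the
  reverse order.
\<close>

lemma extend_antirepresentation:
  assumes comm: "\<And>x y v. v \<in> V \<Longrightarrow> T y (T x v) = T x (T y v) + T (bracket x y) v" and v0: "v0 \<in> V"
  obtains \<phi> where "linmap sU s \<phi>" "\<phi> 1 = v0" "\<And>a. \<phi> a \<in> V" "\<And>x a. \<phi> (a * inc x) = T x (\<phi> a)"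
proof -
  let ?f = "\<lambda>w. fold T w v0"
  have f: "?f w \<in> V" for w by (rule fold_in[OF v0])
  have split: "?f (u @ z @ w) = fold T w (fold T z (?f u))" for u z w
    by simp
  obtain \<phi> where \<phi>: "linmap sU s \<phi>" "\<And>w. \<phi> (prod_list (map inc w)) = ?f w"
  proof (rule enveloping_universal[OF V.vector_space_axioms, of ?f])
    fix u x y w c
    note t = f[of u]
    show "?f (u @ [x + y] @ w) = ?f (u @ [x] @ w) + ?f (u @ [y] @ w)"
      unfolding split using t by (simp add: T_add_left fold_add T_in)
    show "?f (u @ [sg c x] @ w) = s c (?f (u @ [x] @ w))"
      unfolding split using t by (simp add: T_scale_left fold_scale T_in)
    show "?f (u @ [x, y] @ w) = ?f (u @ [y, x] @ w) + ?f (u @ [bracket x y] @ w)"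
      unfolding split using t comm[OF t, of y x] by (simp add: T_in flip: fold_add)
  qed blast
  have in_V: "\<phi> a \<in> V" for a
    by (induction a rule: enveloping_word_induct)
      (simp_all add: \<phi>(2) f linmap_add[OF \<phi>(1)] linmap_scale[OF \<phi>(1)] V_add V_scale)
  have "\<phi> (a * inc x) = T x (\<phi> a)" for x a
  proof (induction a rule: enveloping_word_induct)
    case (word w)
    then show ?case using \<phi>(2)[of "w @ [x]"] \<phi>(2)[of w] by simp
  next
    case (add a b)
    then show ?case by (simp add: distrib_right linmap_add[OF \<phi>(1)] T_add in_V)
  next
    case (scale c a)
    then show ?case by (simp add: U.mult_scale_left linmap_scale[OF \<phi>(1)] T_scale in_V)
  qed
  then show ?thesis using that[of \<phi>] \<phi>(1) \<phi>(2)[of "[]"] in_V by simp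
qed

end

text \<open>
  Left multiplication by the sum of the \<open>m\<^sub>i \<otimes> x\<^sub>i\<close> in the tensor product of the two algebras.
\<close>

definition coefficient_operator ::
  "('k::field \<Rightarrow> 'h::ring_1 \<Rightarrow> 'h) \<Rightarrow> ('k \<Rightarrow> 'a::ab_group_add \<Rightarrow> 'a) \<Rightarrow> ('a \<Rightarrow> 'a \<Rightarrow> 'a) \<Rightarrow>
   'i set \<Rightarrow> ('i \<Rightarrow> 'a) \<Rightarrow> ('i \<Rightarrow> 'h) \<Rightarrow> ('h, 'a, 'k) tensor \<Rightarrow> ('h, 'a, 'k) tensor" where
  "coefficient_operator sH sA mul I x m t
    = (\<Sum>i\<in>I. sweedler sH sA (\<lambda>h b. tens sH sA (m i * h) (mul (x i) b)) t)"

locale two_algebras =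
  H: assoc_algebra sH "(*)" 1 + A: assoc_algebra sA mul e
  for sH :: "'k::field \<Rightarrow> 'h::ring_1 \<Rightarrow> 'h" and sA :: "'k \<Rightarrow> 'a::ab_group_add \<Rightarrow> 'a"
    and mul (infixl \<open>\<star>\<close> 70) and e
begin

lemma bilinear_coefficient_summand:
  "bilinear_over sH sA tscale (\<lambda>h b. tens sH sA (k * h) (x \<star> b))"
  by (intro bilinear_overI linmap_intros)

lemma coefficient_operator_in: "coefficient_operator sH sA (\<star>) I x m t \<in> tensor_space sH sA"
  unfolding coefficient_operator_def by (intro tensor_space_closed)

lemma coefficient_operator_add:
  "t \<in> tensor_space sH sA \<Longrightarrow> t' \<in> tensor_space sH sA \<Longrightarrow> coefficient_operator sH sA (\<star>) I x m (t + t')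
    = coefficient_operator sH sA (\<star>) I x m t + coefficient_operator sH sA (\<star>) I x m t'"
  by (simp only: coefficient_operator_def sweedler_add[OF bilinear_coefficient_summand] sum.distrib)

lemma coefficient_operator_scale:
  "t \<in> tensor_space sH sA \<Longrightarrow> coefficient_operator sH sA (\<star>) I x m (tscale c t)
    = tscale c (coefficient_operator sH sA (\<star>) I x m t)"
  by (simp only: coefficient_operator_def sweedler_scale[OF bilinear_coefficient_summand]
      linmap_sum[OF linmap_scale_fun[OF linmap_id[OF vector_space_tscale]]])

lemma linmap_coefficient_operator:
  assumes "\<And>i. i \<in> I \<Longrightarrow> linmap s sH (\<lambda>y. m y i)" "vector_space s"
  shows "linmap s tscale (\<lambda>y. coefficient_operator sH sA (\<star>) I x (m y) t)"
  unfolding coefficient_operator_def by (intro linmap_intros assms)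

lemma coefficient_operator_compose:
  "coefficient_operator sH sA (\<star>) I x m (coefficient_operator sH sA (\<star>) I x m' t)
    = (\<Sum>i\<in>I. \<Sum>l\<in>I. sweedler sH sA (\<lambda>h b. tens sH sA (m i * (m' l * h)) (x i \<star> (x l \<star> b))) t)"
  unfolding coefficient_operator_def
  by (simp add: sweedler_sum[OF bilinear_coefficient_summand]
      sweedler_sweedler[OF bilinear_coefficient_summand] tensor_space_closed
      sweedler_tens[OF bilinear_coefficient_summand])

text \<open>
  The commutator of two coefficient operators: the coefficients commute with each other, so only the
  commutators of the \<open>x\<^sub>i\<close> remain, and these are absorbed in new coefficients.
\<close>

lemma coefficient_operator_commutator:
  assumes H_commute: "\<And>h k. h * k = (k * h :: 'h)"
    and comm: "\<And>i l. i \<in> I \<Longrightarrow> l \<in> I \<Longrightarrow> x i \<star> x l = x l \<star> x i + (\<Sum>r\<in>I. sA (K i l r) (x r))"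
    and d: "\<And>r. r \<in> I \<Longrightarrow> (\<Sum>i\<in>I. \<Sum>l\<in>I. sH (K i l r) (m i * m' l)) = d r"
  shows "coefficient_operator sH sA (\<star>) I x m (coefficient_operator sH sA (\<star>) I x m' t)
    = coefficient_operator sH sA (\<star>) I x m' (coefficient_operator sH sA (\<star>) I x m t)
      + coefficient_operator sH sA (\<star>) I x d t"
proof -
  have lin: "linmap sA tscale (\<lambda>b. tens sH sA h b)" "linmap sA tscale (\<lambda>a. tens sH sA h (a \<star> b))"
    "linmap sH tscale (\<lambda>k. tens sH sA (k * h) b)" for h b
    by (intro linmap_intros)+
  have "coefficient_operator sH sA (\<star>) I x m (coefficient_operator sH sA (\<star>) I x m' t)
    = (\<Sum>i\<in>I. \<Sum>l\<in>I. sweedler sH sA (\<lambda>h b. tens sH sA (m i * m' l * h) (x i \<star> x l \<star> b)) t)"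
    by (simp add: coefficient_operator_compose mult.assoc A.mult_assoc)
  also have "\<dots> = (\<Sum>i\<in>I. \<Sum>l\<in>I. sweedler sH sA (\<lambda>h b. tens sH sA (m i * m' l * h) (x l \<star> x i \<star> b)) t)
      + (\<Sum>i\<in>I. \<Sum>l\<in>I. \<Sum>r\<in>I. sweedler sH sA (\<lambda>h b. tens sH sA (sH (K i l r) (m i * m' l) * h) (x r \<star> b)) t)"
    unfolding sum.distrib[symmetric]
  proof (intro sum.cong refl)
    fix i l assume "i \<in> I" "l \<in> I"
    then show "sweedler sH sA (\<lambda>h b. tens sH sA (m i * m' l * h) (x i \<star> x l \<star> b)) t
      = sweedler sH sA (\<lambda>h b. tens sH sA (m i * m' l * h) (x l \<star> x i \<star> b)) t
        + (\<Sum>r\<in>I. sweedler sH sA (\<lambda>h b. tens sH sA (sH (K i l r) (m i * m' l) * h) (x r \<star> b)) t)"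
      by (subst comm) (simp_all add: linmap_add[OF lin(2)] linmap_sum[OF lin(2)] linmap_scale[OF lin(2)]
        linmap_scale[OF lin(3)] sweedler_plus_fun sweedler_sum_fun)
  qed
  also have "(\<Sum>i\<in>I. \<Sum>l\<in>I. sweedler sH sA (\<lambda>h b. tens sH sA (m i * m' l * h) (x l \<star> x i \<star> b)) t)
      = coefficient_operator sH sA (\<star>) I x m' (coefficient_operator sH sA (\<star>) I x m t)"
  proof -
    have "m i * m' l * h = m' l * (m i * h)" for i l h
      by (metis H_commute mult.assoc)
    then show ?thesis
      by (subst sum.swap) (simp add: coefficient_operator_compose A.mult_assoc)
  qed
  also have "(\<Sum>i\<in>I. \<Sum>l\<in>I. \<Sum>r\<in>I. sweedler sH sA (\<lambda>h b. tens sH sA (sH (K i l r) (m i * m' l) * h) (x r \<star> b)) t)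
      = (\<Sum>r\<in>I. \<Sum>i\<in>I. \<Sum>l\<in>I. sweedler sH sA (\<lambda>h b. tens sH sA (sH (K i l r) (m i * m' l) * h) (x r \<star> b)) t)"
    unfolding sum.swap[of _ I I, where g = "\<lambda>l r. sweedler sH sA (\<lambda>h b. tens sH sA (sH (K i l r) (m i * m' l) * h) (x r \<star> b)) t" for i]
    by (rule sum.swap)
  also have "\<dots> = coefficient_operator sH sA (\<star>) I x d t"
    by (simp add: coefficient_operator_def flip: d sweedler_sum_fun linmap_sum[OF lin(3)])
  finally show ?thesis .
qed

end

section \<open>The matrix of the adjoint representation in a Hopf pairing\<close>

text \<open>
  Matrices with the formal properties of the adjoint matrix and of its inverse, for a basis indexed by
  an arbitrary finite set and with the coordinates of a vector given explicitly.
\<close>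

locale structure_matrices =
  enveloping_hopf_algebra sg bracket sU \<Delta>U \<epsilon>U SU inc +
  hopf_pairing sU \<Delta>U \<epsilon>U SU sH \<Delta>H \<epsilon>H SH pair
  for sg :: "'k::field \<Rightarrow> 'g::ab_group_add \<Rightarrow> 'g" and bracket
    and sU :: "'k \<Rightarrow> 'u::ring_1 \<Rightarrow> 'u" and \<Delta>U \<epsilon>U SU inc
    and sH :: "'k \<Rightarrow> 'h::ring_1 \<Rightarrow> 'h" and \<Delta>H \<epsilon>H SH and pair +
  fixes I :: "'i set" and X :: "'i \<Rightarrow> 'g" and coord :: "'g \<Rightarrow> 'i \<Rightarrow> 'k"
    and C :: "'i \<Rightarrow> 'i \<Rightarrow> 'i \<Rightarrow> 'k" and \<O> \<O>' :: "'i \<Rightarrow> 'i \<Rightarrow> 'h"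
  assumes finite_I: "finite I"
    and coord_linear: "i \<in> I \<Longrightarrow> linmap sg (*) (\<lambda>x. coord x i)"
    and coord_sum: "(\<Sum>i\<in>I. sg (coord x i) (X i)) = x"
    and coord_basis: "i \<in> I \<Longrightarrow> j \<in> I \<Longrightarrow> coord (X j) i = (if i = j then 1 else 0)"
    and structure_constants: "i \<in> I \<Longrightarrow> j \<in> I \<Longrightarrow> bracket (X i) (X j) = (\<Sum>k\<in>I. sg (C i j k) (X k))"
    and pair_O: "i \<in> I \<Longrightarrow> j \<in> I \<Longrightarrow> k \<in> I \<Longrightarrow> pair (inc (X k)) (\<O> i j) = C k j i"
    and C_O: "i \<in> I \<Longrightarrow> j \<in> I \<Longrightarrow> k \<in> I \<Longrightarrow>
      (\<Sum>l\<in>I. \<Sum>m\<in>I. sH (C l m k) (\<O> l i * \<O> m j)) = (\<Sum>r\<in>I. sH (C i j r) (\<O> k r))"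
    and O_O': "i \<in> I \<Longrightarrow> k \<in> I \<Longrightarrow> (\<Sum>j\<in>I. \<O> i j * \<O>' j k) = (if i = k then 1 else 0)"
    and O'_O: "i \<in> I \<Longrightarrow> k \<in> I \<Longrightarrow> (\<Sum>j\<in>I. \<O>' i j * \<O> j k) = (if i = k then 1 else 0)"
    and comult_O: "i \<in> I \<Longrightarrow> j \<in> I \<Longrightarrow> \<Delta>H (\<O> i j) = (\<Sum>k\<in>I. tens sH sH (\<O> i k) (\<O> k j))"
    and comult_O': "i \<in> I \<Longrightarrow> j \<in> I \<Longrightarrow> \<Delta>H (\<O>' i j) = (\<Sum>k\<in>I. tens sH sH (\<O>' k j) (\<O>' i k))"
    and counit_O: "i \<in> I \<Longrightarrow> j \<in> I \<Longrightarrow> \<epsilon>H (\<O> i j) = (if i = j then 1 else 0)"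
    and counit_O': "i \<in> I \<Longrightarrow> j \<in> I \<Longrightarrow> \<epsilon>H (\<O>' i j) = (if i = j then 1 else 0)"
    and antipode_O: "i \<in> I \<Longrightarrow> j \<in> I \<Longrightarrow> SH (\<O> i j) = \<O>' i j"
begin

lemma vector_space_sg [linmap_intros]: "vector_space sg"
  by (rule L.vector_space_axioms)

lemma linmap_coord [linmap_intros]: "i \<in> I \<Longrightarrow> linmap s sg f \<Longrightarrow> linmap s (*) (\<lambda>x. coord (f x) i)"
  by (rule linmap_compose[OF coord_linear])

lemmas linmap_bracket [linmap_intros] = bilinear[OF L.bracket_bilinear]

lemma linmap_eq_on_basis:
  assumes F: "linmap sg s F" and G: "linmap sg s G" and eq: "\<And>j. j \<in> I \<Longrightarrow> F (X j) = G (X j)"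
  shows "F x = G x"
proof -
  have "F (\<Sum>i\<in>I. sg (coord x i) (X i)) = G (\<Sum>i\<in>I. sg (coord x i) (X i))"
    by (simp add: linmap_sum[OF F] linmap_sum[OF G] linmap_scale[OF F] linmap_scale[OF G] eq)
  then show ?thesis by (simp only: coord_sum)
qed

lemma bilinear_eq_on_basis:
  assumes F: "bilinear_over sg sg s F" and G: "bilinear_over sg sg s G"
    and eq: "\<And>j k. j \<in> I \<Longrightarrow> k \<in> I \<Longrightarrow> F (X j) (X k) = G (X j) (X k)"
  shows "F x y = G x y"
proof -
  have "F (X j) y = G (X j) y" if "j \<in> I" for j
    by (rule linmap_eq_on_basis[of s]) (use F G eq that in \<open>auto simp: bilinear_over_def\<close>)
  then show ?thesis
    by (rule linmap_eq_on_basis[of s "\<lambda>x. F x y" "\<lambda>x. G x y", rotated 2])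
      (use F G in \<open>auto simp: bilinear_over_def\<close>)
qed

lemma inc_commutator:
  "i \<in> I \<Longrightarrow> j \<in> I \<Longrightarrow> inc (X i) * inc (X j) = inc (X j) * inc (X i) + (\<Sum>k\<in>I. sU (C i j k) (inc (X k)))"
proof -
  assume "i \<in> I" "j \<in> I"
  moreover have "linmap sg sU inc" by (intro linmap_intros)
  ultimately have "inc (bracket (X i) (X j)) = (\<Sum>k\<in>I. sU (C i j k) (inc (X k)))"
    by (simp add: structure_constants linmap_sum linmap_scale[of sg sU inc])
  then show ?thesis by (simp add: inc_bracket algebra_simps)
qed

lemma generated_left:
  assumes "P 1" "\<And>a b. P a \<Longrightarrow> P b \<Longrightarrow> P (a + b)" "\<And>c a. P a \<Longrightarrow> P (sU c a)"
    "\<And>j a. j \<in> I \<Longrightarrow> P a \<Longrightarrow> P (inc (X j) * a)"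
  shows "P a"
proof (induction a rule: enveloping_induct_left)
  case (mult x a)
  have lin: "linmap sg sU (\<lambda>x. inc x * a)" by (intro linmap_intros)
  have "P 0" using assms(3)[OF assms(1), of 0] by simp
  then have "P (\<Sum>j\<in>J. sU (coord x j) (inc (X j) * a))" if "J \<subseteq> I" for J
    using that by (induction J rule: infinite_finite_induct) (auto intro: assms mult)
  then show ?case
    using linmap_sum[OF lin, of "\<lambda>j. sg (coord x j) (X j)" I] by (simp add: coord_sum linmap_scale[OF lin])
qed (fact assms)+

lemma generated_right:
  assumes "P 1" "\<And>a b. P a \<Longrightarrow> P b \<Longrightarrow> P (a + b)" "\<And>c a. P a \<Longrightarrow> P (sU c a)"
    "\<And>j a. j \<in> I \<Longrightarrow> P a \<Longrightarrow> P (a * inc (X j))"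
  shows "P a"
proof (induction a rule: enveloping_induct_right)
  case (mult x a)
  have lin: "linmap sg sU (\<lambda>x. a * inc x)" by (intro linmap_intros)
  have "P 0" using assms(3)[OF assms(1), of 0] by simp
  then have "P (\<Sum>j\<in>J. sU (coord x j) (a * inc (X j)))" if "J \<subseteq> I" for J
    using that by (induction J rule: infinite_finite_induct) (auto intro: assms mult)
  then show ?case
    using linmap_sum[OF lin, of "\<lambda>j. sg (coord x j) (X j)" I] by (simp add: coord_sum linmap_scale[OF lin])
qed (fact assms)+

lemma pairing_action_inc: "pairing_action sU \<Delta>U pair (inc x) h = sU (pair (inc x) h) 1 + sU (\<epsilon>H h) (inc x)"
proof -
  have bil: "bilinear_over sU sU sU (\<lambda>u1 u2. sU (pair u1 h) u2)"
    by (intro bilinear_overI linmap_intros)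
  show ?thesis
    by (simp add: pairing_action_def comult_inc sweedler_add[OF bil] sweedler_tens[OF bil]
        tensor_space_closed pair_one_left)
qed

lemma pair_O': "i \<in> I \<Longrightarrow> j \<in> I \<Longrightarrow> k \<in> I \<Longrightarrow> pair (inc (X k)) (\<O>' i j) = - C k j i"
proof -
  assume ijk: "i \<in> I" "j \<in> I" "k \<in> I"
  have "linmap sU (*) (\<lambda>u. pair u h)" for h by (intro linmap_intros)
  with ijk show ?thesis
    using pair_antipode[of "inc (X k)" "\<O> i j"]
    by (simp add: antipode_O antipode_inc linmap_minus[of sU "(*)" "\<lambda>u. pair u h" for h] pair_O)
qed

lemma sum_pair_inc_O:
  assumes l: "l \<in> I"
  shows "(\<Sum>i\<in>I. sU (pair (inc x) (\<O> i l)) (inc (X i))) = inc x * inc (X l) - inc (X l) * inc x"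
proof -
  have "(\<Sum>i\<in>I. sU (pair (inc x) (\<O> i l)) (inc (X i))) = inc (bracket x (X l))"
  proof (rule linmap_eq_on_basis[where s = sU
      and F = "\<lambda>x. \<Sum>i\<in>I. sU (pair (inc x) (\<O> i l)) (inc (X i))" and G = "\<lambda>x. inc (bracket x (X l))"])
    have "linmap sg sU inc" by (intro linmap_intros)
    then show "(\<Sum>i\<in>I. sU (pair (inc (X j)) (\<O> i l)) (inc (X i))) = inc (bracket (X j) (X l))" if "j \<in> I" for j
      using l that by (simp add: pair_O structure_constants linmap_sum linmap_scale[of sg sU inc] cong: sum.cong)
  qed (intro linmap_intros)+
  then show ?thesis by (simp add: inc_bracket)
qed

text \<open>
  Pairing with \<open>\<O>\<close> is a matrix representation of the enveloping algebra which by \<open>sum_pair_inc_O\<close> is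
  the adjoint one on the Lie algebra, so this is \<open>u X = \<Sum> ad(u\<^sub>1)(X) u\<^sub>2\<close>.
\<close>

lemma adjoint_action_matrix:
  assumes j: "j \<in> I"
  shows "(\<Sum>i\<in>I. U.comult_sum (\<lambda>u1 u2. sU (pair u1 (\<O> i j)) (inc (X i) * u2)) u) = u * inc (X j)"
proof (induction u rule: enveloping_induct_left)
  have bil: "bilinear_over sU sU sU (\<lambda>u1 u2. sU (pair u1 (\<O> i j)) (inc (X i) * u2))" for i
    by (intro bilinear_overI linmap_intros)
  {
    case one
    have "(\<Sum>i\<in>I. sU (\<epsilon>H (\<O> i j)) (inc (X i))) = (\<Sum>i\<in>I. if i = j then inc (X i) else 0)"
      by (rule sum.cong) (use j in \<open>auto simp: counit_O\<close>)
    then show ?case using j finite_I by (simp add: U.comult_sum_one[OF bil] pair_one_left)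
  next
    case (add a b)
    then show ?case by (simp add: U.comult_sum_add[OF bil] sum.distrib distrib_right)
  next
    case (scale c a)
    then show ?case
      by (simp add: U.comult_sum_scale[OF bil] U.mult_scale_left flip: U.scale_sum_right)
  next
    case (mult x u)
    have bilH: "bilinear_over sH sH (*) (\<lambda>h1 h2. pair (inc x) h1 * pair u1 h2)" for u1
      by (intro bilinear_overI linmap_intros)
    have lin: "linmap sU sU (\<lambda>u. inc x * u)" by (intro linmap_intros)
    have "(\<Sum>i\<in>I. sU (pair (inc x * u1) (\<O> i j)) (inc (X i) * u2))
        = (\<Sum>l\<in>I. sU (pair u1 (\<O> l j)) ((\<Sum>i\<in>I. sU (pair (inc x) (\<O> i l)) (inc (X i))) * u2))" for u1 u2
    proof -
      have "pair (inc x * u1) (\<O> i j) = (\<Sum>l\<in>I. pair u1 (\<O> l j) * pair (inc x) (\<O> i l))" if "i \<in> I" for i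
        using j that by (simp add: comult_O sweedler_sum_tens[OF bilH] mult.commute[of "pair u1 _"]
            flip: pair_mult_left)
      then have "(\<Sum>i\<in>I. sU (pair (inc x * u1) (\<O> i j)) (inc (X i) * u2))
        = (\<Sum>i\<in>I. \<Sum>l\<in>I. sU (pair u1 (\<O> l j)) (sU (pair (inc x) (\<O> i l)) (inc (X i)) * u2))"
        by (simp add: U.scale_sum_left U.mult_scale_left)
      also have "\<dots> = (\<Sum>l\<in>I. \<Sum>i\<in>I. sU (pair u1 (\<O> l j)) (sU (pair (inc x) (\<O> i l)) (inc (X i)) * u2))"
        by (rule sum.swap)
      finally show ?thesis by (simp add: sum_distrib_right U.scale_sum_right)
    qed
    then have summand: "(\<Sum>i\<in>I. sU (pair (inc x * u1) (\<O> i j)) (inc (X i) * u2)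
          + sU (pair u1 (\<O> i j)) (inc (X i) * (inc x * u2)))
        = inc x * (\<Sum>i\<in>I. sU (pair u1 (\<O> i j)) (inc (X i) * u2))" for u1 u2
      by (simp add: sum.distrib sum_pair_inc_O sum_distrib_left left_diff_distrib U.scale_right_diff_distrib
          sum_subtractf U.mult_scale_right mult.assoc)
    have "(\<Sum>i\<in>I. U.comult_sum (\<lambda>u1 u2. sU (pair u1 (\<O> i j)) (inc (X i) * u2)) (inc x * u))
      = U.comult_sum (\<lambda>u1 u2. inc x * (\<Sum>i\<in>I. sU (pair u1 (\<O> i j)) (inc (X i) * u2))) u"
      unfolding comult_sum_inc_mult[OF bil] summand[symmetric] by (simp add: sweedler_sum_fun sweedler_plus_fun)
    also have "\<dots> = inc x * (u * inc (X j))"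
      by (simp add: sweedler_sum_fun mult flip: sweedler_linmap[OF lin])
    finally show ?case by (simp add: mult.assoc)
  }
qed

text \<open>
  The relation for the inverse matrix is needed because \<open>\<O>'\<close> is the matrix of the coaction on the
  enveloping algebra itself.
\<close>

lemma C_O'_of_commutative:
  assumes H_commute: "\<And>h k. h * k = (k * h :: 'h)" and ijk: "i \<in> I" "j \<in> I" "k \<in> I"
  shows "(\<Sum>l\<in>I. \<Sum>m\<in>I. sH (C l m k) (\<O>' l i * \<O>' m j)) = (\<Sum>r\<in>I. sH (C i j r) (\<O>' k r))"
proof -
  have left_commute: "h * (h' * h'') = h' * (h * h'' :: 'h)" for h h' h''
    by (metis H_commute mult.assoc)
  note ac = mult.assoc H_commute left_commute
  \<comment> \<open>Conjugate the relation for \<open>\<O>\<close> by the inverse matrix on all three indices.\<close>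
  have "(\<Sum>a\<in>I. \<Sum>b\<in>I. \<Sum>s\<in>I. \<O>' a i * (\<O>' b j * (\<O>' k s * (\<Sum>l\<in>I. \<Sum>m\<in>I. sH (C l m s) (\<O> l a * \<O> m b)))))
      = (\<Sum>s\<in>I. \<Sum>l\<in>I. \<Sum>m\<in>I. sH (C l m s) (\<O>' k s * ((\<Sum>a\<in>I. \<O> l a * \<O>' a i) * (\<Sum>b\<in>I. \<O> m b * \<O>' b j))))"
    (is "?L = ?M")
  proof -
    have "?L = (\<Sum>a\<in>I. \<Sum>b\<in>I. \<Sum>s\<in>I. \<Sum>l\<in>I. \<Sum>m\<in>I. sH (C l m s) (\<O>' k s * ((\<O> l a * \<O>' a i) * (\<O> m b * \<O>' b j))))"
      by (simp add: sum_distrib_left H.mult_scale_right ac)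
    also have "\<dots> = (\<Sum>s\<in>I. \<Sum>l\<in>I. \<Sum>m\<in>I. \<Sum>a\<in>I. \<Sum>b\<in>I. sH (C l m s) (\<O>' k s * ((\<O> l a * \<O>' a i) * (\<O> m b * \<O>' b j))))"
    proof -
      have "(\<Sum>a\<in>I. \<Sum>b\<in>I. \<Sum>s\<in>I. \<Sum>l\<in>I. \<Sum>m\<in>I. f a b s l m) = (\<Sum>s\<in>I. \<Sum>l\<in>I. \<Sum>m\<in>I. \<Sum>a\<in>I. \<Sum>b\<in>I. f a b s l m)"
        for f :: "'i \<Rightarrow> 'i \<Rightarrow> 'i \<Rightarrow> 'i \<Rightarrow> 'i \<Rightarrow> 'h"
        by (simp add: sum.cartesian_product)
          (rule sum.reindex_bij_witness[of _ "\<lambda>(s,l,m,a,b). (a,b,s,l,m)" "\<lambda>(a,b,s,l,m). (s,l,m,a,b)"]; auto)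
      then show ?thesis by this
    qed
    also have "\<dots> = ?M"
      by (simp add: sum_distrib_left sum_distrib_right H.scale_sum_right) 
        (intro sum.cong refl sum.swap)
    finally show ?thesis .
  qed
  also have "?M = (\<Sum>s\<in>I. \<Sum>l\<in>I. \<Sum>m\<in>I. if l = i \<and> m = j then sH (C l m s) (\<O>' k s) else 0)"
    by (intro sum.cong refl) (use ijk in \<open>auto simp: O_O'\<close>)
  also have "\<dots> = (\<Sum>s\<in>I. sH (C i j s) (\<O>' k s))"
  proof (rule sum.cong[OF refl])
    fix s
    have "(\<Sum>l\<in>I. \<Sum>m\<in>I. if l = i \<and> m = j then sH (C l m s) (\<O>' k s) else 0)
      = (\<Sum>l\<in>I. if l = i then \<Sum>m\<in>I. if m = j then sH (C l m s) (\<O>' k s) else 0 else 0)"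
      by (rule sum.cong) auto
    then show "(\<Sum>l\<in>I. \<Sum>m\<in>I. if l = i \<and> m = j then sH (C l m s) (\<O>' k s) else 0) = sH (C i j s) (\<O>' k s)"
      using finite_I ijk by simp
  qed
  finally have L: "?L = (\<Sum>s\<in>I. sH (C i j s) (\<O>' k s))" .
  have "?L = (\<Sum>a\<in>I. \<Sum>b\<in>I. \<Sum>r\<in>I. sH (C a b r) ((\<Sum>s\<in>I. \<O>' k s * \<O> s r) * (\<O>' a i * \<O>' b j)))"
  proof (rule sum.cong[OF refl], rule sum.cong[OF refl])
    fix a b assume ab: "a \<in> I" "b \<in> I"
    have "(\<Sum>s\<in>I. \<O>' a i * (\<O>' b j * (\<O>' k s * (\<Sum>l\<in>I. \<Sum>m\<in>I. sH (C l m s) (\<O> l a * \<O> m b)))))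
        = (\<Sum>s\<in>I. \<Sum>r\<in>I. sH (C a b r) ((\<O>' k s * \<O> s r) * (\<O>' a i * \<O>' b j)))"
      using ab by (intro sum.cong refl) (simp add: C_O sum_distrib_left H.mult_scale_right ac)
    also have "\<dots> = (\<Sum>r\<in>I. sH (C a b r) ((\<Sum>s\<in>I. \<O>' k s * \<O> s r) * (\<O>' a i * \<O>' b j)))"
      by (subst sum.swap) (simp add: sum_distrib_right H.scale_sum_right)
    finally show "(\<Sum>s\<in>I. \<O>' a i * (\<O>' b j * (\<O>' k s * (\<Sum>l\<in>I. \<Sum>m\<in>I. sH (C l m s) (\<O> l a * \<O> m b)))))
        = (\<Sum>r\<in>I. sH (C a b r) ((\<Sum>s\<in>I. \<O>' k s * \<O> s r) * (\<O>' a i * \<O>' b j)))" .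
  qed
  also have "\<dots> = (\<Sum>a\<in>I. \<Sum>b\<in>I. \<Sum>r\<in>I. if k = r then sH (C a b r) (\<O>' a i * \<O>' b j) else 0)"
    by (intro sum.cong refl) (use ijk in \<open>auto simp: O'_O\<close>)
  also have "\<dots> = (\<Sum>a\<in>I. \<Sum>b\<in>I. sH (C a b k) (\<O>' a i * \<O>' b j))"
    using finite_I ijk by simp
  finally show ?thesis using L by simp
qed

end

context structure_matrices
begin

subsection \<open>Non-degenerate pairings\<close>

lemma commutative_if_nondegenerate:
  fixes h h' :: 'h
  assumes "nondegenerate_right pair"
  shows "h * h' = h' * h"
proof -
  have bil: "bilinear_over sU sU (*) (\<lambda>u1 u2. pair u1 h * pair u2 h')"
    by (intro bilinear_overI linmap_intros)
  have lin: "linmap sH (*) (pair u)" for u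
    by (intro linmap_intros)
  have "pair u (h * h') = pair u (h' * h)" for u
    using enveloping_cocommutative[OF bil, of u] by (simp add: mult.commute flip: pair_mult_right)
  then have "pair u (h * h' - h' * h) = 0" for u
    by (simp add: linmap_diff[OF lin])
  with assms have "h * h' - h' * h = 0"
    unfolding nondegenerate_right_def by blast
  then show ?thesis by simp
qed

text \<open>
  Pairing both sides with \<open>u\<close> gives \<open>\<langle>\<Sum> \<langle>u\<^sub>1, \<O>\<^sup>i\<^sub>j\<rangle> X\<^sub>i u\<^sub>2, h\<rangle>\<close> and \<open>\<langle>u X\<^sub>j, h\<rangle>\<close>.
\<close>

lemma intertwiner_if_nondegenerate:
  assumes nondegenerate: "nondegenerate_right pair" and j: "j \<in> I"
  shows "(\<Sum>i\<in>I. \<O> i j * H.comult_sum (\<lambda>h1 h2. sH (pair (inc (X i)) h1) h2) h)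
    = H.comult_sum (\<lambda>h1 h2. sH (pair (inc (X j)) h2) h1) h" (is "?L = ?R")
proof -
  have lin: "linmap sH (*) (pair u)" "linmap sU (*) (\<lambda>u. pair u h)" for u h
    by (intro linmap_intros)+
  have "pair u ?L = pair u ?R" for u
  proof -
    have "pair u (\<O> i j * H.comult_sum (\<lambda>h1 h2. sH (pair (inc (X i)) h1) h2) h)
      = pair (U.comult_sum (\<lambda>u1 u2. sU (pair u1 (\<O> i j)) (inc (X i) * u2)) u) h" for i
    proof -
      have "pair u (\<O> i j * H.comult_sum (\<lambda>h1 h2. sH (pair (inc (X i)) h1) h2) h)
        = U.comult_sum (\<lambda>u1 u2. pair u1 (\<O> i j) * pair (inc (X i) * u2) h) u"
        by (simp add: sweedler_linmap[OF lin(1)] linmap_scale[OF lin(1)] flip: pair_mult_right pair_mult_left)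
      then show ?thesis
        by (simp add: sweedler_linmap[OF lin(2)] linmap_scale[OF lin(2)])
    qed
    then have "pair u ?L = pair (u * inc (X j)) h"
      by (simp add: linmap_sum[OF lin(1)] linmap_sum[OF lin(2)] flip: adjoint_action_matrix[OF j])
    also have "\<dots> = pair u ?R"
      by (simp add: sweedler_linmap[OF lin(1)] linmap_scale[OF lin(1)] mult.commute flip: pair_mult_left)
    finally show ?thesis .
  qed
  then have "pair u (?L - ?R) = 0" for u
    by (simp only: linmap_diff[OF lin(1)]) simp
  with nondegenerate have "?L - ?R = 0"
    unfolding nondegenerate_right_def by blast
  then show ?thesis by simp
qed

end

subsection \<open>The two Yetter--Drinfeld module algebras\<close>

text \<open>
  The two properties that the alternative hypotheses of the theorem provide.
\<close>

locale adjoint_matrices =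
  structure_matrices sg bracket sU \<Delta>U \<epsilon>U SU inc sH \<Delta>H \<epsilon>H SH pair I X coord C \<O> \<O>'
  for sg :: "'k::field \<Rightarrow> 'g::ab_group_add \<Rightarrow> 'g" and bracket
    and sU :: "'k \<Rightarrow> 'u::ring_1 \<Rightarrow> 'u" and \<Delta>U \<epsilon>U SU inc
    and sH :: "'k \<Rightarrow> 'h::ring_1 \<Rightarrow> 'h" and \<Delta>H \<epsilon>H SH and pair
    and I :: "'i set" and X coord C \<O> \<O>' +
  assumes H_commute: "h * k = (k * h :: 'h)"
    and intertwiner_O: "j \<in> I \<Longrightarrow>
      (\<Sum>i\<in>I. \<O> i j * H.comult_sum (\<lambda>h1 h2. sH (pair (inc (X i)) h1) h2) h)
      = H.comult_sum (\<lambda>h1 h2. sH (pair (inc (X j)) h2) h1) h"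
begin

text \<open>
  Multiply \<open>intertwiner_O\<close> by the inverse matrix.
\<close>

lemma intertwiner_O':
  assumes j: "j \<in> I"
  shows "(\<Sum>i\<in>I. \<O>' i j * H.comult_sum (\<lambda>h1 h2. sH (pair (inc (X i)) h2) h1) h)
    = H.comult_sum (\<lambda>h1 h2. sH (pair (inc (X j)) h1) h2) h"
proof -
  let ?r = "\<lambda>i. H.comult_sum (\<lambda>h1 h2. sH (pair (inc (X i)) h1) h2) h"
  have "(\<Sum>i\<in>I. \<O>' i j * H.comult_sum (\<lambda>h1 h2. sH (pair (inc (X i)) h2) h1) h)
    = (\<Sum>i\<in>I. \<Sum>k\<in>I. (\<O> k i * \<O>' i j) * ?r k)"
    by (simp add: sum_distrib_left H_commute[of "\<O> _ _" "\<O>' _ _"] mult.assoc flip: intertwiner_O)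
  also have "\<dots> = (\<Sum>k\<in>I. (\<Sum>i\<in>I. \<O> k i * \<O>' i j) * ?r k)"
    by (subst sum.swap) (simp add: sum_distrib_right)
  also have "\<dots> = (\<Sum>k\<in>I. if k = j then ?r k else 0)"
    by (rule sum.cong) (use j in \<open>auto simp: O_O'\<close>)
  also have "\<dots> = ?r j" using finite_I j by simp
  finally show ?thesis .
qed

sublocale plain: matrix_generated sH \<Delta>H \<epsilon>H sU "(*)" 1 "pairing_action sU \<Delta>U pair" I "\<lambda>i. inc (X i)" \<O>'
  "\<lambda>j. pair (inc (X j))"
proof (intro matrix_generated.intro right_hopf_action_pairing matrix_generated_axioms.intro)
  show "(\<Sum>l\<in>I. sU (pair (inc (X k)) (\<O>' l j)) (inc (X l))) = inc (X j) * inc (X k) - inc (X k) * inc (X j)"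
    if "j \<in> I" "k \<in> I" for j k
    using that by (simp add: pair_O' inc_commutator[of k j] sum_negf)
  show "linmap sH (*) (pair (inc (X j)))" for j by (intro linmap_intros)
  show "P a" if "P 1" "\<And>a b. P a \<Longrightarrow> P b \<Longrightarrow> P (a + b)" "\<And>c a. P a \<Longrightarrow> P (sU c a)"
    "\<And>j a. j \<in> I \<Longrightarrow> P a \<Longrightarrow> P (inc (X j) * a)" for P a
    using that by (rule generated_left)
qed (simp_all add: finite_I pairing_action_inc comult_O' counit_O' intertwiner_O', rule H_commute)

sublocale opposite: matrix_generated sH "co_opposite sH \<Delta>H" \<epsilon>H sU "\<lambda>a b. b * a" 1 "pairing_action sU \<Delta>U pair"
  I "\<lambda>i. inc (X i)" \<O> "\<lambda>j. pair (inc (X j))"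
proof (intro matrix_generated.intro right_hopf_action_opposite_pairing matrix_generated_axioms.intro)
  fix i j k h
  have bil: "bilinear_over sH sH tscale (\<lambda>a b. tens sH sH b a)"
    "bilinear_over sH sH sH (\<lambda>h1 h2. sH (pair (inc (X i)) h2) h1)"
    "bilinear_over sH sH sH (\<lambda>h1 h2. sH (pair (inc (X j)) h1) h2)" for i
    by (intro bilinear_overI linmap_intros)+
  show "co_opposite sH \<Delta>H (\<O> i j) = (\<Sum>k\<in>I. tens sH sH (\<O> k j) (\<O> i k))" if "i \<in> I" "j \<in> I"
    using that by (simp add: co_opposite_def comult_O sweedler_sum_tens[OF bil(1)])
  show "(\<Sum>l\<in>I. sU (pair (inc (X k)) (\<O> l j)) (inc (X l))) = inc (X k) * inc (X j) - inc (X j) * inc (X k)"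
    if "j \<in> I" "k \<in> I"
    using that by (simp add: pair_O inc_commutator[of k j])
  show "(\<Sum>i\<in>I. \<O> i j * sweedler sH sH (\<lambda>h1 h2. sH (pair (inc (X i)) h2) h1) (co_opposite sH \<Delta>H h))
    = sweedler sH sH (\<lambda>h1 h2. sH (pair (inc (X j)) h1) h2) (co_opposite sH \<Delta>H h)" if "j \<in> I"
    using that by (simp add: H.sweedler_co_opposite[OF bil(2)] H.sweedler_co_opposite[OF bil(3)] intertwiner_O)
  show "linmap sH (*) (pair (inc (X j)))" by (intro linmap_intros)
  show "P a" if "P 1" "\<And>a b. P a \<Longrightarrow> P b \<Longrightarrow> P (a + b)" "\<And>c a. P a \<Longrightarrow> P (sU c a)"
    "\<And>j a. j \<in> I \<Longrightarrow> P a \<Longrightarrow> P (a * inc (X j))" for P a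
    using that by (rule generated_right)
qed (simp_all add: finite_I pairing_action_inc counit_O, rule H_commute)

lemma C_O': "i \<in> I \<Longrightarrow> j \<in> I \<Longrightarrow> k \<in> I \<Longrightarrow>
    (\<Sum>l\<in>I. \<Sum>m\<in>I. sH (C l m k) (\<O>' l i * \<O>' m j)) = (\<Sum>r\<in>I. sH (C i j r) (\<O>' k r))"
  by (rule C_O'_of_commutative[OF H_commute])

text \<open>
  The linear extension of the columns of \<open>N\<close> from the basis to the Lie algebra: the coaction with matrix
  \<open>N\<close> sends \<open>x\<close> to the sum of \<open>coefficient N x i \<otimes> X\<^sub>i\<close>.
\<close>

definition coefficient :: "('i \<Rightarrow> 'i \<Rightarrow> 'h) \<Rightarrow> 'g \<Rightarrow> 'i \<Rightarrow> 'h" where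
  "coefficient N x i = (\<Sum>j\<in>I. sH (coord x j) (N i j))"

lemma linmap_coefficient [linmap_intros]: "linmap s sg f \<Longrightarrow> linmap s sH (\<lambda>x. coefficient N (f x) i)"
  unfolding coefficient_def by (intro linmap_intros linmap_spaces)

lemma coefficient_basis: "j \<in> I \<Longrightarrow> coefficient N (X j) i = N i j"
proof -
  assume j: "j \<in> I"
  have "coefficient N (X j) i = (\<Sum>k\<in>I. if k = j then N i k else 0)"
    unfolding coefficient_def by (rule sum.cong) (use j in \<open>auto simp: coord_basis\<close>)
  then show ?thesis using j finite_I by simp
qed

text \<open>
  Both sides are bilinear in the Lie algebra elements, so the relation between matrix entries and
  structure constants, which is the case of basis elements, suffices.
\<close>

lemma coefficient_structure:
  assumes N: "\<And>j k r. j \<in> I \<Longrightarrow> k \<in> I \<Longrightarrow> r \<in> I \<Longrightarrow>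
      (\<Sum>i\<in>I. \<Sum>l\<in>I. sH (C i l r) (N i j * N l k)) = (\<Sum>s\<in>I. sH (C j k s) (N r s))"
    and r: "r \<in> I"
  shows "(\<Sum>i\<in>I. \<Sum>l\<in>I. sH (C i l r) (coefficient N x i * coefficient N y l)) = coefficient N (bracket x y) r"
proof (rule bilinear_eq_on_basis[where s = sH
    and F = "\<lambda>x y. \<Sum>i\<in>I. \<Sum>l\<in>I. sH (C i l r) (coefficient N x i * coefficient N y l)"
    and G = "\<lambda>x y. coefficient N (bracket x y) r"])
  have lin: "linmap sg sH (\<lambda>x. coefficient N x r)" by (intro linmap_intros)
  show "(\<Sum>i\<in>I. \<Sum>l\<in>I. sH (C i l r) (coefficient N (X j) i * coefficient N (X k) l))
      = coefficient N (bracket (X j) (X k)) r" if "j \<in> I" "k \<in> I" for j k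
    using that r by (simp add: coefficient_basis N structure_constants linmap_sum[OF lin] linmap_scale[OF lin])
qed (intro bilinear_overI linmap_intros)+

lemma two_algebras_opposite: "two_algebras sH sU (\<lambda>a b. b * a) 1"
  by (intro two_algebras.intro H.assoc_algebra_axioms assoc_algebra_opposite)

lemma two_algebras_enveloping: "two_algebras sH sU (*) 1"
  by (intro two_algebras.intro H.assoc_algebra_axioms U.assoc_algebra_axioms)

lemma linear_operators_coefficient:
  assumes "two_algebras sH sU mul 1"
  shows "linear_operators sg bracket sU \<Delta>U \<epsilon>U SU inc tscale (tensor_space sH sU)
    (\<lambda>x. coefficient_operator sH sU mul I (\<lambda>i. inc (X i)) (coefficient N x))"
proof -
  interpret T: two_algebras sH sU mul 1 by fact
  have lin: "linmap sg tscale (\<lambda>x. coefficient_operator sH sU mul I (\<lambda>i. inc (X i)) (coefficient N x) t)" for t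
    by (intro T.linmap_coefficient_operator linmap_intros)
  show ?thesis
    by (intro linear_operators.intro enveloping_hopf_algebra_axioms vector_space_tscale linear_operators_axioms.intro
        tensor_space_closed T.coefficient_operator_in T.coefficient_operator_add T.coefficient_operator_scale
        linmap_add[OF lin] linmap_scale[OF lin])
qed

lemma coefficient_operator_basis:
  "j \<in> I \<Longrightarrow> coefficient_operator sH sU mul I x (coefficient N (X j)) t
    = (\<Sum>i\<in>I. sweedler sH sU (\<lambda>h b. tens sH sU (N i j * h) (mul (x i) b)) t)"
  by (simp add: coefficient_operator_def coefficient_basis)

lemma coaction_exists:
  "\<exists>coact. generator_coaction sH \<Delta>H \<epsilon>H sU (*) 1 (pairing_action sU \<Delta>U pair) I (\<lambda>i. inc (X i)) \<O>'
    (\<lambda>j. pair (inc (X j))) coact"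
proof -
  interpret T: two_algebras sH sU "(*)" 1 by (rule two_algebras_enveloping)
  interpret R: linear_operators sg bracket sU \<Delta>U \<epsilon>U SU inc tscale "tensor_space sH sU"
    "\<lambda>x. coefficient_operator sH sU (*) I (\<lambda>i. inc (X i)) (coefficient \<O>' x)"
    by (rule linear_operators_coefficient[OF two_algebras_enveloping])
  obtain \<phi> where \<phi>: "linmap sU tscale \<phi>" "\<phi> 1 = tens sH sU 1 1" "\<And>a. \<phi> a \<in> tensor_space sH sU"
    "\<And>x a. \<phi> (inc x * a) = coefficient_operator sH sU (*) I (\<lambda>i. inc (X i)) (coefficient \<O>' x) (\<phi> a)"
    by (rule R.extend_representation[OF T.coefficient_operator_commutator[OF H_commute inc_commutator
            coefficient_structure[OF C_O']] tensor_space_tens]) blast+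
  have "generator_coaction sH \<Delta>H \<epsilon>H sU (*) 1 (pairing_action sU \<Delta>U pair) I (\<lambda>i. inc (X i)) \<O>'
    (\<lambda>j. pair (inc (X j))) \<phi>"
    by (intro generator_coaction.intro plain.matrix_generated_axioms generator_coaction_axioms.intro)
      (simp_all add: \<phi> coefficient_operator_basis)
  then show ?thesis by blast
qed

lemma opposite_coaction_exists:
  "\<exists>coact. generator_coaction sH (co_opposite sH \<Delta>H) \<epsilon>H sU (\<lambda>a b. b * a) 1 (pairing_action sU \<Delta>U pair)
    I (\<lambda>i. inc (X i)) \<O> (\<lambda>j. pair (inc (X j))) coact"
proof -
  interpret T: two_algebras sH sU "\<lambda>a b. b * a" 1 by (rule two_algebras_opposite)
  let ?T = "\<lambda>x. coefficient_operator sH sU (\<lambda>a b. b * a) I (\<lambda>i. inc (X i)) (coefficient \<O> x)"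
  interpret R: linear_operators sg bracket sU \<Delta>U \<epsilon>U SU inc tscale "tensor_space sH sU" ?T
    by (rule linear_operators_coefficient[OF two_algebras_opposite])
  have comm: "?T y (?T x t) = ?T x (?T y t) + ?T (bracket x y) t" for x y t
  \<comment> \<open>The commutators for the reversed product have the structure constants \<open>C\<close> with the first two indices exchanged.\<close>
  proof (rule T.coefficient_operator_commutator[OF H_commute, where K = "\<lambda>i l. C l i"])
    fix r assume r: "r \<in> I"
    show "(\<Sum>i\<in>I. \<Sum>l\<in>I. sH (C l i r) (coefficient \<O> y i * coefficient \<O> x l)) = coefficient \<O> (bracket x y) r"
      by (subst sum.swap) (simp add: H_commute[of "coefficient \<O> y _"] coefficient_structure[OF C_O r])
  qed (rule inc_commutator)
  obtain \<phi> where \<phi>: "linmap sU tscale \<phi>" "\<phi> 1 = tens sH sU 1 1" "\<And>a. \<phi> a \<in> tensor_space sH sU"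
    "\<And>x a. \<phi> (a * inc x) = ?T x (\<phi> a)"
    by (rule R.extend_antirepresentation[OF comm tensor_space_tens]) blast+
  have "generator_coaction sH (co_opposite sH \<Delta>H) \<epsilon>H sU (\<lambda>a b. b * a) 1 (pairing_action sU \<Delta>U pair)
    I (\<lambda>i. inc (X i)) \<O> (\<lambda>j. pair (inc (X j))) \<phi>"
    by (intro generator_coaction.intro opposite.matrix_generated_axioms generator_coaction_axioms.intro)
      (simp_all add: \<phi> coefficient_operator_basis)
  then show ?thesis by blast
qed

end

section \<open>Affine algebraic groups\<close>

text \<open>
  The hypothesis expresses that \<open>M\<close> is a column of the matrix of the adjoint representation, with
  \<open>q\<^sub>i(f)\<close> for the derivative of \<open>f\<close> in the direction \<open>X\<^sub>i\<close> at the unit and conjugation written as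
  \<open>f\<^sub>1 S(f\<^sub>3)\<close>.  Multiplying by \<open>f\<^sub>4\<close> cancels the antipode.
\<close>

lemma (in hopf_algebra) intertwiner_if_conjugation:
  assumes q: "\<And>i. i \<in> I \<Longrightarrow> linmap scale (*) (q i)" and j: "j \<in> I"
    and conjugation: "\<And>f. comult_sum (\<lambda>x g. comult_sum (\<lambda>y z. scale (q j y) (x * S z)) g) f
      = (\<Sum>i\<in>I. scale (q i f) (M i))"
  shows "(\<Sum>i\<in>I. M i * comult_sum (\<lambda>f1 f2. scale (q i f1) f2) f) = comult_sum (\<lambda>f1 f2. scale (q j f2) f1) f"
proof -
  note [linmap_intros] = linmap_compose[OF q[OF j]] linmap_compose[OF antipode_linear]
  have tri: "trilinear_over scale scale scale scale (\<lambda>x g f2. comult_sum (\<lambda>y z. scale (q j y) (x * (S z * f2))) g)"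
    "trilinear_over scale scale scale scale (\<lambda>y z f2. scale (q j y) (x * (S z * f2)))" for x
    by (intro trilinear_overI bilinear_overI linmap_intros)+
  have lin: "linmap scale scale (\<lambda>h. h * k)" "linmap scale scale (\<lambda>h. k * h)" "linmap scale scale (\<lambda>h. scale c h)"
    "linmap scale scale (\<lambda>y. scale (q j y) k)" for k c
    by (intro linmap_intros)+
  have "(\<Sum>i\<in>I. M i * comult_sum (\<lambda>f1 f2. scale (q i f1) f2) f)
    = comult_sum (\<lambda>f1 f2. (\<Sum>i\<in>I. scale (q i f1) (M i)) * f2) f"
    by (simp add: sweedler_linmap[OF lin(2)] sum_distrib_right sweedler_sum_fun mult_scale_left mult_scale_right)
  also have "\<dots> = comult_sum (\<lambda>f1 f2. comult_sum (\<lambda>x g. comult_sum (\<lambda>y z. scale (q j y) (x * (S z * f2))) g) f1) f"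
    by (simp add: sweedler_linmap[OF lin(1)] mult_scale_left mult.assoc flip: conjugation)
  also have "\<dots> = comult_sum (\<lambda>x g. comult_sum (\<lambda>y w. comult_sum (\<lambda>z f2. scale (q j y) (x * (S z * f2))) w) g) f"
    unfolding comult_sum_coassoc[OF tri(1)] comult_sum_coassoc[OF tri(2)] ..
  also have "\<dots> = comult_sum (\<lambda>x g. comult_sum (\<lambda>y w. scale (q j y) (x * comult_sum (\<lambda>z f2. S z * f2) w)) g) f"
    by (simp add: sweedler_linmap[OF lin(2)] sweedler_linmap[OF lin(3)])
  also have "\<dots> = comult_sum (\<lambda>x g. comult_sum (\<lambda>y w. scale (\<epsilon> w) (scale (q j y) x)) g) f"
    by (simp add: antipode_left mult_scale_right mult.commute)
  also have "\<dots> = comult_sum (\<lambda>x g. scale (q j g) x) f"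
    unfolding comult_sum_counit_right[OF lin(4)] ..
  finally show ?thesis .
qed

context hopf_pairing
begin

lemma algebraic_group_case_intertwiner:
  fixes SG :: "'f::comm_ring_1 \<Rightarrow> 'f" and \<O> :: "nat \<Rightarrow> nat \<Rightarrow> 'h" and inc :: "'g \<Rightarrow> 'a"
  assumes "algebraic_group_case sG \<Delta>G \<epsilon>G SG sA inc sH \<Delta>H \<epsilon>H SH pair n X \<O>"
  shows "\<And>h k. h * k = (k * h :: 'h)"
    and "\<And>j h. j \<in> {1..n} \<Longrightarrow>
      (\<Sum>i\<in>{1..n}. \<O> i j * H.comult_sum (\<lambda>h1 h2. sH (pair (inc (X i)) h1) h2) h)
      = H.comult_sum (\<lambda>h1 h2. sH (pair (inc (X j)) h2) h1) h"
proof -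
  interpret G: affine_algebraic_group sG \<Delta>G \<epsilon>G SG
    using assms by (simp add: algebraic_group_case_def)
  obtain \<iota> \<rho> where \<rho>: "bilinear_over sA sG sG \<rho>"
    and \<iota>: "inj \<iota>" "linmap sH sG \<iota>" "\<And>h h'. \<iota> (h * h') = \<iota> h * \<iota> h'"
      "\<And>h. \<Delta>G (\<iota> h) = sweedler sH sH (\<lambda>h1 h2. tens sG sG (\<iota> h1) (\<iota> h2)) (\<Delta>H h)"
    and pair: "\<And>u h. pair u h = \<epsilon>G (\<rho> u (\<iota> h))"
    and adjoint: "regular_adjoint_matrix sG \<Delta>G \<epsilon>G SG n (\<lambda>j. \<rho> (inc (X j))) (\<lambda>i j. \<iota> (\<O> i j))"
    using assms unfolding algebraic_group_case_def acts_by_left_invariant_regular_derivations_def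
      hopf_subalgebra_embedding_def by blast
  show "h * k = k * h" for h k :: 'h
    by (rule injD[OF \<iota>(1)]) (simp add: \<iota>(3) mult.commute)
  fix j h assume j: "j \<in> {1..n}"
  note [linmap_intros] = bilinear[OF \<rho>]
  have q: "linmap sG (*) (\<lambda>f. \<epsilon>G (\<rho> (inc (X i)) f))" for i
    by (intro linmap_intros)
  have bil: "bilinear_over sG sG sG (\<lambda>f1 f2. sG (\<epsilon>G (\<rho> (inc (X i)) f1)) f2)"
    "bilinear_over sG sG sG (\<lambda>f1 f2. sG (\<epsilon>G (\<rho> (inc (X i)) f2)) f1)" for i
    by (intro bilinear_overI linmap_intros)+
  have comult_\<iota>: "G.comult_sum F (\<iota> h) = H.comult_sum (\<lambda>h1 h2. F (\<iota> h1) (\<iota> h2)) h"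
    if F: "bilinear_over sG sG s F" for F :: "'f \<Rightarrow> 'f \<Rightarrow> 'f" and s h
    by (simp add: \<iota>(4) sweedler_sweedler[OF F] tensor_space_closed sweedler_tens[OF F])
  have "(\<Sum>i\<in>{1..n}. \<iota> (\<O> i j) * G.comult_sum (\<lambda>f1 f2. sG (\<epsilon>G (\<rho> (inc (X i)) f1)) f2) (\<iota> h))
    = G.comult_sum (\<lambda>f1 f2. sG (\<epsilon>G (\<rho> (inc (X j)) f2)) f1) (\<iota> h)"
    by (rule G.intertwiner_if_conjugation[OF q j])
      (use adjoint j in \<open>simp add: regular_adjoint_matrix_def\<close>)
  then show "(\<Sum>i\<in>{1..n}. \<O> i j * H.comult_sum (\<lambda>h1 h2. sH (pair (inc (X i)) h1) h2) h)
      = H.comult_sum (\<lambda>h1 h2. sH (pair (inc (X j)) h2) h1) h"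
    by (intro injD[OF \<iota>(1)])
      (simp add: comult_\<iota>[OF bil(1)] comult_\<iota>[OF bil(2)] linmap_sum[OF \<iota>(2)] \<iota>(3)
        sweedler_linmap[OF \<iota>(2)] linmap_scale[OF \<iota>(2)] pair)
qed

end

section \<open>Lie groups: functions and germs\<close>

text \<open>
  Differentiability only involves values near a point of \<open>W'\<close>, and relatively open sets contain small
  variations of single coordinates.
\<close>

lemma C_k_on_cong_openin:
  assumes "C_k_on B m r W f" "openin (top_of_set (coord_space B m)) W'" "W' \<subseteq> W" "\<And>x. x \<in> W' \<Longrightarrow> f x = g x"
  shows "C_k_on B m r W' g"
  using assms(1,4)
proof (induction r arbitrary: f g)
  case 0
  then show ?case
    using continuous_on_eq[OF continuous_on_subset[OF _ assms(3)], of f g] by simp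
next
  case (Suc r)
  obtain T where T: "open T" "W' = coord_space B m \<inter> T"
    using assms(2) by (auto simp: openin_open)
  have "\<exists>g'. (\<forall>x\<in>W'. ((\<lambda>t. g (x(i := t))) has_field_derivative g' x) (at (x i) within B)) \<and> C_k_on B m r W' g'"
    if i: "i < m" for i
  proof -
    obtain f' where f': "\<And>x. x \<in> W \<Longrightarrow> ((\<lambda>t. f (x(i := t))) has_field_derivative f' x) (at (x i) within B)"
      "C_k_on B m r W f'"
      using Suc(2) i unfolding C_k_on.simps by blast
    have "((\<lambda>t. g (x(i := t))) has_field_derivative f' x) (at (x i) within B)" if x: "x \<in> W'" for x
    proof -
      have "continuous_on UNIV (\<lambda>t. (x(i := t)) k)" for k by (cases "k = i") auto
      then have "continuous_on UNIV (\<lambda>t. x(i := t))"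
        by (rule continuous_on_coordinatewise_then_product)
      then have "open ((\<lambda>t. x(i := t)) -` T)"
        using T(1) by (simp add: open_vimage)
      moreover have "x i \<in> (\<lambda>t. x(i := t)) -` T" using x T by simp
      ultimately obtain d where d: "d > 0" "\<And>t. dist (x i) t < d \<Longrightarrow> x(i := t) \<in> T"
        by (auto simp: open_contains_ball subset_iff)
      have in_W': "x(i := t) \<in> W'" if "t \<in> B" "dist t (x i) < d" for t
        using that x T i d(2)[of t] by (auto simp: coord_space_def dist_commute)
      show ?thesis
      proof (rule has_field_derivative_transform_within[OF _ d(1)])
        show "((\<lambda>t. f (x(i := t))) has_field_derivative f' x) (at (x i) within B)"
          using f'(1) x assms(3) by blast
        show "x i \<in> B" using x T i by (auto simp: coord_space_def)
      qed (use in_W' Suc(3) in blast)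
    qed
    moreover have "C_k_on B m r W' f'"
      using Suc.IH[OF f'(2)] by blast
    ultimately show ?thesis by blast
  qed
  moreover have "continuous_on W' g"
    using continuous_on_eq[OF continuous_on_subset[OF _ assms(3)], of f g] Suc(2,3) by simp
  ultimately show ?case by simp
qed

text \<open>
  Shrinking the domain of smoothness to an open set on which the two functions agree.
\<close>

lemma smooth_functions_germ_closed:
  assumes manifold: "smooth_manifold B m \<A>" and N: "N = top \<or> N = nhds e"
    and f: "f \<in> smooth_functions B m \<A> \<phi> N" and eq: "germ_eq N f g"
  shows "g \<in> smooth_functions B m \<A> \<phi> N"
proof -
  obtain W where W: "open W" "\<forall>\<^sub>F x in N. x \<in> W" "smooth_function_on B m \<A> W (\<lambda>x. \<phi> (f x))"
    using f by (auto simp: smooth_functions_def)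
  obtain U where U: "open U" "\<forall>\<^sub>F x in N. x \<in> U" "\<And>x. x \<in> U \<Longrightarrow> f x = g x"
  proof (cases "N = top")
    case True
    then show ?thesis using that[of UNIV] eq by (auto simp: germ_eq_def)
  next
    case False
    then obtain U where "open U" "e \<in> U" "\<And>x. x \<in> U \<Longrightarrow> f x = g x"
      using eq N by (auto simp: germ_eq_def eventually_nhds)
    then show ?thesis using that[of U] False N by (auto simp: eventually_nhds)
  qed
  have "smooth_function_on B m \<A> (W \<inter> U) (\<lambda>x. \<phi> (g x))"
    unfolding smooth_function_on_def C_infinity_on_def
  proof (clarify, rule C_k_on_cong_openin)
    fix V c r assume Vc: "(V, c) \<in> \<A>"
    obtain d where V: "open V" "openin (top_of_set (coord_space B m)) (c ` V)" "homeomorphism V (c ` V) c d"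
      using manifold Vc by (fastforce simp: smooth_manifold_def)
    show "C_k_on B m r (c ` (V \<inter> W)) (\<lambda>x. \<phi> (f (inv_into V c x)))"
      using W(3) Vc by (auto simp: smooth_function_on_def C_infinity_on_def)
    have "openin (top_of_set V) (V \<inter> (W \<inter> U))"
      using W(1) U(1) by (auto simp: openin_open)
    then have "openin (top_of_set (c ` V)) (c ` (V \<inter> (W \<inter> U)))"
      by (rule homeomorphism_imp_open_map[OF V(3)])
    then show "openin (top_of_set (coord_space B m)) (c ` (V \<inter> (W \<inter> U)))"
      using V(2) openin_trans by blast
    show "c ` (V \<inter> (W \<inter> U)) \<subseteq> c ` (V \<inter> W)" by blast
    have "inj_on c V" using V(3) by (metis homeomorphism_def inj_on_inverseI)
    then show "\<phi> (f (inv_into V c x)) = \<phi> (g (inv_into V c x))" if "x \<in> c ` (V \<inter> (W \<inter> U))" for x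
      using that U(3) by auto
  qed
  moreover have "open (W \<inter> U)" "\<forall>\<^sub>F x in N. x \<in> W \<inter> U"
    using W U by (auto simp: eventually_conj_iff)
  ultimately show ?thesis
    unfolding smooth_functions_def by blast
qed

lemma eventually_prod_nested: "eventually P (N \<times>\<^sub>F N') \<Longrightarrow> \<forall>\<^sub>F a in N. \<forall>\<^sub>F b in N'. P (a, b)"
  unfolding eventually_prod_filter by (auto elim!: eventually_mono)

lemma filterlim_top_prod: "filterlim f (top \<times>\<^sub>F top) F" for f :: "'c \<Rightarrow> 'a \<times> 'b"
proof -
  have "top \<times>\<^sub>F top = (top :: ('a \<times> 'b) filter)"
    by (intro filter_eqI) (auto simp: eventually_prod_filter)
  then show ?thesis by (simp add: filterlim_def)
qed

lemma lie_group_filterlim: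
  assumes lie: "lie_group B m \<A> mul e ginv" and N: "N = top \<or> N = nhds e"
  shows "filterlim (\<lambda>(a, y). (a, mul y (ginv a))) (N \<times>\<^sub>F N) (N \<times>\<^sub>F N)"
    and "filterlim (\<lambda>(a, y). (y, ginv a)) (N \<times>\<^sub>F N) (N \<times>\<^sub>F N)"
    and "filterlim (\<lambda>(a, y). (mul (mul a y) (ginv a), a)) (N \<times>\<^sub>F N) (N \<times>\<^sub>F N)"
proof -
  interpret group mul e ginv using lie by (simp add: lie_group_def)
  have mul: "continuous_on UNIV (\<lambda>(x, y). mul x y)" and inv: "continuous_on UNIV ginv"
    using lie by (auto simp: lie_group_def smooth_map_def)
  have mul': "continuous_on UNIV (\<lambda>z. mul (f z) (g z))"
    if "continuous_on UNIV f" "continuous_on UNIV g" for f g :: "'a \<times> 'a \<Rightarrow> 'a"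
    using continuous_on_compose2[OF mul continuous_on_Pair[OF that]] by simp
  have inv': "continuous_on UNIV (\<lambda>z. ginv (f z))" if "continuous_on UNIV f" for f :: "'a \<times> 'a \<Rightarrow> 'a"
    using continuous_on_compose2[OF inv that] by simp
  have *: "filterlim F (N \<times>\<^sub>F N) (N \<times>\<^sub>F N)" if "continuous_on UNIV F" "F (e, e) = (e, e)" for F :: "'a \<times> 'a \<Rightarrow> 'a \<times> 'a"
  proof (cases "N = top")
    case False
    have "(F \<longlongrightarrow> F (e, e)) (nhds (e, e))"
      using that(1) by (simp add: continuous_on_eq_continuous_at isCont_def tendsto_at_iff_tendsto_nhds)
    then show ?thesis using N False that(2) by (simp add: nhds_prod)
  qed (simp add: filterlim_top_prod)
  show "filterlim (\<lambda>(a, y). (a, mul y (ginv a))) (N \<times>\<^sub>F N) (N \<times>\<^sub>F N)"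
    "filterlim (\<lambda>(a, y). (y, ginv a)) (N \<times>\<^sub>F N) (N \<times>\<^sub>F N)"
    "filterlim (\<lambda>(a, y). (mul (mul a y) (ginv a), a)) (N \<times>\<^sub>F N) (N \<times>\<^sub>F N)"
    by (rule *; auto simp: case_prod_unfold intro!: continuous_on_Pair mul' inv' continuous_intros)+
qed

text \<open>
  The properties of a group of functions or germs that the computation uses.  Global functions and
  germs are treated together; \<open>translate\<close> is trivial for the former and the continuity of the group
  operations at the unit for the latter.
\<close>

locale function_pairing =
  hopf_pairing sA \<Delta>A \<epsilon>A SA sH \<Delta>H \<epsilon>H SH pair + G: group mul e ginv
  for sA :: "'k::field \<Rightarrow> 'a::ring_1 \<Rightarrow> 'a" and \<Delta>A \<epsilon>A SA
    and sH :: "'k \<Rightarrow> 'h::ring_1 \<Rightarrow> 'h" and \<Delta>H \<epsilon>H SH and pair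
    and mul :: "'p \<Rightarrow> 'p \<Rightarrow> 'p" and e ginv +
  fixes N :: "'p filter" and F :: "('p \<Rightarrow> 'k) set" and \<iota> :: "'h \<Rightarrow> 'p \<Rightarrow> 'k"
    and \<rho> :: "'a \<Rightarrow> ('p \<Rightarrow> 'k) \<Rightarrow> 'p \<Rightarrow> 'k"
  assumes at_unit: "\<And>P. eventually P N \<Longrightarrow> P e"
    and translate: "filterlim (\<lambda>(a, y). (a, mul y (ginv a))) (N \<times>\<^sub>F N) (N \<times>\<^sub>F N)"
      "filterlim (\<lambda>(a, y). (y, ginv a)) (N \<times>\<^sub>F N) (N \<times>\<^sub>F N)"
      "filterlim (\<lambda>(a, y). (mul (mul a y) (ginv a), a)) (N \<times>\<^sub>F N) (N \<times>\<^sub>F N)"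
    and F_closed: "f \<in> F \<Longrightarrow> germ_eq N f f' \<Longrightarrow> f' \<in> F"
    and transposed: "transposed_subalgebra N mul e ginv F sH \<Delta>H \<epsilon>H SH \<iota>"
    and operators: "linear_operator N F (\<rho> u)"
    and pair_eq: "pair u h = \<rho> u (\<iota> h) e"
begin

lemma \<iota>_in: "\<iota> h \<in> F"
  and \<iota>_kernel: "germ_eq N (\<iota> h) (\<lambda>_. 0) \<Longrightarrow> h = 0"
  and \<iota>_add: "\<forall>\<^sub>F x in N. \<iota> (h + h') x = \<iota> h x + \<iota> h' x"
  and \<iota>_scale: "\<forall>\<^sub>F x in N. \<iota> (sH c h) x = c * \<iota> h x"
  and \<iota>_mult: "\<forall>\<^sub>F x in N. \<iota> (h * h') x = \<iota> h x * \<iota> h' x"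
  and \<iota>_comult: "\<Delta>H h = (\<Sum>(h1, h2)\<leftarrow>xs. tens sH sH h1 h2) \<Longrightarrow>
      \<forall>\<^sub>F (a, b) in N \<times>\<^sub>F N. \<iota> h (mul a b) = (\<Sum>(h1, h2)\<leftarrow>xs. \<iota> h1 a * \<iota> h2 b)"
  using transposed by (simp_all add: transposed_subalgebra_def germ_eq_def)

lemma \<iota>_eqI:
  assumes "\<forall>\<^sub>F x in N. \<iota> h x = \<iota> k x"
  shows "h = k"
proof -
  have "germ_eq N (\<iota> (h + sH (- 1) k)) (\<lambda>_. 0)"
    unfolding germ_eq_def using assms \<iota>_add[of h "sH (- 1) k"] \<iota>_scale[of "- 1" k]
    by eventually_elim simp
  then show ?thesis using \<iota>_kernel[of "h + sH (- 1) k"] by simp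
qed

lemma \<iota>_commute: "h * k = (k * h :: 'h)"
proof (rule \<iota>_eqI)
  show "\<forall>\<^sub>F x in N. \<iota> (h * k) x = \<iota> (k * h) x"
    using \<iota>_mult[of h k] \<iota>_mult[of k h] by eventually_elim simp
qed

lemma \<iota>_zero: "\<forall>\<^sub>F x in N. \<iota> 0 x = 0"
  using \<iota>_scale[of 0 0] by simp

lemma \<iota>_combination: "\<forall>\<^sub>F y in N. \<iota> (\<Sum>x\<leftarrow>xs. sH (c x) (k x)) y = (\<Sum>x\<leftarrow>xs. c x * \<iota> (k x) y)"
proof (induction xs)
  case Nil
  then show ?case using \<iota>_zero by simp
next
  case (Cons x xs)
  from Cons \<iota>_add[of "sH (c x) (k x)" "\<Sum>x\<leftarrow>xs. sH (c x) (k x)"] \<iota>_scale[of "c x" "k x"]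
  show ?case by eventually_elim simp
qed

lemma \<iota>_sum: "\<forall>\<^sub>F y in N. \<iota> (\<Sum>i\<in>I. h i) y = (\<Sum>i\<in>I. \<iota> (h i) y)"
proof (induction I rule: infinite_finite_induct)
  case (insert i I)
  from insert(3) \<iota>_add[of "h i" "\<Sum>i\<in>I. h i"]
  show ?case by eventually_elim (simp add: insert)
qed (use \<iota>_zero in simp_all)

lemma comult_presentation:
  obtains xs where "\<Delta>H h = (\<Sum>(h1, h2)\<leftarrow>xs. tens sH sH h1 h2)"
  by (rule tensor_space_presentation[OF H.vector_space_axioms H.vector_space_axioms H.comult_in])

text \<open>
  Comultiplying twice, \<open>h(a y a\<^sup>-\<^sup>1) = \<Sum> h\<^sub>1(a) h\<^sub>2(y) h\<^sub>3(a\<^sup>-\<^sup>1)\<close>, which for fixed \<open>a\<close> is a combination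
  of the \<open>h\<^sub>2\<close>.  For germs this is available for \<open>a\<close> close to the unit only.
\<close>

lemma \<iota>_conjugate: "\<forall>\<^sub>F a in N. \<exists>k. \<forall>\<^sub>F y in N. \<iota> h (mul (mul a y) (ginv a)) = \<iota> k y"
proof -
  obtain xs where xs: "\<Delta>H h = (\<Sum>(h1, h2)\<leftarrow>xs. tens sH sH h1 h2)"
    by (rule comult_presentation)
  have "\<exists>ys. \<Delta>H k = (\<Sum>(h1, h2)\<leftarrow>ys. tens sH sH h1 h2)" for k
    by (rule comult_presentation[of k]) blast
  then obtain ys where ys: "\<And>k. \<Delta>H k = (\<Sum>(h1, h2)\<leftarrow>ys k. tens sH sH h1 h2)"
    by metis
  have "\<forall>\<^sub>F (a, y) in N \<times>\<^sub>F N. \<iota> h (mul a (mul y (ginv a))) = (\<Sum>(h1, h2)\<leftarrow>xs. \<iota> h1 a * \<iota> h2 (mul y (ginv a)))"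
    using eventually_compose_filterlim[OF \<iota>_comult[OF xs] translate(1)] by (simp add: case_prod_unfold)
  moreover have "\<forall>\<^sub>F (a, y) in N \<times>\<^sub>F N. \<forall>x\<in>set xs. \<iota> (snd x) (mul y (ginv a))
      = (\<Sum>(h1, h2)\<leftarrow>ys (snd x). \<iota> h1 y * \<iota> h2 (ginv a))"
    using eventually_compose_filterlim[OF \<iota>_comult[OF ys] translate(2)]
    by (simp add: case_prod_unfold eventually_ball_finite)
  ultimately have "\<forall>\<^sub>F (a, y) in N \<times>\<^sub>F N. \<iota> h (mul (mul a y) (ginv a))
      = (\<Sum>x\<leftarrow>xs. \<iota> (fst x) a * (\<Sum>z\<leftarrow>ys (snd x). \<iota> (snd z) (ginv a) * \<iota> (fst z) y))"
    by eventually_elim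
      (auto simp: G.assoc case_prod_unfold mult.commute intro!: arg_cong[of _ _ sum_list] map_cong)
  then have "\<forall>\<^sub>F a in N. \<forall>\<^sub>F y in N. \<iota> h (mul (mul a y) (ginv a))
      = (\<Sum>x\<leftarrow>xs. \<iota> (fst x) a * (\<Sum>z\<leftarrow>ys (snd x). \<iota> (snd z) (ginv a) * \<iota> (fst z) y))"
    by (auto dest: eventually_prod_nested)
  then show ?thesis
  proof (rule eventually_mono)
    fix a
    assume a: "\<forall>\<^sub>F y in N. \<iota> h (mul (mul a y) (ginv a))
      = (\<Sum>x\<leftarrow>xs. \<iota> (fst x) a * (\<Sum>z\<leftarrow>ys (snd x). \<iota> (snd z) (ginv a) * \<iota> (fst z) y))"
    let ?k = "\<lambda>x. \<Sum>z\<leftarrow>ys (snd x). sH (\<iota> (snd z) (ginv a)) (fst z)"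
    have "\<forall>\<^sub>F y in N. \<forall>x\<in>set xs. \<iota> (?k x) y = (\<Sum>z\<leftarrow>ys (snd x). \<iota> (snd z) (ginv a) * \<iota> (fst z) y)"
      by (simp add: eventually_ball_finite \<iota>_combination)
    with a \<iota>_combination[of "\<lambda>x. \<iota> (fst x) a" ?k xs]
    have "\<forall>\<^sub>F y in N. \<iota> h (mul (mul a y) (ginv a)) = \<iota> (\<Sum>x\<leftarrow>xs. sH (\<iota> (fst x) a) (?k x)) y"
      by eventually_elim (auto intro!: arg_cong[of _ _ sum_list] map_cong)
    then show "\<exists>k. \<forall>\<^sub>F y in N. \<iota> h (mul (mul a y) (ginv a)) = \<iota> k y" by blast
  qed
qed

text \<open>
  The operators are controlled on \<open>F\<close> only, hence the detour through closure of \<open>F\<close> under equality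
  of germs.
\<close>

lemma operator_at_unit:
  assumes "\<forall>\<^sub>F y in N. f y = \<iota> k y"
  shows "\<rho> u f e = pair u k"
proof -
  have eq: "germ_eq N (\<iota> k) f" using assms by (auto simp: germ_eq_def elim: eventually_mono)
  then have "f \<in> F" by (rule F_closed[OF \<iota>_in])
  then have "germ_eq N (\<rho> u (\<iota> k)) (\<rho> u f)"
    using eq operators \<iota>_in unfolding linear_operator_def by blast
  then show ?thesis
    unfolding germ_eq_def by (auto dest: at_unit simp: pair_eq)
qed

text \<open>
  For \<open>a\<close> near the unit, let \<open>k\<^sub>1\<close> be the element whose germ is \<open>y \<mapsto> h\<^sub>1(a y a\<^sup>-\<^sup>1)\<close>.  By definition of the
  adjoint representation, \<open>\<Sum>\<^sub>i M\<^sup>i\<^sub>j(a) \<langle>x\<^sub>i, h\<^sub>1\<rangle> = \<langle>x\<^sub>j, k\<^sub>1\<rangle>\<close>.  The two expansions of \<open>h(a y)\<close> give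
  \<open>\<Sum> h\<^sub>2(a) k\<^sub>1 = \<Sum> h\<^sub>1(a) h\<^sub>2\<close> in \<open>H\<close>, and pairing this with \<open>x\<^sub>j\<close> is the claim at \<open>a\<close>.
\<close>

lemma intertwiner_if_adjoint_matrix:
  fixes x :: "nat \<Rightarrow> 'a"
  assumes adjoint: "adjoint_matrix N mul ginv F n (\<lambda>j. \<rho> (x j)) M"
    and M: "\<And>i j. i \<in> {1..n} \<Longrightarrow> j \<in> {1..n} \<Longrightarrow> germ_eq N (\<iota> (\<O> i j)) (M i j)"
    and j: "j \<in> {1..n}"
  shows "(\<Sum>i\<in>{1..n}. \<O> i j * H.comult_sum (\<lambda>h1 h2. sH (pair (x i) h1) h2) h)
    = H.comult_sum (\<lambda>h1 h2. sH (pair (x j) h2) h1) h"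
proof -
  obtain xs where xs: "\<Delta>H h = (\<Sum>(h1, h2)\<leftarrow>xs. tens sH sH h1 h2)"
    by (rule comult_presentation)
  have bil: "bilinear_over sH sH sH (\<lambda>h1 h2. sH (pair (x i) h1) h2)"
    "bilinear_over sH sH sH (\<lambda>h1 h2. sH (pair (x i) h2) h1)" for i
    by (intro bilinear_overI linmap_intros)+
  have lin: "linmap sH (*) (pair u)" for u
    by (intro linmap_intros)
  let ?L = "\<lambda>i. \<Sum>z\<leftarrow>xs. sH (pair (x i) (fst z)) (snd z)"
  let ?R = "\<Sum>z\<leftarrow>xs. sH (pair (x j) (snd z)) (fst z)"
  have prod: "\<forall>\<^sub>F (a, b) in N \<times>\<^sub>F N. \<iota> h (mul a b) = (\<Sum>z\<leftarrow>xs. \<iota> (fst z) a * \<iota> (snd z) b)"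
    using \<iota>_comult[OF xs] by (simp add: case_prod_unfold)
  have ev_conj: "\<forall>\<^sub>F a in N. \<forall>z\<in>set xs. \<exists>k. \<forall>\<^sub>F y in N. \<iota> (fst z) (mul (mul a y) (ginv a)) = \<iota> k y"
    by (simp add: eventually_ball_finite \<iota>_conjugate)
  have ev_prod: "\<forall>\<^sub>F a in N. \<forall>\<^sub>F y in N. \<iota> h (mul a y) = (\<Sum>z\<leftarrow>xs. \<iota> (fst z) a * \<iota> (snd z) y)"
    using eventually_prod_nested[OF prod] by simp
  have "\<forall>\<^sub>F (a, y) in N \<times>\<^sub>F N. \<iota> h (mul (mul (mul a y) (ginv a)) a)
      = (\<Sum>z\<leftarrow>xs. \<iota> (fst z) (mul (mul a y) (ginv a)) * \<iota> (snd z) a)"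
    using eventually_compose_filterlim[OF prod translate(3)] by (simp add: case_prod_unfold)
  then have ev_conj_prod: "\<forall>\<^sub>F a in N. \<forall>\<^sub>F y in N. \<iota> h (mul a y)
      = (\<Sum>z\<leftarrow>xs. \<iota> (fst z) (mul (mul a y) (ginv a)) * \<iota> (snd z) a)"
    by (auto dest: eventually_prod_nested simp: G.assoc)
  have ev_M: "\<forall>\<^sub>F a in N. \<forall>i\<in>{1..n}. \<iota> (\<O> i j) a = M i j a"
    using M j by (simp add: eventually_ball_finite germ_eq_def)
  have ev_mult: "\<forall>\<^sub>F a in N. \<forall>i\<in>{1..n}. \<iota> (\<O> i j * ?L i) a = \<iota> (\<O> i j) a * \<iota> (?L i) a"
    by (simp add: eventually_ball_finite \<iota>_mult)
  have ev_L: "\<forall>\<^sub>F a in N. \<forall>i\<in>{1..n}. \<iota> (?L i) a = (\<Sum>z\<leftarrow>xs. pair (x i) (fst z) * \<iota> (snd z) a)"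
    by (simp add: eventually_ball_finite \<iota>_combination)
  have ev_R: "\<forall>\<^sub>F a in N. \<iota> ?R a = (\<Sum>z\<leftarrow>xs. pair (x j) (snd z) * \<iota> (fst z) a)"
    by (rule \<iota>_combination)
  have "\<forall>\<^sub>F a in N. \<iota> (\<Sum>i\<in>{1..n}. \<O> i j * ?L i) a = \<iota> ?R a"
    using ev_conj ev_prod ev_conj_prod ev_M ev_mult ev_L ev_R \<iota>_sum[of "\<lambda>i. \<O> i j * ?L i" "{1..n}"]
  proof eventually_elim
    case (elim a)
    obtain k where k: "\<And>z. z \<in> set xs \<Longrightarrow> \<forall>\<^sub>F y in N. \<iota> (fst z) (mul (mul a y) (ginv a)) = \<iota> (k z) y"
      using elim(1) by metis
    have pair_k: "(\<Sum>i\<in>{1..n}. M i j a * pair (x i) (fst z)) = pair (x j) (k z)" if z: "z \<in> set xs" for z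
    proof -
      have "germ_eq N (\<lambda>y. \<rho> (x j) (\<lambda>y. \<iota> (fst z) (mul (mul a y) (ginv a))) (mul (mul (ginv a) y) a))
          (\<lambda>y. \<Sum>i\<in>{1..n}. M i j a * \<rho> (x i) (\<iota> (fst z)) y)"
        using adjoint j \<iota>_in unfolding adjoint_matrix_def by blast
      then have "\<rho> (x j) (\<lambda>y. \<iota> (fst z) (mul (mul a y) (ginv a))) (mul (mul (ginv a) e) a)
          = (\<Sum>i\<in>{1..n}. M i j a * \<rho> (x i) (\<iota> (fst z)) e)"
        unfolding germ_eq_def by (rule at_unit)
      \<comment> \<open>At the unit the conjugated argument on the left is the unit again.\<close>
      moreover have "mul (mul (ginv a) e) a = e"
        by (simp add: G.assoc G.group_left_neutral)
      ultimately show ?thesis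
        using operator_at_unit[OF k[OF z]] by (simp add: pair_eq)
    qed
    have k_all: "\<forall>\<^sub>F y in N. \<forall>z\<in>set xs. \<iota> (fst z) (mul (mul a y) (ginv a)) = \<iota> (k z) y"
      using k by (simp add: eventually_ball_finite)
    have "(\<Sum>z\<leftarrow>xs. sH (\<iota> (snd z) a) (k z)) = (\<Sum>z\<leftarrow>xs. sH (\<iota> (fst z) a) (snd z))"
    proof (rule \<iota>_eqI)
      show "\<forall>\<^sub>F y in N. \<iota> (\<Sum>z\<leftarrow>xs. sH (\<iota> (snd z) a) (k z)) y = \<iota> (\<Sum>z\<leftarrow>xs. sH (\<iota> (fst z) a) (snd z)) y"
        using elim(2,3) k_all \<iota>_combination[of "\<lambda>z. \<iota> (snd z) a" k xs] \<iota>_combination[of "\<lambda>z. \<iota> (fst z) a" snd xs]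
      proof eventually_elim
        case (elim y)
        have "(\<Sum>z\<leftarrow>xs. \<iota> (snd z) a * \<iota> (k z) y) = (\<Sum>z\<leftarrow>xs. \<iota> (fst z) (mul (mul a y) (ginv a)) * \<iota> (snd z) a)"
          using elim(3) by (auto intro!: arg_cong[of _ _ sum_list] map_cong simp: mult.commute)
        then show ?case using elim by simp
      qed
    qed
    from arg_cong[OF this, of "pair (x j)"]
    have pair_sums: "(\<Sum>z\<leftarrow>xs. \<iota> (snd z) a * pair (x j) (k z)) = (\<Sum>z\<leftarrow>xs. \<iota> (fst z) a * pair (x j) (snd z))"
      by (simp add: linmap_sum_list[OF lin] linmap_scale[OF lin])
    have "\<iota> (\<Sum>i\<in>{1..n}. \<O> i j * ?L i) a = (\<Sum>i\<in>{1..n}. M i j a * (\<Sum>z\<leftarrow>xs. pair (x i) (fst z) * \<iota> (snd z) a))"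
      unfolding elim(8) by (rule sum.cong[OF refl]) (use elim(4-6) in simp)
    also have "\<dots> = (\<Sum>z\<leftarrow>xs. \<iota> (snd z) a * (\<Sum>i\<in>{1..n}. M i j a * pair (x i) (fst z)))"
      by (induction xs) (simp_all add: distrib_left sum.distrib sum_distrib_left mult.commute mult.left_commute)
    also have "\<dots> = (\<Sum>z\<leftarrow>xs. \<iota> (snd z) a * pair (x j) (k z))"
      by (rule arg_cong[of _ _ sum_list], rule map_cong[OF refl], simp only: pair_k)
    finally show ?case unfolding pair_sums elim(7) by (simp add: mult.commute)
  qed
  then have "(\<Sum>i\<in>{1..n}. \<O> i j * ?L i) = ?R" by (rule \<iota>_eqI)
  then show ?thesis
    unfolding xs sweedler_sum_list[OF bil(1)] sweedler_sum_list[OF bil(2)] by (simp add: case_prod_unfold)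
qed

end

lemma lie_group_case_intertwiner:
  fixes \<O> :: "nat \<Rightarrow> nat \<Rightarrow> 'h::ring_1" and mul :: "'p::{t2_space,second_countable_topology} \<Rightarrow> 'p \<Rightarrow> 'p"
    and sA :: "'k::field \<Rightarrow> 'a::ring_1 \<Rightarrow> 'a"
  assumes "hopf_pairing sA \<Delta>A \<epsilon>A SA sH \<Delta>H \<epsilon>H SH pair"
    and lie_case: "lie_group_function_case N mul e ginv B m \<A> sA inc sH \<Delta>H \<epsilon>H SH pair n X \<O> \<O>'"
    and N: "N = top \<or> N = nhds e"
  shows "\<And>h k. h * k = (k * h :: 'h)"
    and "\<And>j h. j \<in> {1..n} \<Longrightarrow>
      (\<Sum>i\<in>{1..n}. \<O> i j * sweedler sH sH (\<lambda>h1 h2. sH (pair (inc (X i)) h1) h2) (\<Delta>H h))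
      = sweedler sH sH (\<lambda>h1 h2. sH (pair (inc (X j)) h2) h1) (\<Delta>H h)"
proof -
  obtain \<phi> F \<iota> \<rho> M where lie: "lie_group B m \<A> mul e ginv"
    and F: "F = smooth_functions B m \<A> \<phi> N"
    and \<rho>: "acts_by_left_invariant_derivations N mul F sA inc \<rho>"
    and \<iota>: "transposed_subalgebra N mul e ginv F sH \<Delta>H \<epsilon>H SH \<iota>"
    and pair: "\<And>u h. pair u h = \<rho> u (\<iota> h) e"
    and adjoint: "adjoint_matrix N mul ginv F n (\<lambda>j. \<rho> (inc (X j))) M"
    and M: "\<And>i j. i \<in> {1..n} \<Longrightarrow> j \<in> {1..n} \<Longrightarrow> germ_eq N (\<iota> (\<O> i j)) (M i j)"
    using lie_case unfolding lie_group_function_case_def by blast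
  interpret P: hopf_pairing sA \<Delta>A \<epsilon>A SA sH \<Delta>H \<epsilon>H SH pair by fact
  interpret function_pairing sA \<Delta>A \<epsilon>A SA sH \<Delta>H \<epsilon>H SH pair mul e ginv N F \<iota> \<rho>
  proof (intro function_pairing.intro P.hopf_pairing_axioms function_pairing_axioms.intro)
    show "Groups.group mul e ginv" using lie by (simp add: lie_group_def)
    show "P e" if "eventually P N" for P
      using that N by (auto dest: eventually_nhds_x_imp_x)
    show "f' \<in> F" if "f \<in> F" "germ_eq N f f'" for f f'
      using smooth_functions_germ_closed[OF _ N] that lie by (auto simp: F lie_group_def)
    show "linear_operator N F (\<rho> u)" for u
      using \<rho> by (simp add: acts_by_left_invariant_derivations_def)
  qed (fact \<iota> pair lie_group_filterlim[OF lie N])+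
  show "h * k = k * h" for h k :: 'h by (rule \<iota>_commute)
  show "(\<Sum>i\<in>{1..n}. \<O> i j * sweedler sH sH (\<lambda>h1 h2. sH (pair (inc (X i)) h1) h2) (\<Delta>H h))
      = sweedler sH sH (\<lambda>h1 h2. sH (pair (inc (X j)) h2) h1) (\<Delta>H h)" if "j \<in> {1..n}" for j h
    by (rule intertwiner_if_adjoint_matrix[OF adjoint M that])
qed

section \<open>The theorem\<close>

lemma (in vector_space) basis_coordinates:
  assumes "is_basis scale n X"
  obtains c where "\<And>i. linmap scale (*) (\<lambda>x. c x i)" "\<And>x. (\<Sum>i\<in>{1..n}. scale (c x i) (X i)) = x"
    "\<And>i j. i \<in> {1..n} \<Longrightarrow> j \<in> {1..n} \<Longrightarrow> c (X j) i = (if i = j then 1 else 0)"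
proof
  let ?B = "X ` {1..n}"
  have X: "inj_on X {1..n}" "independent ?B" "span ?B = UNIV"
    using assms by (auto simp: is_basis_def)
  let ?c = "\<lambda>x i. representation ?B x (X i)"
  show "linmap scale (*) (\<lambda>x. ?c x i)" for i
    by (rule linmapI)
      (use X in \<open>simp_all add: representation_add representation_scale vector_space_axioms vector_space_field\<close>)
  show "(\<Sum>i\<in>{1..n}. scale (?c x i) (X i)) = x" for x
    using sum_representation_eq[of ?B x ?B] X by (simp add: sum.reindex)
  show "?c (X j) i = (if i = j then 1 else 0)" if "i \<in> {1..n}" "j \<in> {1..n}" for i j
    using X(1) representation_basis[OF X(2), of "X j"] that by (auto dest: inj_onD)
qed

lemma coaction_extending_unique:
  assumes generated: "matrix_generated sH \<Delta>H \<epsilon>H sA multA unitA act {1..n} X M p"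
    and exists: "\<exists>coact. generator_coaction sH \<Delta>H \<epsilon>H sA multA unitA act {1..n} X M p coact"
  shows "(\<exists>!coact. coaction_extending sH \<Delta>H sA multA unitA act n X M coact) \<and>
    (\<forall>coact. coaction_extending sH \<Delta>H sA multA unitA act n X M coact \<longrightarrow>
      yetter_drinfeld_module_algebra sH \<Delta>H \<epsilon>H sA multA unitA act coact \<and>
      braided_commutative sH sA multA act coact)"
proof -
  have "coaction_extending sH \<Delta>H sA multA unitA act n X M coact
      \<longleftrightarrow> generator_coaction sH \<Delta>H \<epsilon>H sA multA unitA act {1..n} X M p coact" for coact
  proof
    assume "coaction_extending sH \<Delta>H sA multA unitA act n X M coact"
    then show "generator_coaction sH \<Delta>H \<epsilon>H sA multA unitA act {1..n} X M p coact"
      unfolding coaction_extending_def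
      by (intro matrix_generated.generator_coaction_if_antimultiplicative[OF generated]) blast+
  next
    assume "generator_coaction sH \<Delta>H \<epsilon>H sA multA unitA act {1..n} X M p coact"
    then interpret generator_coaction sH \<Delta>H \<epsilon>H sA multA unitA act "{1..n}" X M p coact .
    show "coaction_extending sH \<Delta>H sA multA unitA act n X M coact"
      unfolding coaction_extending_def using antimultiplicative coact_generator by blast
  qed
  then show ?thesis
    using exists matrix_generated.generator_coaction_unique[OF generated]
      generator_coaction.yetter_drinfeld generator_coaction.braided_commutative
    by metis
qed

theorem theorem6p1:
  fixes sg :: "'k::field \<Rightarrow> 'g::ab_group_add \<Rightarrow> 'g" and bracket :: "'g \<Rightarrow> 'g \<Rightarrow> 'g"
    and n :: nat and X :: "nat \<Rightarrow> 'g" and C :: "nat \<Rightarrow> nat \<Rightarrow> nat \<Rightarrow> 'k"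
    and sU :: "'k \<Rightarrow> 'u::ring_1 \<Rightarrow> 'u" and \<Delta>U \<epsilon>U SU and inc :: "'g \<Rightarrow> 'u"
    and sH :: "'k \<Rightarrow> 'h::ring_1 \<Rightarrow> 'h" and \<Delta>H \<epsilon>H SH
    and pair :: "'u \<Rightarrow> 'h \<Rightarrow> 'k"
    and \<O> \<O>' :: "nat \<Rightarrow> nat \<Rightarrow> 'h"
  assumes lie: "lie_algebra sg bracket"
    and basis: "is_basis sg n X"
    and structure_constants: "\<And>i j. i \<in> {1..n} \<Longrightarrow> j \<in> {1..n} \<Longrightarrow>
      bracket (X i) (X j) = (\<Sum>k\<in>{1..n}. sg (C i j k) (X k))"
    and enveloping: "enveloping_hopf_algebra sg bracket sU \<Delta>U \<epsilon>U SU inc"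
    and hopf: "hopf_algebra sH \<Delta>H \<epsilon>H SH"
    and pairing: "hopf_pairing sU \<Delta>U \<epsilon>U SU sH \<Delta>H \<epsilon>H SH pair"
    and pair_O: "\<And>i j k. i \<in> {1..n} \<Longrightarrow> j \<in> {1..n} \<Longrightarrow> k \<in> {1..n} \<Longrightarrow>
      pair (inc (X k)) (\<O> i j) = C k j i"
    and C_O: "\<And>i j k. i \<in> {1..n} \<Longrightarrow> j \<in> {1..n} \<Longrightarrow> k \<in> {1..n} \<Longrightarrow>
      (\<Sum>l\<in>{1..n}. \<Sum>m\<in>{1..n}. sH (C l m k) (\<O> l i * \<O> m j)) =
      (\<Sum>r\<in>{1..n}. sH (C i j r) (\<O> k r))"
    and O_inverse: "inverse_matrix n \<O> \<O>'"
    and comult_O: "\<And>i j. i \<in> {1..n} \<Longrightarrow> j \<in> {1..n} \<Longrightarrow>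
      \<Delta>H (\<O> i j) = (\<Sum>k\<in>{1..n}. tens sH sH (\<O> i k) (\<O> k j))"
    and comult_O': "\<And>i j. i \<in> {1..n} \<Longrightarrow> j \<in> {1..n} \<Longrightarrow>
      \<Delta>H (\<O>' i j) = (\<Sum>k\<in>{1..n}. tens sH sH (\<O>' k j) (\<O>' i k))"
    and counit_O: "\<And>i j. i \<in> {1..n} \<Longrightarrow> j \<in> {1..n} \<Longrightarrow> \<epsilon>H (\<O> i j) = (if i = j then 1 else 0)"
    and counit_O': "\<And>i j. i \<in> {1..n} \<Longrightarrow> j \<in> {1..n} \<Longrightarrow> \<epsilon>H (\<O>' i j) = (if i = j then 1 else 0)"
    and antipode_O: "\<And>i j. i \<in> {1..n} \<Longrightarrow> j \<in> {1..n} \<Longrightarrow> SH (\<O> i j) = \<O>' i j"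
    and antipode_O': "\<And>i j. i \<in> {1..n} \<Longrightarrow> j \<in> {1..n} \<Longrightarrow> SH (\<O>' i j) = \<O> i j"
    and cases:
      "(\<exists>(mul :: 'p::{t2_space,second_countable_topology} \<Rightarrow> 'p \<Rightarrow> 'p) e ginv B m \<A>.
          lie_group_function_case top mul e ginv B m \<A> sU inc sH \<Delta>H \<epsilon>H SH pair n X \<O> \<O>')
       \<or> (\<exists>(mul :: 'p \<Rightarrow> 'p \<Rightarrow> 'p) e ginv B m \<A>.
          lie_group_function_case (nhds e) mul e ginv B m \<A> sU inc sH \<Delta>H \<epsilon>H SH pair n X \<O> \<O>')
       \<or> (\<exists>(sA :: 'k \<Rightarrow> 'a::comm_ring_1 \<Rightarrow> 'a) \<Delta>A \<epsilon>A SA.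
          algebraic_group_case sA \<Delta>A \<epsilon>A SA sU inc sH \<Delta>H \<epsilon>H SH pair n X \<O>)
       \<or> nondegenerate_right pair"
  shows
    "(\<exists>!coact'. coaction_extending sH \<Delta>H sU (*) 1 (pairing_action sU \<Delta>U pair) n (\<lambda>i. inc (X i)) \<O>' coact')
     \<and> (\<forall>coact'. coaction_extending sH \<Delta>H sU (*) 1 (pairing_action sU \<Delta>U pair) n (\<lambda>i. inc (X i)) \<O>' coact' \<longrightarrow>
          yetter_drinfeld_module_algebra sH \<Delta>H \<epsilon>H sU (*) 1 (pairing_action sU \<Delta>U pair) coact' \<and>
          braided_commutative sH sU (*) (pairing_action sU \<Delta>U pair) coact')
     \<and> (\<exists>!coact. coaction_extending sH (co_opposite sH \<Delta>H) sU (\<lambda>a b. b * a) 1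
            (pairing_action sU \<Delta>U pair) n (\<lambda>i. inc (X i)) \<O> coact)
     \<and> (\<forall>coact. coaction_extending sH (co_opposite sH \<Delta>H) sU (\<lambda>a b. b * a) 1
            (pairing_action sU \<Delta>U pair) n (\<lambda>i. inc (X i)) \<O> coact \<longrightarrow>
          yetter_drinfeld_module_algebra sH (co_opposite sH \<Delta>H) \<epsilon>H sU (\<lambda>a b. b * a) 1
            (pairing_action sU \<Delta>U pair) coact \<and>
          braided_commutative sH sU (\<lambda>a b. b * a) (pairing_action sU \<Delta>U pair) coact)"
proof -
  interpret P: hopf_pairing sU \<Delta>U \<epsilon>U SU sH \<Delta>H \<epsilon>H SH pair by (rule pairing)
  interpret E: enveloping_hopf_algebra sg bracket sU \<Delta>U \<epsilon>U SU inc by (rule enveloping)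
  obtain c where c: "\<And>i. linmap sg (*) (\<lambda>x. c x i)" "\<And>x. (\<Sum>i\<in>{1..n}. sg (c x i) (X i)) = x"
    "\<And>i j. i \<in> {1..n} \<Longrightarrow> j \<in> {1..n} \<Longrightarrow> c (X j) i = (if i = j then 1 else 0)"
    by (rule E.L.basis_coordinates[OF basis], rule that)
  interpret S: structure_matrices sg bracket sU \<Delta>U \<epsilon>U SU inc sH \<Delta>H \<epsilon>H SH pair "{1..n}" X c C \<O> \<O>'
  proof (intro structure_matrices.intro enveloping pairing structure_matrices_axioms.intro finite_atLeastAtMost
      c structure_constants pair_O C_O comult_O comult_O' counit_O counit_O' antipode_O; assumption?)
    show "(\<Sum>j\<in>{1..n}. \<O> i j * \<O>' j k) = (if i = k then 1 else 0)"
      "(\<Sum>j\<in>{1..n}. \<O>' i j * \<O> j k) = (if i = k then 1 else 0)" if "i \<in> {1..n}" "k \<in> {1..n}" for i k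
      using O_inverse that by (simp_all only: inverse_matrix_def)
  qed
  have "(\<forall>h k. h * k = (k * h :: 'h)) \<and> (\<forall>j\<in>{1..n}. \<forall>h.
      (\<Sum>i\<in>{1..n}. \<O> i j * sweedler sH sH (\<lambda>h1 h2. sH (pair (inc (X i)) h1) h2) (\<Delta>H h))
      = sweedler sH sH (\<lambda>h1 h2. sH (pair (inc (X j)) h2) h1) (\<Delta>H h))"
    using cases
  proof (elim disjE exE)
    fix mul :: "'p \<Rightarrow> 'p \<Rightarrow> 'p" and e ginv B m \<A>
    assume "lie_group_function_case top mul e ginv B m \<A> sU inc sH \<Delta>H \<epsilon>H SH pair n X \<O> \<O>'"
    from lie_group_case_intertwiner[OF pairing this] show ?thesis by blast
  next
    fix mul :: "'p \<Rightarrow> 'p \<Rightarrow> 'p" and e ginv B m \<A>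
    assume "lie_group_function_case (nhds e) mul e ginv B m \<A> sU inc sH \<Delta>H \<epsilon>H SH pair n X \<O> \<O>'"
    from lie_group_case_intertwiner[OF pairing this] show ?thesis by blast
  next
    fix sA :: "'k \<Rightarrow> 'a \<Rightarrow> 'a" and \<Delta>A \<epsilon>A SA
    assume "algebraic_group_case sA \<Delta>A \<epsilon>A SA sU inc sH \<Delta>H \<epsilon>H SH pair n X \<O>"
    from P.algebraic_group_case_intertwiner[OF this] show ?thesis by blast
  next
    assume "nondegenerate_right pair"
    from S.commutative_if_nondegenerate[OF this] S.intertwiner_if_nondegenerate[OF this]
    show ?thesis by blast
  qed
  then interpret adjoint_matrices sg bracket sU \<Delta>U \<epsilon>U SU inc sH \<Delta>H \<epsilon>H SH pair "{1..n}" X c C \<O> \<O>'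
    by (intro adjoint_matrices.intro S.structure_matrices_axioms adjoint_matrices_axioms.intro) blast+
  show ?thesis
    using coaction_extending_unique[OF plain.matrix_generated_axioms coaction_exists]
      coaction_extending_unique[OF opposite.matrix_generated_axioms opposite_coaction_exists]
    by blast
qed

end
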